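(* Let $\omega$ be a weight on $\mathbf R^{2d}$ and let $\mathscr B$ be a mixed quasi-norm space on $\mathbf R^{2d}\simeq\mathbf C^d$. Then the following is true: (1) $A(\omega,\mathscr B)$, $B(\omega,\mathscr B)$ and $M(\omega,\mathscr B)$ are quasi-Banach spaces. If in addition $\nu_1(\mathscr B)\ge1$, then $A(\omega,\mathscr B)$, $B(\omega,\mathscr B)$ and $M(\omega,\mathscr B)$ are Banach spaces; (2) the Bargmann transform is isometric and bijective from $M(\omega,\mathscr B)$ to $A(\omega,\mathscr B)$.
   Context: A weight on $\mathbf R^{2d}$ is a positive function $\omega$ such that $\omega,1/\omega\in L^\infty_{loc}(\mathbf R^{2d})$. $\mathscr B$ is a mixed quasi-norm space on $\mathbf R^{2d}$ if there are $p_1,\dots,p_n\in(0,\infty]$ and subspaces $V_1,\dots,V_n$ with $V_1\oplus\cdots\oplus V_n=\mathbf R^{2d}$ such that $\mathscr B=\mathscr B_n$, where $\mathscr B_1=L^{p_1}(V_1)$ and $\mathscr B_j=L^{p_j}(V_j;\mathscr B_{j-1})$, $j=2,\dots,n$ (iterated quasi-norm $\|\cdot\|_{\mathscr B}$); $\nu_1(\mathscr B)=\min(p_1,\dots,p_n)$. Identify $(x,\xi)\in\mathbf R^{2d}$ with $z=x+i\xi\in\mathbf C^d$. Let $(U_{\mathfrak V}F)(x,\xi)=(2\pi)^{d/2}e^{\frac12(|x|^2+|\xi|^2)}e^{-i\langle x,\xi\rangle}F(2^{1/2}x,-2^{1/2}\xi)$. With $0<r\le\nu_1(\mathscr B)$,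 $B(\omega,\mathscr B)$ is the set of all $F\in L^r_{loc}(\mathbf C^d)$ with $\|F\|_{B(\omega,\mathscr B)}=\|(U_{\mathfrak V}^{-1}F)\omega\|_{\mathscr B}<\infty$, and $A(\omega,\mathscr B)=A(\mathbf C^d)\cap B(\omega,\mathscr B)$ with topology (quasi-norm) inherited from $B(\omega,\mathscr B)$, where $A(\mathbf C^d)$ is the set of entire functions. Let $h_\alpha(x)=\pi^{-d/4}(-1)^{|\alpha|}(2^{|\alpha|}\alpha!)^{-1/2}e^{|x|^2/2}\partial^\alpha e^{-|x|^2}$, $\alpha\in\mathbf N^d$, be the Hermite functions. $\mathcal H_{\flat_1}'(\mathbf R^d)$ is the space of formal Hermite series $f=\sum_{\alpha\in\mathbf N^d}c_\alpha h_\alpha$ such that for every $r>0$ there is $C>0$ with $|c_\alpha|\le Cr^{|\alpha|}(\alpha!)^{1/2}$ for all $\alpha$. The Bargmann transform of such $f$ is the entire function $(\mathfrak V_df)(z)=\sum_\alpha c_\alpha z^\alpha/\sqrt{\alpha!}$ (this agrees with $\pi^{-d/4}\int_{\mathbf R^d}\exp(-\frac12(\langle z,z\rangle+|y|^2)+2^{1/2}\langle z,y\rangle)f(y)\,dy$ when $f\in L^2(\mathbf R^d)$, where $\langle z,w\rangle=\sum_jz_jw_j$). With $\phi(x)=\pi^{-d/4}e^{-|x|^2/2}$, the short-time Fourier transform is $V_\phi f=U_{\mathfrak V}^{-1}(\mathfrak V_df)$ (which equals $(2\pi)^{-d/2}\int f(y)\overline{\phi(y-x)}e^{-i\langle y,\xi\rangle}dy$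 for $f\in L^2$). $M(\omega,\mathscr B)$ is the set of all $f\in\mathcal H_{\flat_1}'(\mathbf R^d)$ with $\|f\|_{M(\omega,\mathscr B)}=\|V_\phi f\cdot\omega\|_{\mathscr B}<\infty$. *)

theory Defs
  imports
    "HOL-Analysis.Analysis"
    "HOL-Probability.Essential_Supremum"
    "HOL-Library.Function_Algebras"
begin

section \<open>Lebesgue quasi-norms\<close>

definition ennreal_powr :: "ennreal \<Rightarrow> real \<Rightarrow> ennreal" where
  "ennreal_powr x a = (if x = \<infinity> then \<infinity> else ennreal (enn2real x powr a))"

text \<open>
  The quasi-norm of \<open>L\<^sup>p\<close>, \<open>0 < p \<le> \<infinity>\<close>, on nonnegative functions; it is applied to the absolute value
  (or to the iterated quasi-norm) of the function in question.
\<close>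

definition Lp_qnorm :: "'a measure \<Rightarrow> ennreal \<Rightarrow> ('a \<Rightarrow> ennreal) \<Rightarrow> ennreal" where
  "Lp_qnorm M p f =
     (if p = \<infinity> then esssup M f
      else ennreal_powr (\<integral>\<^sup>+x. ennreal_powr (f x) (enn2real p) \<partial>M) (1 / enn2real p))"

definition Lp_loc :: "ennreal \<Rightarrow> ('a::euclidean_space \<Rightarrow> 'b::real_normed_vector) set" where
  "Lp_loc p = {f \<in> borel_measurable lebesgue.
     \<forall>K. compact K \<longrightarrow> Lp_qnorm (lebesgue_on K) p (\<lambda>x. ennreal (norm (f x))) < \<infinity>}"

definition weight :: "('a::euclidean_space \<Rightarrow> real) \<Rightarrow> bool" where
  "weight \<omega> \<longleftrightarrow> (\<forall>x. 0 < \<omega> x) \<and> \<omega> \<in> Lp_loc \<infinity> \<and> (\<lambda>x. 1 / \<omega> x) \<in> Lp_loc \<infinity>"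


section \<open>Mixed quasi-norm spaces\<close>

definition orthonormal_basis_of :: "'a::euclidean_space set \<Rightarrow> 'a set \<Rightarrow> bool" where
  "orthonormal_basis_of V B \<longleftrightarrow>
     B \<subseteq> V \<and> pairwise orthogonal B \<and> (\<forall>b\<in>B. norm b = 1) \<and> span B = V"

text \<open>
  The Lebesgue measure of the Euclidean space \<open>V\<close>, regarded as a measure on the ambient space that is
  concentrated on \<open>V\<close>. It does not depend on the chosen orthonormal basis; for \<open>V = {0}\<close> it is the unit
  point mass at the origin. Note that the library's \<open>lebesgue_on V\<close> is the restriction of the Lebesgue
  measure of the ambient space, which vanishes for proper subspaces.
\<close>

definition subspace_lebesgue :: "'a::euclidean_space set \<Rightarrow> 'a measure" where
  "subspace_lebesgue V =
     (let B = (SOME B. orthonormal_basis_of V B) in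
       completion (distr (Pi\<^sub>M B (\<lambda>_. lborel)) borel (\<lambda>c. \<Sum>b\<in>B. c b *\<^sub>R b)))"

definition direct_sum_decomposition :: "'a::real_vector set list \<Rightarrow> bool" where
  "direct_sum_decomposition Vs \<longleftrightarrow>
     (\<forall>V\<in>set Vs. subspace V) \<and> (\<forall>x. \<exists>!vs. list_all2 (\<in>) vs Vs \<and> sum_list vs = x)"

text \<open>
  A mixed quasi-norm space is given by the list \<open>[(p\<^sub>1, V\<^sub>1), \<dots>, (p\<^sub>n, V\<^sub>n)]\<close>; the head of the list
  belongs to the innermost quasi-norm.
\<close>

type_synonym 'a mixed_space = "(ennreal \<times> 'a set) list"

definition mixed_quasi_norm_space :: "'a::euclidean_space mixed_space \<Rightarrow> bool" where
  "mixed_quasi_norm_space \<B> \<longleftrightarrow>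
     \<B> \<noteq> [] \<and> (\<forall>p\<in>set (map fst \<B>). 0 < p) \<and> direct_sum_decomposition (map snd \<B>)"

definition \<nu>\<^sub>1 :: "'a mixed_space \<Rightarrow> ennreal" where
  "\<nu>\<^sub>1 \<B> = Min (set (map fst \<B>))"

text \<open>
  For \<open>\<B> = [(p\<^sub>1, V\<^sub>1), \<dots>, (p\<^sub>n, V\<^sub>n)]\<close> this unfolds to the \<open>L\<^bsup>p\<^sub>n\<^esup>(V\<^sub>n)\<close> quasi-norm in \<open>v\<^sub>n\<close> of \<open>\<dots>\<close> of the
  \<open>L\<^bsup>p\<^sub>1\<^esup>(V\<^sub>1)\<close> quasi-norm in \<open>v\<^sub>1\<close> of \<open>f (v\<^sub>1 + \<dots> + v\<^sub>n)\<close>.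
\<close>

fun mixed_qnorm :: "'a::euclidean_space mixed_space \<Rightarrow> ('a \<Rightarrow> ennreal) \<Rightarrow> ennreal" where
  "mixed_qnorm [] f = f 0"
| "mixed_qnorm ((p, V) # \<B>) f =
     mixed_qnorm \<B> (\<lambda>w. Lp_qnorm (subspace_lebesgue V) p (\<lambda>v. f (v + w)))"


section \<open>Quasi-Banach and Banach spaces\<close>

text \<open>
  Complex (quasi-)Banach spaces whose underlying vector space is a linear subspace \<open>X\<close> of an ambient
  type, with (quasi-)norm \<open>N\<close> on \<open>X\<close>. The real number \<open>C\<close> is the constant of the quasi-triangle inequality.
\<close>

definition quasi_norm_on :: "real \<Rightarrow> (complex \<Rightarrow> 'v::ab_group_add \<Rightarrow> 'v) \<Rightarrow> 'v set \<Rightarrow> ('v \<Rightarrow> real) \<Rightarrow> bool" where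
  "quasi_norm_on C smul X N \<longleftrightarrow>
     (\<forall>x\<in>X. 0 \<le> N x) \<and>
     (\<forall>x\<in>X. N x = 0 \<longleftrightarrow> x = 0) \<and>
     (\<forall>c. \<forall>x\<in>X. N (smul c x) = cmod c * N x) \<and>
     (\<forall>x\<in>X. \<forall>y\<in>X. N (x + y) \<le> C * (N x + N y))"

definition complete_wrt :: "'v::ab_group_add set \<Rightarrow> ('v \<Rightarrow> real) \<Rightarrow> bool" where
  "complete_wrt X N \<longleftrightarrow>
     (\<forall>u :: nat \<Rightarrow> 'v. range u \<subseteq> X \<longrightarrow>
        (\<forall>\<epsilon>>0. \<exists>n\<^sub>0. \<forall>m\<ge>n\<^sub>0. \<forall>n\<ge>n\<^sub>0. N (u m - u n) < \<epsilon>) \<longrightarrow>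
        (\<exists>x\<in>X. (\<lambda>n. N (u n - x)) \<longlonglongrightarrow> 0))"

definition quasi_banach_space :: "(complex \<Rightarrow> 'v::ab_group_add \<Rightarrow> 'v) \<Rightarrow> 'v set \<Rightarrow> ('v \<Rightarrow> real) \<Rightarrow> bool" where
  "quasi_banach_space smul X N \<longleftrightarrow>
     vector_space smul \<and> module.subspace smul X \<and>
     (\<exists>C\<ge>1. quasi_norm_on C smul X N) \<and> complete_wrt X N"

definition banach_space :: "(complex \<Rightarrow> 'v::ab_group_add \<Rightarrow> 'v) \<Rightarrow> 'v set \<Rightarrow> ('v \<Rightarrow> real) \<Rightarrow> bool" where
  "banach_space smul X N \<longleftrightarrow>
     vector_space smul \<and> module.subspace smul X \<and>
     quasi_norm_on 1 smul X N \<and> complete_wrt X N"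

definition isometric_on ::
  "'v::ab_group_add set \<Rightarrow> ('v \<Rightarrow> real) \<Rightarrow> ('w::ab_group_add \<Rightarrow> real) \<Rightarrow> ('v \<Rightarrow> 'w) \<Rightarrow> bool" where
  "isometric_on X N\<^sub>X N\<^sub>Y T \<longleftrightarrow>
     (\<forall>x\<in>X. N\<^sub>Y (T x) = N\<^sub>X x) \<and> (\<forall>x\<in>X. \<forall>y\<in>X. N\<^sub>Y (T x - T y) = N\<^sub>X (x - y))"

definition fun_scale :: "complex \<Rightarrow> ('a \<Rightarrow> complex) \<Rightarrow> 'a \<Rightarrow> complex" where
  "fun_scale c f = (\<lambda>x. c * f x)"


section \<open>Functions modulo equality almost everywhere\<close>

quotient_type (overloaded) 'a ae_fun = "'a::euclidean_space \<Rightarrow> complex" /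
  "\<lambda>f g. AE x in lebesgue. f x = g x"
  by (rule equivpI) (auto simp: reflp_def symp_def transp_def elim: AE_mp)

instantiation ae_fun :: (euclidean_space) ab_group_add
begin

lift_definition zero_ae_fun :: "'a ae_fun" is "\<lambda>_. 0" .

lift_definition plus_ae_fun :: "'a ae_fun \<Rightarrow> 'a ae_fun \<Rightarrow> 'a ae_fun" is "\<lambda>f g x. f x + g x"
  by (auto elim!: eventually_elim2)

lift_definition uminus_ae_fun :: "'a ae_fun \<Rightarrow> 'a ae_fun" is "\<lambda>f x. - f x"
  by auto

lift_definition minus_ae_fun :: "'a ae_fun \<Rightarrow> 'a ae_fun \<Rightarrow> 'a ae_fun" is "\<lambda>f g x. f x - g x"
  by (auto elim!: eventually_elim2)

instance
  by standard (transfer; simp add: algebra_simps)+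

end

lift_definition ae_scale :: "complex \<Rightarrow> 'a::euclidean_space ae_fun \<Rightarrow> 'a ae_fun" is "\<lambda>c f x. c * f x"
  by (auto elim: eventually_mono)


section \<open>The operator \<open>U\<^sub>\<VV>\<close>\<close>

text \<open>
  \<open>\<real>\<^sup>2\<^sup>d\<close> is \<open>(real ^ 'd) \<times> (real ^ 'd)\<close>, with elements \<open>(x, \<xi>)\<close>, and is identified with
  \<open>complex ^ 'd\<close> by \<open>z = x + i\<xi>\<close>.
\<close>

definition Re_vec :: "complex ^ 'd \<Rightarrow> real ^ 'd" where
  "Re_vec z = (\<chi> j. Re (z $ j))"

definition Im_vec :: "complex ^ 'd \<Rightarrow> real ^ 'd" where
  "Im_vec z = (\<chi> j. Im (z $ j))"

definition U_op :: "((real ^ 'd) \<times> (real ^ 'd) \<Rightarrow> complex) \<Rightarrow> complex ^ 'd \<Rightarrow> complex" where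
  "U_op F = (\<lambda>z. let x = Re_vec z; \<xi> = Im_vec z in
     complex_of_real ((2 * pi) powr (real CARD('d) / 2) * exp (((norm x)\<^sup>2 + (norm \<xi>)\<^sup>2) / 2))
     * exp (- \<i> * complex_of_real (x \<bullet> \<xi>))
     * F (sqrt 2 *\<^sub>R x, - sqrt 2 *\<^sub>R \<xi>))"

lemma bij_U_op: "bij (U_op :: ((real ^ 'd) \<times> (real ^ 'd) \<Rightarrow> complex) \<Rightarrow> complex ^ 'd \<Rightarrow> complex)"
proof -
  define a :: "real ^ 'd \<Rightarrow> real ^ 'd \<Rightarrow> complex" where
    "a x \<xi> = complex_of_real ((2 * pi) powr (real CARD('d) / 2) * exp (((norm x)\<^sup>2 + (norm \<xi>)\<^sup>2) / 2))
       * exp (- \<i> * complex_of_real (x \<bullet> \<xi>))" for x \<xi>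
  have a: "a x \<xi> \<noteq> 0" for x \<xi>
    by (simp add: a_def)
  define z where "z x \<xi> = (\<chi> j. Complex (x $ j) (\<xi> $ j))" for x \<xi> :: "real ^ 'd"
  have Re_z: "Re_vec (z x \<xi>) = x" and Im_z: "Im_vec (z x \<xi>) = \<xi>" for x \<xi>
    by (simp_all add: z_def Re_vec_def Im_vec_def vec_eq_iff)
  have z: "z (Re_vec w) (Im_vec w) = w" for w
    by (simp add: z_def Re_vec_def Im_vec_def vec_eq_iff)
  have U: "U_op F w = a (Re_vec w) (Im_vec w) * F (sqrt 2 *\<^sub>R Re_vec w, - sqrt 2 *\<^sub>R Im_vec w)"
    for F :: "(real ^ 'd) \<times> (real ^ 'd) \<Rightarrow> complex" and w
    by (simp add: U_op_def a_def Let_def)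
  define W where "W G = (\<lambda>(x, \<xi>). G (z (x /\<^sub>R sqrt 2) (- (\<xi> /\<^sub>R sqrt 2)))
     / a (x /\<^sub>R sqrt 2) (- (\<xi> /\<^sub>R sqrt 2)))" for G :: "complex ^ 'd \<Rightarrow> complex"
  have 1: "W (U_op F) = F" for F
    by (auto simp: fun_eq_iff W_def U Re_z Im_z a)
  have 2: "U_op (W G) = G" for G
    by (auto simp: fun_eq_iff W_def U z a)
  show ?thesis
    by (rule o_bij[of W]) (simp_all add: fun_eq_iff 1 2)
qed

definition phase_qnorm ::
  "((real ^ 'd) \<times> (real ^ 'd) \<Rightarrow> real) \<Rightarrow> ((real ^ 'd) \<times> (real ^ 'd)) mixed_space \<Rightarrow>
    ((real ^ 'd) \<times> (real ^ 'd) \<Rightarrow> complex) \<Rightarrow> ennreal" where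
  "phase_qnorm \<omega> \<B> F = mixed_qnorm \<B> (\<lambda>X. ennreal (cmod (F X * complex_of_real (\<omega> X))))"


section \<open>The spaces \<open>B(\<omega>, \<B>)\<close> and \<open>A(\<omega>, \<B>)\<close>\<close>

definition B_qnorm ::
  "((real ^ 'd) \<times> (real ^ 'd) \<Rightarrow> real) \<Rightarrow> ((real ^ 'd) \<times> (real ^ 'd)) mixed_space \<Rightarrow>
    (complex ^ 'd \<Rightarrow> complex) \<Rightarrow> ennreal" where
  "B_qnorm \<omega> \<B> F = phase_qnorm \<omega> \<B> (inv U_op F)"

definition B_functions ::
  "ennreal \<Rightarrow> ((real ^ 'd) \<times> (real ^ 'd) \<Rightarrow> real) \<Rightarrow> ((real ^ 'd) \<times> (real ^ 'd)) mixed_space \<Rightarrow>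
    (complex ^ 'd \<Rightarrow> complex) set" where
  "B_functions r \<omega> \<B> = {F \<in> Lp_loc r. B_qnorm \<omega> \<B> F < \<infinity>}"

text \<open>
  The elements of \<open>B(\<omega>, \<B>)\<close> are classes of functions modulo equality almost everywhere. The
  quasi-norm of a class is that of any of its members (iterated quasi-norms of functions that agree
  almost everywhere coincide); \<open>rep_ae_fun\<close> selects one.
\<close>

definition B_space ::
  "ennreal \<Rightarrow> ((real ^ 'd) \<times> (real ^ 'd) \<Rightarrow> real) \<Rightarrow> ((real ^ 'd) \<times> (real ^ 'd)) mixed_space \<Rightarrow>
    (complex ^ 'd) ae_fun set" where
  "B_space r \<omega> \<B> = abs_ae_fun ` B_functions r \<omega> \<B>"

definition B_norm ::
  "((real ^ 'd) \<times> (real ^ 'd) \<Rightarrow> real) \<Rightarrow> ((real ^ 'd) \<times> (real ^ 'd)) mixed_space \<Rightarrow>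
    (complex ^ 'd) ae_fun \<Rightarrow> real" where
  "B_norm \<omega> \<B> F = enn2real (B_qnorm \<omega> \<B> (rep_ae_fun F))"

definition entire :: "(complex ^ 'd \<Rightarrow> complex) \<Rightarrow> bool" where
  "entire F \<longleftrightarrow> (\<forall>z. \<exists>D. (F has_derivative D) (at z) \<and> (\<forall>c v. D (c *s v) = c * D v))"

definition A_space ::
  "ennreal \<Rightarrow> ((real ^ 'd) \<times> (real ^ 'd) \<Rightarrow> real) \<Rightarrow> ((real ^ 'd) \<times> (real ^ 'd)) mixed_space \<Rightarrow>
    (complex ^ 'd \<Rightarrow> complex) set" where
  "A_space r \<omega> \<B> = Collect entire \<inter> B_functions r \<omega> \<B>"

definition A_norm ::
  "((real ^ 'd) \<times> (real ^ 'd) \<Rightarrow> real) \<Rightarrow> ((real ^ 'd) \<times> (real ^ 'd)) mixed_space \<Rightarrow>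
    (complex ^ 'd \<Rightarrow> complex) \<Rightarrow> real" where
  "A_norm \<omega> \<B> F = enn2real (B_qnorm \<omega> \<B> F)"


section \<open>Formal Hermite series, Bargmann transform and \<open>M(\<omega>, \<B>)\<close>\<close>

text \<open>
  Multi-indices are functions \<open>'d \<Rightarrow> nat\<close>. A formal Hermite series \<open>\<Sum>\<^sub>\<alpha> c\<^sub>\<alpha> h\<^sub>\<alpha>\<close> carries exactly the data
  of its coefficients and is represented by the family \<open>c\<close>, with coefficientwise linear operations.
\<close>

type_synonym 'd hermite_series = "('d \<Rightarrow> nat) \<Rightarrow> complex"

definition mi_abs :: "('d::finite \<Rightarrow> nat) \<Rightarrow> nat" where
  "mi_abs \<alpha> = (\<Sum>j\<in>UNIV. \<alpha> j)"

definition mi_fact :: "('d::finite \<Rightarrow> nat) \<Rightarrow> real" where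
  "mi_fact \<alpha> = (\<Prod>j\<in>UNIV. fact (\<alpha> j))"

definition mi_power :: "complex ^ 'd \<Rightarrow> ('d::finite \<Rightarrow> nat) \<Rightarrow> complex" where
  "mi_power z \<alpha> = (\<Prod>j\<in>UNIV. (z $ j) ^ \<alpha> j)"

definition H_flat1' :: "'d::finite hermite_series set" where
  "H_flat1' = {c. \<forall>r>0. \<exists>C>0. \<forall>\<alpha>. cmod (c \<alpha>) \<le> C * r ^ mi_abs \<alpha> * sqrt (mi_fact \<alpha>)}"

definition bargmann :: "'d::finite hermite_series \<Rightarrow> complex ^ 'd \<Rightarrow> complex" where
  "bargmann c z = (\<Sum>\<^sub>\<infinity>\<alpha>. c \<alpha> * mi_power z \<alpha> / complex_of_real (sqrt (mi_fact \<alpha>)))"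

text \<open>The short-time Fourier transform with window \<open>\<phi>(x) = \<pi>\<^bsup>-d/4\<^esup> exp (-|x|\<^sup>2/2)\<close>.\<close>

definition stft :: "'d::finite hermite_series \<Rightarrow> (real ^ 'd) \<times> (real ^ 'd) \<Rightarrow> complex" where
  "stft c = inv U_op (bargmann c)"

definition M_space ::
  "((real ^ 'd) \<times> (real ^ 'd) \<Rightarrow> real) \<Rightarrow> ((real ^ 'd) \<times> (real ^ 'd)) mixed_space \<Rightarrow>
    'd::finite hermite_series set" where
  "M_space \<omega> \<B> = {c \<in> H_flat1'. phase_qnorm \<omega> \<B> (stft c) < \<infinity>}"

definition M_norm ::
  "((real ^ 'd) \<times> (real ^ 'd) \<Rightarrow> real) \<Rightarrow> ((real ^ 'd) \<times> (real ^ 'd)) mixed_space \<Rightarrow>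
    'd::finite hermite_series \<Rightarrow> real" where
  "M_norm \<omega> \<B> c = enn2real (phase_qnorm \<omega> \<B> (stft c))"

end

theory Submission
  imports
    Defs
    "HOL-Complex_Analysis.Cauchy_Integral_Formula"
    "HOL-Probability.Infinite_Product_Measure"
begin

text \<open>
  Everything is pulled back to \<open>complex ^ 'd\<close>, where the quasi-norm of \<open>B(\<omega>, \<B>)\<close> becomes \<open>N(|F| W)\<close> with a mixed
  quasi-norm \<open>N\<close> and a positive weight \<open>W\<close> that is locally bounded below. The Bargmann transform of a
  coefficient family \<open>c\<close> is the power series \<open>\<Sum>\<^sub>\<alpha> c\<^sub>\<alpha> z\<^sup>\<alpha> / sqrt \<alpha>!\<close>, and the growth condition on \<open>c\<close> says exactly
  that this series converges everywhere. As the short-time Fourier transform is defined through the Bargmann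
  transform, the latter is an isometric bijection of \<open>M(\<omega>, \<B>)\<close> onto \<open>A(\<omega>, \<B>)\<close> as soon as every entire
  function is known to have such an expansion (\<open>separately_holomorphic_power_series\<close>, by an iterated Cauchy formula
  on tori) and the coefficients are unique (\<open>torus_coeff_power_series\<close>). So \<open>M\<close> inherits its structure
  from \<open>A\<close>, and what remains is completeness of \<open>B\<close> and of its subspace \<open>A\<close>.

  The iterated quasi-norm satisfies, by induction over the layers, a quasi-triangle inequality, with constant
  one if all exponents are at least one, and monotone convergence. The obstacle is to compare it with
  Lebesgue measure of the whole space, since the subspaces need not be orthogonal and sections of measurable
  functions can be bad on null sets. The comparison uses only invariance under translations: averaging over
  translates and exchanging integrals shows that iterated null sets are Lebesgue null sets
  (\<open>mixed_AE_iff_AE_lborel\<close>) and that the quasi-norm controls \<open>L\<^sup>s\<close> integrals over bounded sets for every finite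
  \<open>s\<close> that is at most every exponent (\<open>nn_integral_bounded_le_mixed_qnorm\<close>). In particular a measurable function of finite
  quasi-norm lies in \<open>Lp_loc r\<close> (\<open>finite_norm_imp_Lp_loc\<close>), a function of quasi-norm zero vanishes almost everywhere, and the
  classical argument of Riesz and Fischer (\<open>Riesz_Fischer\<close>) shows that \<open>B\<close> is complete.

  For \<open>A\<close> one needs that quasi-norm convergence of entire functions is locally uniform. The modulus of an entire
  function has the sub-mean value property on balls (\<open>entire_sub_mean_value\<close>), and a maximum argument extends it
  to powers \<open>s \<le> 1\<close> (\<open>sub_mean_value_powr\<close>), which is necessary because exponents below one are allowed. Together
  with the local \<open>L\<^sup>s\<close> control this makes a Cauchy sequence converge locally uniformly, the limit is entire, and it
  agrees almost everywhere with the limit in \<open>B\<close> (\<open>entire_complete\<close>).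
\<close>

section \<open>Lebesgue quasi-norms\<close>

lemma ennreal_powr_ennreal: "0 \<le> x \<Longrightarrow> ennreal_powr (ennreal x) a = ennreal (x powr a)"
  by (simp add: ennreal_powr_def)

lemma ennreal_powr_0[simp]: "ennreal_powr 0 a = 0"
  by (simp add: ennreal_powr_def)

lemma ennreal_powr_top[simp]: "ennreal_powr top a = top"
  by (simp add: ennreal_powr_def)

lemma ennreal_powr_eq_0_iff[simp]: "ennreal_powr x a = 0 \<longleftrightarrow> x = 0"
  by (cases x) (auto simp: ennreal_powr_ennreal)

lemma ennreal_powr_less_top_iff[simp]: "ennreal_powr x a < top \<longleftrightarrow> x < top"
  by (cases x) (auto simp: ennreal_powr_ennreal)

lemma ennreal_powr_one[simp]: "ennreal_powr x 1 = x"
  by (cases x) (auto simp: ennreal_powr_ennreal)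

lemma ennreal_powr_mono: "0 < a \<Longrightarrow> x \<le> y \<Longrightarrow> ennreal_powr x a \<le> ennreal_powr y a"
  by (cases x; cases y) (auto simp: ennreal_powr_ennreal intro!: ennreal_leI powr_mono2 simp: top_unique)

lemma ennreal_powr_powr: "ennreal_powr (ennreal_powr x a) b = ennreal_powr x (a * b)"
  by (cases x) (auto simp: ennreal_powr_ennreal powr_powr)

lemma ennreal_powr_mult:
  "0 \<le> c \<Longrightarrow> ennreal_powr (ennreal c * x) a = ennreal (c powr a) * ennreal_powr x a"
  by (cases x; cases "c = 0")
    (auto simp: ennreal_powr_ennreal ennreal_mult_top powr_mult ennreal_mult simp flip: ennreal_mult)

lemma ennreal_powr_le_iff:
  assumes "0 < a"
  shows "ennreal_powr x (1 / a) \<le> c \<longleftrightarrow> x \<le> ennreal_powr c a"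
proof
  assume "ennreal_powr x (1 / a) \<le> c"
  from ennreal_powr_mono[OF assms this] show "x \<le> ennreal_powr c a"
    using assms by (simp add: ennreal_powr_powr)
next
  assume "x \<le> ennreal_powr c a"
  from ennreal_powr_mono[OF _ this, of "1 / a"] assms show "ennreal_powr x (1 / a) \<le> c"
    by (simp add: ennreal_powr_powr)
qed

lemma ennreal_powr_SUP:
  assumes "0 < a"
  shows "ennreal_powr (SUP i\<in>I. f i) a = (SUP i\<in>I. ennreal_powr (f i) a)"
proof (rule antisym)
  have 1: "f i \<le> ennreal_powr (SUP i\<in>I. ennreal_powr (f i) a) (1 / a)" if "i \<in> I" for i
    by (rule ennreal_powr_le_iff[of "1/a" "f i", THEN iffD1])
      (use assms that in \<open>auto intro!: SUP_upper\<close>)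
  have "(SUP i\<in>I. f i) \<le> ennreal_powr (SUP i\<in>I. ennreal_powr (f i) a) (1 / a)"
    by (rule SUP_least) (rule 1)
  from ennreal_powr_mono[OF assms this]
  show "ennreal_powr (SUP i\<in>I. f i) a \<le> (SUP i\<in>I. ennreal_powr (f i) a)"
    using assms by (simp add: ennreal_powr_powr)
qed (auto intro!: SUP_least ennreal_powr_mono assms SUP_upper)

lemma borel_measurable_ennreal_powr[measurable (raw)]:
  assumes [measurable]: "f \<in> borel_measurable M"
  shows "(\<lambda>x. ennreal_powr (f x) a) \<in> borel_measurable M"
  unfolding ennreal_powr_def by measurable

text \<open>
  On the open half line this is convexity of the power function. If \<open>x\<close> or \<open>y\<close> vanishes, the
  inequality reduces to \<open>u powr q \<le> u\<close>, which holds since \<open>u \<le> 1 \<le> q\<close>.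
\<close>

lemma convex_powr_nonneg:
  fixes x y u v q :: real
  assumes "1 \<le> q" "0 \<le> x" "0 \<le> y" "0 < u" "0 < v" "u + v = 1"
  shows "(u * x + v * y) powr q \<le> u * x powr q + v * y powr q"
proof -
  have pow: "w powr q \<le> w" if "0 < w" "w \<le> 1" for w
    using powr_mono'[of 1 q w] that assms by simp
  consider "x = 0" | "y = 0" | "0 < x" "0 < y" using assms by fastforce
  then show ?thesis
  proof cases
    case 1
    then show ?thesis
      using pow[of v] assms by (simp add: powr_mult mult_right_mono)
  next
    case 2
    then show ?thesis
      using pow[of u] assms by (simp add: powr_mult mult_right_mono)
  next
    case 3
    have u: "u = 1 - v" using assms by simp
    from 3 convex_onD[OF powr_convex[OF assms(1)], of v x y] assms show ?thesis
      by (simp add: u)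
  qed
qed

lemma Lp_qnorm_eq:
  "p \<noteq> \<infinity> \<Longrightarrow> Lp_qnorm M p f =
    ennreal_powr (\<integral>\<^sup>+x. ennreal_powr (f x) (enn2real p) \<partial>M) (1 / enn2real p)"
  "Lp_qnorm M top f = esssup M f"
  by (simp_all add: Lp_qnorm_def)

lemma enn2real_exponent: "0 < p \<Longrightarrow> p \<noteq> \<infinity> \<Longrightarrow> 0 < enn2real p"
  by (simp add: enn2real_positive_iff less_top[symmetric] order_neq_le_trans)

lemma esssup_le_iff:
  fixes f :: "'a \<Rightarrow> ennreal"
  assumes "f \<in> borel_measurable M"
  shows "esssup M f \<le> c \<longleftrightarrow> (AE x in M. f x \<le> c)"
  using esssup_AE[of f M] assms by (auto intro: esssup_I elim!: eventually_mono)

lemma Lp_qnorm_le_iff: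
  assumes "0 < p" "p \<noteq> \<infinity>"
  shows "Lp_qnorm M p f \<le> c \<longleftrightarrow>
    (\<integral>\<^sup>+x. ennreal_powr (f x) (enn2real p) \<partial>M) \<le> ennreal_powr c (enn2real p)"
  using assms enn2real_exponent[OF assms] by (simp add: Lp_qnorm_eq ennreal_powr_le_iff)

lemma Lp_qnorm_mono_AE:
  assumes "0 < p" "f \<in> borel_measurable M" "g \<in> borel_measurable M" "AE x in M. f x \<le> g x"
  shows "Lp_qnorm M p f \<le> Lp_qnorm M p g"
proof (cases "p = \<infinity>")
  case True
  then show ?thesis using assms by (simp add: Lp_qnorm_eq esssup_AE_mono)
next
  case False
  then show ?thesis
    using assms enn2real_exponent[OF assms(1)]
    by (auto simp: Lp_qnorm_eq intro!: ennreal_powr_mono nn_integral_mono_AE)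
qed

text \<open>
  As \<open>esssup\<close> is infinite on non-measurable functions, quasi-norms of classes modulo null sets are
  meaningful only because completeness of the measure protects measurability on null sets.
\<close>

lemma measurable_completion_AE_eq:
  assumes "f \<in> borel_measurable (completion M)" "AE x in M. f x = g x"
  shows "g \<in> borel_measurable (completion M)"
proof (rule measurableI)
  fix A :: "'b set" assume [measurable]: "A \<in> sets borel"
  have "f -` A \<inter> space M \<in> sets (completion M)"
    using measurable_sets[OF assms(1), of A] by simp
  moreover have "AE x in completion M. x \<in> f -` A \<inter> space M \<longleftrightarrow> x \<in> g -` A \<inter> space M"
    using assms(2) by (auto simp: AE_completion_iff elim!: eventually_mono)
  ultimately show "g -` A \<inter> space (completion M) \<in> sets (completion M)"
    using completion.in_sets_AE[where A="f -` A \<inter> space M" and B="g -` A \<inter> space M"] by auto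
qed auto

text \<open>
  Sections of a Lebesgue measurable function may fail to be measurable on an exceptional null set of
  fibres, so the functions here are arbitrary; completeness of the measure makes this possible.
\<close>

lemma Lp_qnorm_completion_cong_AE:
  assumes "AE x in M. f x = g x"
  shows "Lp_qnorm (completion M) p f = Lp_qnorm (completion M) p g"
proof (cases "p = \<infinity>")
  case True
  have "f \<in> borel_measurable (completion M) \<longleftrightarrow> g \<in> borel_measurable (completion M)"
    using assms by (auto intro: measurable_completion_AE_eq elim!: eventually_mono)
  then show ?thesis using True assms
    by (cases "f \<in> borel_measurable (completion M)")
       (auto simp: Lp_qnorm_eq esssup_non_measurable AE_completion_iff intro!: esssup_AE_cong)
next
  case False
  then show ?thesis
    using assms by (auto simp: Lp_qnorm_eq nn_integral_completion
        intro!: arg_cong2[where f=ennreal_powr] nn_integral_cong_AE elim!: eventually_mono)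
qed

lemma Lp_qnorm_completion:
  assumes "f \<in> borel_measurable M"
  shows "Lp_qnorm (completion M) p f = Lp_qnorm M p f"
  using assms measurable_completion[OF assms]
  by (auto simp: Lp_qnorm_def nn_integral_completion esssup_eq_AE AE_completion_iff)

lemma Lp_qnorm_cmult_le:
  assumes "0 < p" "f \<in> borel_measurable M" "0 \<le> c"
  shows "Lp_qnorm M p (\<lambda>x. ennreal c * f x) \<le> ennreal c * Lp_qnorm M p f"
proof (cases "p = \<infinity>")
  case True
  have "AE x in M. ennreal c * f x \<le> ennreal c * esssup M f"
    using esssup_AE[of f M] by (auto elim!: eventually_mono intro!: mult_left_mono)
  with assms show ?thesis unfolding True by (auto simp: Lp_qnorm_eq esssup_le_iff)
next
  case False
  note q = enn2real_exponent[OF assms(1) False]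
  show ?thesis
    using assms False q
    by (simp add: Lp_qnorm_eq ennreal_powr_mult nn_integral_cmult powr_powr)
qed

lemma Lp_qnorm_eq_0_AE:
  assumes "0 < p" "f \<in> borel_measurable M" "Lp_qnorm M p f = 0"
  shows "AE x in M. f x = 0"
proof (cases "p = \<infinity>")
  case True
  with assms esssup_le_iff[of f M 0] show ?thesis by (simp add: Lp_qnorm_eq)
next
  case False
  with assms have "(\<integral>\<^sup>+x. ennreal_powr (f x) (enn2real p) \<partial>M) = 0"
    by (simp add: Lp_qnorm_eq)
  then show ?thesis using assms by (simp add: nn_integral_0_iff_AE)
qed

definition quasi_triangle_const :: "ennreal \<Rightarrow> real" where
  "quasi_triangle_const p = (if 1 \<le> p then 1 else 2 * 2 powr (1 / enn2real p))"

lemma quasi_triangle_const_ge_1: "1 \<le> quasi_triangle_const p"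
proof -
  have "(1::real) \<le> 2 powr (1 / enn2real p)" by (rule ge_one_powr_ge_zero) auto
  then show ?thesis by (simp add: quasi_triangle_const_def)
qed

text \<open>
  A pointwise inequality between powers becomes a bound for the quasi-norm of a sum. Convexity supplies
  the pointwise inequality with the sharp constant for \<open>p \<ge> 1\<close>, and a comparison with the maximum
  supplies a crude one for every \<open>p\<close>.
\<close>

lemma Lp_qnorm_add_le:
  fixes a b c A B :: real
  assumes p: "0 < p" "p \<noteq> \<infinity>" and [measurable]: "f \<in> borel_measurable M" "g \<in> borel_measurable M"
    and ab: "0 < a" "0 < b" "Lp_qnorm M p f \<le> ennreal a" "Lp_qnorm M p g \<le> ennreal b"
    and q: "q = enn2real p" and AB: "0 < A" "0 < B"
    and pointwise: "\<And>x y. 0 \<le> x \<Longrightarrow> 0 \<le> y \<Longrightarrow> (x + y) powr q \<le> A * x powr q + B * y powr q"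
    and c: "0 \<le> c" "A * a powr q + B * b powr q \<le> c powr q"
  shows "Lp_qnorm M p (\<lambda>x. f x + g x) \<le> ennreal c"
proof -
  have pt: "ennreal_powr (f x + g x) q \<le> ennreal A * ennreal_powr (f x) q + ennreal B * ennreal_powr (g x) q" for x
    using pointwise AB
    by (cases "f x"; cases "g x")
       (auto simp: ennreal_powr_ennreal ennreal_mult_top ennreal_leI
             simp flip: ennreal_plus ennreal_mult)
  have fin: "(\<integral>\<^sup>+x. ennreal_powr (f x) q \<partial>M) \<le> ennreal (a powr q)"
    "(\<integral>\<^sup>+x. ennreal_powr (g x) q \<partial>M) \<le> ennreal (b powr q)"
    using ab Lp_qnorm_le_iff[OF p, of M _ "ennreal _"]
    by (simp_all add: q[symmetric] ennreal_powr_ennreal)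
  have "(\<integral>\<^sup>+x. ennreal_powr (f x + g x) q \<partial>M)
      \<le> (\<integral>\<^sup>+x. ennreal A * ennreal_powr (f x) q + ennreal B * ennreal_powr (g x) q \<partial>M)"
    by (intro nn_integral_mono pt)
  also have "\<dots> = ennreal A * (\<integral>\<^sup>+x. ennreal_powr (f x) q \<partial>M)
      + ennreal B * (\<integral>\<^sup>+x. ennreal_powr (g x) q \<partial>M)"
    by (simp add: nn_integral_add nn_integral_cmult)
  also have "\<dots> \<le> ennreal A * ennreal (a powr q) + ennreal B * ennreal (b powr q)"
    by (intro add_mono mult_left_mono fin) auto
  also have "\<dots> = ennreal (A * a powr q + B * b powr q)"
    using AB by (simp flip: ennreal_mult ennreal_plus)
  also have "\<dots> \<le> ennreal_powr (ennreal c) q"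
    using c by (simp add: ennreal_powr_ennreal ennreal_leI)
  finally show ?thesis
    unfolding q Lp_qnorm_le_iff[OF p] .
qed

text \<open>
  Minkowski's inequality: normalise \<open>f\<close> and \<open>g\<close> by the bounds \<open>a\<close> and \<open>b\<close> and write \<open>(f + g) / (a + b)\<close>
  as a convex combination of \<open>f / a\<close> and \<open>g / b\<close>. Working with positive real bounds instead of the
  norms themselves avoids the cases where a norm is zero or infinite.
\<close>

lemma minkowski_bound:
  fixes a b :: real
  assumes "1 \<le> p" "p \<noteq> \<infinity>" and "f \<in> borel_measurable M" "g \<in> borel_measurable M"
    and ab: "0 < a" "0 < b" "Lp_qnorm M p f \<le> ennreal a" "Lp_qnorm M p g \<le> ennreal b"
  shows "Lp_qnorm M p (\<lambda>x. f x + g x) \<le> ennreal (a + b)"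
proof -
  define q where "q = enn2real p"
  have q: "1 \<le> q" "0 < p"
    using assms(1,2) enn2real_mono[of 1 p] by (auto simp: q_def less_top intro: order_less_le_trans[of 0 1])
  define u where "u = a / (a + b)"
  define v where "v = b / (a + b)"
  have uv: "0 < u" "0 < v" "u + v = 1"
    using ab by (auto simp: u_def v_def add_divide_distrib[symmetric])
  (* The weights of the convex combination, with the normalisations multiplied out. *)
  define A where "A = (a + b) powr q * u / a powr q"
  define B where "B = (a + b) powr q * v / b powr q"
  have AB: "0 < A" "0 < B" using ab uv by (auto simp: A_def B_def)
  show ?thesis
  proof (rule Lp_qnorm_add_le[OF q(2) assms(2-4) ab q_def AB])
    fix x y :: real assume xy: "0 \<le> x" "0 \<le> y"
    have "x + y = (a + b) * (u * (x / a) + v * (y / b))"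
      using ab by (simp add: u_def v_def divide_simps)
    then have "(x + y) powr q = (a + b) powr q * (u * (x / a) + v * (y / b)) powr q"
      using ab xy uv by (simp add: powr_mult)
    also have "\<dots> \<le> (a + b) powr q * (u * (x / a) powr q + v * (y / b) powr q)"
      using ab xy uv q by (intro mult_left_mono convex_powr_nonneg) auto
    also have "\<dots> = A * x powr q + B * y powr q"
      using ab xy by (simp add: A_def B_def powr_divide field_simps)
    finally show "(x + y) powr q \<le> A * x powr q + B * y powr q" .
  next
    have "A * a powr q + B * b powr q = (a + b) powr q * (u + v)"
      using ab by (simp add: A_def B_def distrib_left)
    then show "A * a powr q + B * b powr q \<le> (a + b) powr q" by (simp add: uv(3))
  qed (use ab in auto)
qed

lemma crude_triangle_bound:
  fixes a b :: real
  assumes p: "0 < p" "p \<noteq> \<infinity>" and fg: "f \<in> borel_measurable M" "g \<in> borel_measurable M"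
    and ab: "0 < a" "0 < b" "Lp_qnorm M p f \<le> ennreal a" "Lp_qnorm M p g \<le> ennreal b"
  shows "Lp_qnorm M p (\<lambda>x. f x + g x) \<le> ennreal (2 * 2 powr (1 / enn2real p) * (a + b))"
proof -
  define q where "q = enn2real p"
  have q: "0 < q" using enn2real_exponent[OF p] by (simp add: q_def)
  show ?thesis
  proof (rule Lp_qnorm_add_le[OF p fg ab q_def, of "2 powr q" "2 powr q"])
    fix x y :: real assume xy: "0 \<le> x" "0 \<le> y"
    have "(x + y) powr q \<le> (2 * max x y) powr q" using xy q by (intro powr_mono2) auto
    also have "\<dots> \<le> 2 powr q * x powr q + 2 powr q * y powr q"
      using xy by (auto simp: powr_mult max_def)
    finally show "(x + y) powr q \<le> 2 powr q * x powr q + 2 powr q * y powr q" .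
  next
    have "a powr q \<le> (a + b) powr q" "b powr q \<le> (a + b) powr q"
      using ab q by (auto intro!: powr_mono2)
    then have "2 powr q * (a powr q + b powr q) \<le> 2 powr q * (2 * (a + b) powr q)"
      by (intro mult_left_mono) auto
    also have "\<dots> = (2 * 2 powr (1 / enn2real p) * (a + b)) powr q"
      using ab q by (simp add: powr_mult powr_powr flip: q_def)
    finally show "2 powr q * a powr q + 2 powr q * b powr q \<le> (2 * 2 powr (1 / enn2real p) * (a + b)) powr q"
      by (simp add: distrib_left)
  qed (use ab in auto)
qed

lemma Lp_qnorm_triangle:
  assumes p: "0 < p" and [measurable]: "f \<in> borel_measurable M" "g \<in> borel_measurable M"
  shows "Lp_qnorm M p (\<lambda>x. f x + g x)
    \<le> ennreal (quasi_triangle_const p) * (Lp_qnorm M p f + Lp_qnorm M p g)"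
proof (cases "p = \<infinity>")
  case True
  have "AE x in M. f x + g x \<le> esssup M f + esssup M g"
    using esssup_AE[of f M] esssup_AE[of g M] by eventually_elim (rule add_mono)
  then show ?thesis
    using assms by (auto simp: True Lp_qnorm_eq quasi_triangle_const_def intro!: esssup_I)
next
  case False
  let ?C = "quasi_triangle_const p"
  have C: "1 \<le> ?C" by (rule quasi_triangle_const_ge_1)
  show ?thesis
  proof (cases "Lp_qnorm M p f = top \<or> Lp_qnorm M p g = top")
    case True
    with C have "ennreal ?C * (Lp_qnorm M p f + Lp_qnorm M p g) = top"
      by (auto simp: ennreal_mult_top)
    then show ?thesis by simp
  next
    case fin: False
    then obtain a b where ab: "Lp_qnorm M p f = ennreal a" "Lp_qnorm M p g = ennreal b" "0 \<le> a" "0 \<le> b"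
      by (metis ennreal_cases)
    show ?thesis
    proof (rule ennreal_le_epsilon)
      fix e :: real assume e: "0 < e"
      define d where "d = e / (2 * ?C)"
      have d: "0 < d" using e C by (simp add: d_def)
      have "Lp_qnorm M p (\<lambda>x. f x + g x) \<le> ennreal (?C * ((a + d) + (b + d)))"
      proof (cases "1 \<le> p")
        case True
        then show ?thesis
          using minkowski_bound[OF True False assms(2,3), of "a + d" "b + d"] d ab
          by (simp add: quasi_triangle_const_def ennreal_leI)
      next
        case F: False
        then show ?thesis
          using crude_triangle_bound[OF p False assms(2,3), of "a + d" "b + d"] d ab
          by (simp add: quasi_triangle_const_def ennreal_leI)
      qed
      also have "?C * ((a + d) + (b + d)) = ?C * (a + b) + e"
        using C by (simp add: d_def field_simps)
      also have "ennreal \<dots> = ennreal ?C * (Lp_qnorm M p f + Lp_qnorm M p g) + ennreal e"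
        using C ab e by (simp add: ennreal_mult)
      finally show "Lp_qnorm M p (\<lambda>x. f x + g x)
        \<le> ennreal ?C * (Lp_qnorm M p f + Lp_qnorm M p g) + ennreal e" .
    qed
  qed
qed

lemma Lp_qnorm_SUP_le:
  fixes f :: "nat \<Rightarrow> 'a \<Rightarrow> ennreal"
  assumes "0 < p" and [measurable]: "\<And>n. f n \<in> borel_measurable M" and "incseq f"
  shows "Lp_qnorm M p (\<lambda>x. SUP n. f n x) \<le> (SUP n. Lp_qnorm M p (f n))"
proof (cases "p = \<infinity>")
  case True
  have "AE x in M. \<forall>n. f n x \<le> esssup M (f n)"
    unfolding AE_all_countable by (intro allI esssup_AE)
  then have "AE x in M. (SUP n. f n x) \<le> (SUP n. esssup M (f n))"
    by eventually_elim (auto intro!: SUP_mono)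
  then show ?thesis by (simp add: True Lp_qnorm_eq esssup_I)
next
  case False
  note q = enn2real_exponent[OF assms(1) False]
  have inc: "incseq (\<lambda>n x. ennreal_powr (f n x) (enn2real p))"
    using assms(3) q by (auto simp: incseq_def le_fun_def intro!: ennreal_powr_mono)
  show ?thesis
    using False q inc
    by (simp add: Lp_qnorm_eq ennreal_powr_SUP nn_integral_monotone_convergence_SUP)
qed

text \<open>
  On a set of finite measure the higher exponent controls the lower one. For finite \<open>p\<close>, with \<open>a\<close> the \<open>p\<close>-quasi-norm of
  \<open>f\<close>, the bound comes from integrating \<open>f powr s \<le> a powr s + a powr (s - p) * f powr p\<close>, whose two terms
  dominate where \<open>f \<le> a\<close> and where \<open>f > a\<close>, respectively.
\<close>

lemma nn_integral_powr_le_Lp_qnorm: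
  fixes s :: real
  assumes s: "0 < s" "ennreal s \<le> p" and [measurable]: "f \<in> borel_measurable M" "A \<in> sets M"
  shows "(\<integral>\<^sup>+x. ennreal_powr (f x) s * indicator A x \<partial>M)
    \<le> (1 + emeasure M A) * ennreal_powr (Lp_qnorm M p f) s"
proof -
  have p: "0 < p" using s by (metis ennreal_less_zero_iff order_less_le_trans)
  consider "Lp_qnorm M p f = 0" | "Lp_qnorm M p f = top"
    | a where "Lp_qnorm M p f = ennreal a" "0 < a"
    by (cases "Lp_qnorm M p f") (auto simp: le_less)
  then show ?thesis
  proof cases
    case 1
    from Lp_qnorm_eq_0_AE[OF p _ 1] have "AE x in M. ennreal_powr (f x) s * indicator A x = 0"
      by (auto elim!: eventually_mono)
    then have "(\<integral>\<^sup>+x. ennreal_powr (f x) s * indicator A x \<partial>M) = 0"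
      by (subst nn_integral_0_iff_AE) auto
    then show ?thesis by simp
  next
    case 2
    then show ?thesis by (simp add: ennreal_mult_top)
  next
    case (3 a)
    show ?thesis
    proof (cases "p = \<infinity>")
      case True
      have "AE x in M. ennreal_powr (f x) s * indicator A x \<le> ennreal (a powr s) * indicator A x"
        using esssup_AE[of f M] 3
        by (auto simp: True Lp_qnorm_eq ennreal_powr_ennreal indicator_def
              dest: ennreal_powr_mono[OF s(1)] elim!: eventually_mono)
      then have "(\<integral>\<^sup>+x. ennreal_powr (f x) s * indicator A x \<partial>M) \<le> (\<integral>\<^sup>+x. ennreal (a powr s) * indicator A x \<partial>M)"
        by (rule nn_integral_mono_AE)
      also have "\<dots> = emeasure M A * ennreal (a powr s)"
        by (subst nn_integral_cmult_indicator) (simp_all add: mult.commute)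
      also have "\<dots> \<le> (1 + emeasure M A) * ennreal (a powr s)"
        by (intro mult_right_mono) auto
      finally show ?thesis using 3 by (simp add: ennreal_powr_ennreal)
    next
      case False
      define q where "q = enn2real p"
      have q: "0 < q" using enn2real_exponent[OF p False] by (simp add: q_def)
      have sq: "s \<le> q" using enn2real_mono[OF s(2)] False s(1) by (simp add: q_def less_top)
      (* The first term dominates for x <= a, the second one for x > a. *)
      have real: "x powr s \<le> a powr s + a powr (s - q) * x powr q" if "0 \<le> x" for x
      proof (cases "x \<le> a")
        case True
        then have "x powr s \<le> a powr s" using that s by (intro powr_mono2) auto
        then show ?thesis by (simp add: add_increasing2)
      next
        case xa: False
        then have "x powr (s - q) \<le> a powr (s - q)" using 3 sq by (intro powr_mono2') auto
        then have "x powr (s - q) * x powr q \<le> a powr (s - q) * x powr q" by (intro mult_right_mono) auto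
        then show ?thesis using xa 3 by (simp add: add_increasing flip: powr_add)
      qed
      have pt: "ennreal_powr (f x) s * indicator A x
          \<le> ennreal (a powr s) * indicator A x + ennreal (a powr (s - q)) * ennreal_powr (f x) q" for x
        using real 3
        by (cases "f x")
           (auto simp: ennreal_powr_ennreal indicator_def ennreal_mult_top ennreal_leI
               simp flip: ennreal_plus ennreal_mult)
      have "(\<integral>\<^sup>+x. ennreal_powr (f x) q \<partial>M) \<le> ennreal (a powr q)"
        using 3 Lp_qnorm_le_iff[OF p False, of M f "ennreal a"] by (simp add: q_def ennreal_powr_ennreal)
      note fin = this
      have "(\<integral>\<^sup>+x. ennreal_powr (f x) s * indicator A x \<partial>M)
          \<le> (\<integral>\<^sup>+x. ennreal (a powr s) * indicator A x + ennreal (a powr (s - q)) * ennreal_powr (f x) q \<partial>M)"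
        by (intro nn_integral_mono pt)
      also have "\<dots> = ennreal (a powr s) * emeasure M A
          + ennreal (a powr (s - q)) * (\<integral>\<^sup>+x. ennreal_powr (f x) q \<partial>M)"
        by (simp add: nn_integral_add nn_integral_cmult nn_integral_cmult_indicator)
      also have "\<dots> \<le> ennreal (a powr s) * emeasure M A + ennreal (a powr (s - q)) * ennreal (a powr q)"
        by (intro add_mono mult_left_mono fin) auto
      also have "\<dots> = (1 + emeasure M A) * ennreal (a powr s)"
        using 3 by (simp add: distrib_right distrib_left mult.commute add.commute flip: ennreal_mult powr_add)
      finally show ?thesis using 3 by (simp add: ennreal_powr_ennreal)
    qed
  qed
qed

section \<open>Quasi-norms of sections and Lebesgue measure on subspaces\<close>

text \<open>
  This keeps iterated essential suprema and iterated null sets within the Borel sets.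
\<close>

lemma sets_Collect_AE:
  assumes "sigma_finite_measure M"
    and P: "{x \<in> space (N \<Otimes>\<^sub>M M). P (fst x) (snd x)} \<in> sets (N \<Otimes>\<^sub>M M)"
  shows "{w \<in> space N. AE v in M. P w v} \<in> sets N"
proof -
  interpret sigma_finite_measure M by fact
  let ?Q = "{x \<in> space (N \<Otimes>\<^sub>M M). \<not> P (fst x) (snd x)}"
  have Q: "?Q \<in> sets (N \<Otimes>\<^sub>M M)"
    using sets.compl_sets[OF P] by (rule back_subst[where P="\<lambda>A. A \<in> _"]) auto
  have [measurable]: "(\<lambda>w. emeasure M (Pair w -` ?Q)) \<in> borel_measurable N"
    by (rule measurable_emeasure_Pair[OF Q])
  have "(AE v in M. P w v) \<longleftrightarrow> emeasure M (Pair w -` ?Q) = 0" if "w \<in> space N" for w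
  proof -
    have eq: "Pair w -` ?Q = {v \<in> space M. \<not> P w v}"
      using that by (auto simp: space_pair_measure)
    then show ?thesis
      using sets_Pair1[OF Q, of w] by (simp add: AE_iff_measurable[OF _ refl])
  qed
  then have "{w \<in> space N. AE v in M. P w v} = {w \<in> space N. emeasure M (Pair w -` ?Q) = 0}"
    by auto
  also have "\<dots> \<in> sets N" by measurable
  finally show ?thesis .
qed

lemma borel_measurable_Lp_qnorm:
  assumes "sigma_finite_measure M" and [measurable]: "case_prod f \<in> borel_measurable (N \<Otimes>\<^sub>M M)"
  shows "(\<lambda>w. Lp_qnorm M p (f w)) \<in> borel_measurable N"
proof (cases "p = \<infinity>")
  case False
  interpret sigma_finite_measure M by fact
  show ?thesis using False by (simp add: Lp_qnorm_eq)
next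
  case True
  have "(\<lambda>w. esssup M (f w)) \<in> borel_measurable N"
  proof (rule borel_measurableI_le)
    fix c
    have meas: "f w \<in> borel_measurable M" if "w \<in> space N" for w
      using that by measurable
    have "{w \<in> space N. esssup M (f w) \<le> c} = {w \<in> space N. AE v in M. f w v \<le> c}"
      using meas by (auto simp: esssup_le_iff)
    also have "\<dots> \<in> sets N" by (rule sets_Collect_AE[OF assms(1)]) measurable
    finally show "{w \<in> space N. esssup M (f w) \<le> c} \<in> sets N" .
  qed
  then show ?thesis by (simp add: True Lp_qnorm_eq)
qed

lemma Lp_qnorm_distr:
  assumes "T \<in> measurable M N" "f \<in> borel_measurable N"
  shows "Lp_qnorm (distr M N T) p f = Lp_qnorm M p (\<lambda>x. f (T x))"
proof (cases "p = \<infinity>")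
  case True
  have "(AE x in distr M N T. f x \<le> z) \<longleftrightarrow> (AE x in M. f (T x) \<le> z)" for z
    using assms by (intro AE_distr_iff) auto
  moreover have "(\<lambda>x. f (T x)) \<in> borel_measurable M"
    using measurable_comp[OF assms] by (simp add: comp_def)
  ultimately show ?thesis using assms by (simp add: True Lp_qnorm_eq esssup_eq_AE)
next
  case False
  then show ?thesis using assms by (simp add: Lp_qnorm_eq nn_integral_distr)
qed

definition chosen_basis :: "'a::euclidean_space set \<Rightarrow> 'a set" where
  "chosen_basis V = (SOME B. orthonormal_basis_of V B)"

text \<open>
  The measure on the Borel sets whose completion is the Lebesgue measure of the subspace. Iterated
  integrals are computed with it, because Tonelli's theorem needs product \<open>\<sigma>\<close>-algebras.
\<close>

definition subspace_lborel :: "'a::euclidean_space set \<Rightarrow> 'a measure" where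
  "subspace_lborel V =
     distr (Pi\<^sub>M (chosen_basis V) (\<lambda>_. lborel)) borel (\<lambda>c. \<Sum>b\<in>chosen_basis V. c b *\<^sub>R b)"

lemma subspace_lebesgue_eq_completion: "subspace_lebesgue V = completion (subspace_lborel V)"
  by (simp add: subspace_lebesgue_def subspace_lborel_def chosen_basis_def Let_def)

lemma sets_subspace_lborel[measurable_cong, simp]: "sets (subspace_lborel V) = sets borel"
  by (simp add: subspace_lborel_def)

lemma space_subspace_lborel[simp]: "space (subspace_lborel V) = UNIV"
  by (simp add: subspace_lborel_def)

lemma coordinate_sum_measurable[measurable]:
  fixes B :: "'a::euclidean_space set"
  shows "(\<lambda>c. \<Sum>b\<in>B. c b *\<^sub>R b) \<in> borel_measurable (Pi\<^sub>M B (\<lambda>_. lborel :: real measure))"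
  by (intro borel_measurable_sum borel_measurable_scaleR borel_measurable_const)
    (use measurable_component_singleton[of _ B "\<lambda>_. lborel"] in simp)

lemma chosen_basis:
  fixes V :: "'a::euclidean_space set"
  assumes "subspace V"
  shows "orthonormal_basis_of V (chosen_basis V)"
proof -
  obtain B where "B \<subseteq> V" "pairwise orthogonal B" "\<And>x. x \<in> B \<Longrightarrow> norm x = 1"
    "independent B" "card B = dim V" "span B = V"
    using orthonormal_basis_subspace[OF assms] by metis
  then have "orthonormal_basis_of V B" by (auto simp: orthonormal_basis_of_def)
  then show ?thesis unfolding chosen_basis_def by (rule someI)
qed

lemma finite_orthonormal_basis: "orthonormal_basis_of V B \<Longrightarrow> finite B"
  unfolding orthonormal_basis_of_def by (intro pairwise_orthogonal_imp_finite) auto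

lemma orthonormal_coordinate:
  assumes "orthonormal_basis_of V B" "b \<in> B"
  shows "(\<Sum>b'\<in>B. c b' *\<^sub>R b') \<bullet> b = c b"
proof -
  have "(\<Sum>b'\<in>B. c b' *\<^sub>R b') \<bullet> b = (\<Sum>b'\<in>B. if b' = b then c b else 0)"
    unfolding inner_sum_left
    using assms by (intro sum.cong)
      (auto simp: orthonormal_basis_of_def pairwise_def orthogonal_def dot_square_norm)
  also have "\<dots> = c b"
    using assms finite_orthonormal_basis[OF assms(1)] by simp
  finally show ?thesis .
qed

lemma orthonormal_expansion:
  assumes "orthonormal_basis_of V B" "u \<in> V"
  obtains c where "u = (\<Sum>b\<in>B. c b *\<^sub>R b)"
proof -
  have "u \<in> range (\<lambda>c. \<Sum>b\<in>B. c b *\<^sub>R b)"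
    using assms span_finite[OF finite_orthonormal_basis[OF assms(1)]]
    by (simp add: orthonormal_basis_of_def)
  then show thesis using that by blast
qed

interpretation lborel_product: product_sigma_finite "\<lambda>_. lborel :: real measure" by standard

lemma PiM_lborel_translate:
  assumes "finite B"
  shows "distr (Pi\<^sub>M B (\<lambda>_. lborel :: real measure)) (Pi\<^sub>M B (\<lambda>_. lborel))
    (\<lambda>c. \<lambda>b\<in>B. a b + c b) = Pi\<^sub>M B (\<lambda>_. lborel)"
proof (rule lborel_product.PiM_eqI[OF assms])
  fix A :: "'a \<Rightarrow> real set" assume A: "\<And>i. i \<in> B \<Longrightarrow> A i \<in> sets lborel"
  let ?P = "Pi\<^sub>M B (\<lambda>_. lborel :: real measure)"
  have [measurable]: "(\<lambda>c. \<lambda>b\<in>B. a b + c b) \<in> measurable ?P ?P" by measurable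
  have shift: "emeasure lborel {x. a i + x \<in> A i} = emeasure lborel (A i)" "{x. a i + x \<in> A i} \<in> sets lborel"
    if "i \<in> B" for i
  proof -
    have [measurable]: "A i \<in> sets borel" using A[OF that] by simp
    have "emeasure (distr lborel borel ((+) (a i))) (A i) = emeasure lborel ((+) (a i) -` A i \<inter> space lborel)"
      by (rule emeasure_distr) auto
    then show "emeasure lborel {x. a i + x \<in> A i} = emeasure lborel (A i)"
      by (simp add: lborel_distr_plus vimage_def)
    show "{x. a i + x \<in> A i} \<in> sets lborel" by measurable
  qed
  have "emeasure (distr ?P ?P (\<lambda>c. \<lambda>b\<in>B. a b + c b)) (Pi\<^sub>E B A)
      = emeasure ?P ((\<lambda>c. \<lambda>b\<in>B. a b + c b) -` Pi\<^sub>E B A \<inter> space ?P)"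
    using A assms by (intro emeasure_distr) (auto intro!: sets_PiM_I_finite)
  also have "(\<lambda>c. \<lambda>b\<in>B. a b + c b) -` Pi\<^sub>E B A \<inter> space ?P = Pi\<^sub>E B (\<lambda>i. {x. a i + x \<in> A i})"
    by (auto simp: space_PiM PiE_iff extensional_def)
  also have "emeasure ?P \<dots> = (\<Prod>i\<in>B. emeasure lborel {x. a i + x \<in> A i})"
    using assms shift(2) by (intro lborel_product.emeasure_PiM) auto
  also have "\<dots> = (\<Prod>i\<in>B. emeasure lborel (A i))"
    using shift(1) by simp
  finally show "emeasure (distr ?P ?P (\<lambda>c. \<lambda>b\<in>B. a b + c b)) (Pi\<^sub>E B A) = (\<Prod>i\<in>B. emeasure lborel (A i))" .
qed simp

text \<open>
  In coordinates with respect to the orthonormal basis a translation along \<open>V\<close> is a translation of each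
  coordinate.
\<close>

lemma subspace_lborel_translate:
  fixes V :: "'a::euclidean_space set"
  assumes "subspace V" "u \<in> V"
  shows "distr (subspace_lborel V) borel (\<lambda>v. v + u) = subspace_lborel V"
proof -
  let ?B = "chosen_basis V" let ?P = "Pi\<^sub>M ?B (\<lambda>_. lborel :: real measure)"
  let ?T = "\<lambda>c. \<Sum>b\<in>?B. c b *\<^sub>R b"
  note B = chosen_basis[OF assms(1)]
  from orthonormal_expansion[OF B assms(2)] obtain a where a: "u = ?T a" .
  have "distr (subspace_lborel V) borel (\<lambda>v. v + u) = distr ?P borel (\<lambda>c. ?T c + u)"
    unfolding subspace_lborel_def by (subst distr_distr) (auto simp: comp_def)
  also have "\<dots> = distr ?P borel (?T \<circ> (\<lambda>c. \<lambda>b\<in>?B. a b + c b))"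
    unfolding a by (intro distr_cong) (auto simp: scaleR_add_left sum.distrib add.commute)
  also have "\<dots> = distr (distr ?P ?P (\<lambda>c. \<lambda>b\<in>?B. a b + c b)) borel ?T"
    by (subst distr_distr) auto
  also have "\<dots> = subspace_lborel V"
    by (simp only: PiM_lborel_translate[OF finite_orthonormal_basis[OF B]] subspace_lborel_def)
  finally show ?thesis .
qed

text \<open>
  The coordinate map turns the slab into a box, whose product measure is finite.
\<close>

lemma emeasure_subspace_lborel_finite:
  fixes V :: "'a::euclidean_space set"
  assumes "subspace V"
  shows "emeasure (subspace_lborel V) {x. \<forall>b\<in>chosen_basis V. \<bar>x \<bullet> b\<bar> \<le> r} < \<infinity>"
proof -
  let ?B = "chosen_basis V" let ?P = "Pi\<^sub>M ?B (\<lambda>_. lborel :: real measure)"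
  let ?T = "\<lambda>c. \<Sum>b\<in>?B. c b *\<^sub>R b"
  note B = chosen_basis[OF assms]
  note fin = finite_orthonormal_basis[OF B]
  have [measurable]: "{x. \<forall>b\<in>?B. \<bar>x \<bullet> b\<bar> \<le> r} \<in> sets borel"
    using fin by measurable
  have "emeasure (subspace_lborel V) {x. \<forall>b\<in>?B. \<bar>x \<bullet> b\<bar> \<le> r}
      = emeasure ?P (?T -` {x. \<forall>b\<in>?B. \<bar>x \<bullet> b\<bar> \<le> r} \<inter> space ?P)"
    unfolding subspace_lborel_def by (rule emeasure_distr) auto
  also have "?T -` {x. \<forall>b\<in>?B. \<bar>x \<bullet> b\<bar> \<le> r} \<inter> space ?P = Pi\<^sub>E ?B (\<lambda>_. {-r..r})"
    by (auto simp: space_PiM PiE_iff orthonormal_coordinate[OF B] abs_le_iff) (meson minus_le_iff)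
  also have "emeasure ?P \<dots> = (\<Prod>i\<in>?B. emeasure lborel {-r..r})"
    using fin by (intro lborel_product.emeasure_PiM) auto
  also have "\<dots> < \<infinity>"
    by (auto simp: emeasure_lborel_Icc_eq less_top[symmetric] power_eq_top_ennreal)
  finally show ?thesis .
qed

lemma sigma_finite_subspace_lborel:
  fixes V :: "'a::euclidean_space set"
  assumes "subspace V"
  shows "sigma_finite_measure (subspace_lborel V)"
proof
  let ?A = "\<lambda>n::nat. {x. \<forall>b\<in>chosen_basis V. \<bar>x \<bullet> b\<bar> \<le> real n}"
  note fin = finite_orthonormal_basis[OF chosen_basis[OF assms]]
  have [measurable]: "?A n \<in> sets borel" for n using fin by measurable
  have "x \<in> (\<Union>n. ?A n)" for x :: 'a
  proof -
    obtain n :: nat where n: "(\<Sum>b\<in>chosen_basis V. \<bar>x \<bullet> b\<bar>) \<le> real n"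
      using real_arch_simple by blast
    have "\<bar>x \<bullet> b\<bar> \<le> real n" if "b \<in> chosen_basis V" for b
      using member_le_sum[of b "chosen_basis V" "\<lambda>b. \<bar>x \<bullet> b\<bar>"] that fin n by auto
    then show ?thesis by blast
  qed
  then have "(\<Union>n. ?A n) = UNIV" by blast
  then show "\<exists>A. countable A \<and> A \<subseteq> sets (subspace_lborel V) \<and> \<Union> A = space (subspace_lborel V) \<and>
      (\<forall>a\<in>A. emeasure (subspace_lborel V) a \<noteq> \<infinity>)"
    using emeasure_subspace_lborel_finite[OF assms]
    by (intro exI[of _ "range ?A"]) (auto simp: less_top)
qed

lemma emeasure_subspace_lborel_cball_finite:
  fixes V :: "'a::euclidean_space set"
  assumes "subspace V"
  shows "emeasure (subspace_lborel V) (cball 0 r) < \<infinity>"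
proof -
  note B = chosen_basis[OF assms]
  note fin = finite_orthonormal_basis[OF B]
  have [measurable]: "{x. \<forall>b\<in>chosen_basis V. \<bar>x \<bullet> b\<bar> \<le> r} \<in> sets borel" using fin by measurable
  have "cball 0 r \<subseteq> {x. \<forall>b\<in>chosen_basis V. \<bar>x \<bullet> b\<bar> \<le> r}"
  proof (safe)
    fix x :: 'a and b assume "x \<in> cball 0 r" "b \<in> chosen_basis V"
    then show "\<bar>x \<bullet> b\<bar> \<le> r"
      using Cauchy_Schwarz_ineq2[of x b] B by (simp add: orthonormal_basis_of_def)
  qed
  then have "emeasure (subspace_lborel V) (cball 0 r)
      \<le> emeasure (subspace_lborel V) {x. \<forall>b\<in>chosen_basis V. \<bar>x \<bullet> b\<bar> \<le> r}"
    by (rule emeasure_mono) simp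
  also note emeasure_subspace_lborel_finite[OF assms, of r]
  finally show ?thesis .
qed

text \<open>
  The unit ball contains the image of the box with sides \<open>1 / (card B + 1)\<close>; the summand one covers the
  zero-dimensional subspace.
\<close>

lemma emeasure_subspace_lborel_cball_pos:
  fixes V :: "'a::euclidean_space set"
  assumes "subspace V"
  shows "0 < emeasure (subspace_lborel V) (cball 0 1)"
proof -
  let ?B = "chosen_basis V" let ?P = "Pi\<^sub>M ?B (\<lambda>_. lborel :: real measure)"
  let ?T = "\<lambda>c. \<Sum>b\<in>?B. c b *\<^sub>R b"
  note B = chosen_basis[OF assms]
  note fin = finite_orthonormal_basis[OF B]
  define d :: real where "d = 1 / real (card ?B + 1)"
  have d: "0 < d" "real (card ?B) * d \<le> 1" by (simp_all add: d_def field_simps)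
  have "0 < (\<Prod>i\<in>?B. emeasure lborel {0..d})"
    using d fin by (auto simp: less_le)
  also have "\<dots> = emeasure ?P (Pi\<^sub>E ?B (\<lambda>_. {0..d}))"
    using fin by (intro lborel_product.emeasure_PiM[symmetric]) auto
  also have "\<dots> \<le> emeasure ?P (?T -` cball 0 1 \<inter> space ?P)"
  proof (rule emeasure_mono)
    show "Pi\<^sub>E ?B (\<lambda>_. {0..d}) \<subseteq> ?T -` cball 0 1 \<inter> space ?P"
    proof
      fix c assume c: "c \<in> Pi\<^sub>E ?B (\<lambda>_. {0..d})"
      have "norm (?T c) \<le> (\<Sum>b\<in>?B. norm (c b *\<^sub>R b))" by (rule norm_sum)
      also have "\<dots> \<le> (\<Sum>b\<in>?B. d)"
        using c B by (intro sum_mono) (auto simp: orthonormal_basis_of_def PiE_iff)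
      also have "\<dots> \<le> 1" using d by simp
      finally show "c \<in> ?T -` cball 0 1 \<inter> space ?P"
        using c by (auto simp: space_PiM PiE_iff)
    qed
    show "?T -` cball 0 1 \<inter> space ?P \<in> sets ?P" by (rule measurable_sets[of _ _ borel]) auto
  qed
  also have "\<dots> = emeasure (subspace_lborel V) (cball 0 1)"
    unfolding subspace_lborel_def by (rule emeasure_distr[symmetric]) auto
  finally show ?thesis .
qed

section \<open>Iterated quasi-norms\<close>

definition admissible :: "'a::euclidean_space mixed_space \<Rightarrow> bool" where
  "admissible \<B> \<longleftrightarrow> (\<forall>(p, V) \<in> set \<B>. 0 < p \<and> subspace V)"

lemma admissible_Nil[simp]: "admissible []"
  by (simp add: admissible_def)

lemma admissible_Cons[simp]: "admissible ((p, V) # \<B>) \<longleftrightarrow> 0 < p \<and> subspace V \<and> admissible \<B>"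
  by (simp add: admissible_def)

lemma Lp_qnorm_subspace_lebesgue:
  assumes "f \<in> borel_measurable borel"
  shows "Lp_qnorm (subspace_lebesgue V) p f = Lp_qnorm (subspace_lborel V) p f"
  unfolding subspace_lebesgue_eq_completion
  by (rule Lp_qnorm_completion) (use assms in \<open>simp cong: measurable_cong_sets\<close>)

lemma borel_measurable_shift[measurable (raw)]:
  fixes f :: "'a::euclidean_space \<Rightarrow> ennreal"
  assumes [measurable]: "f \<in> borel_measurable borel"
  shows "(\<lambda>v. f (v + w)) \<in> borel_measurable borel"
  by measurable

lemma cball_borel[measurable]: "cball (a::'a::euclidean_space) r \<in> sets borel"
  by (simp add: borel_closed)

text \<open>
  One layer of the iterated quasi-norm; naming it lets every induction over the layers end with the
  induction hypothesis applied to a Borel function.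
\<close>

definition inner_qnorm :: "ennreal \<Rightarrow> 'a::euclidean_space set \<Rightarrow> ('a \<Rightarrow> ennreal) \<Rightarrow> 'a \<Rightarrow> ennreal" where
  "inner_qnorm p V f w = Lp_qnorm (subspace_lebesgue V) p (\<lambda>v. f (v + w))"

lemma mixed_qnorm_Cons: "mixed_qnorm ((p, V) # \<B>) f = mixed_qnorm \<B> (inner_qnorm p V f)"
  by (simp add: inner_qnorm_def[abs_def])

lemma inner_qnorm_eq:
  assumes "f \<in> borel_measurable borel"
  shows "inner_qnorm p V f w = Lp_qnorm (subspace_lborel V) p (\<lambda>v. f (v + w))"
  using assms by (simp add: inner_qnorm_def Lp_qnorm_subspace_lebesgue)

lemma borel_measurable_inner_qnorm:
  assumes "subspace V" and [measurable]: "f \<in> borel_measurable borel"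
  shows "inner_qnorm p V f \<in> borel_measurable borel"
proof -
  have "(\<lambda>w. Lp_qnorm (subspace_lborel V) p (\<lambda>v. f (v + w))) \<in> borel_measurable borel"
    by (rule borel_measurable_Lp_qnorm[OF sigma_finite_subspace_lborel[OF assms(1)]]) measurable
  moreover have "inner_qnorm p V f = (\<lambda>w. Lp_qnorm (subspace_lborel V) p (\<lambda>v. f (v + w)))"
    by (simp add: fun_eq_iff inner_qnorm_eq)
  ultimately show ?thesis by simp
qed

lemma inner_qnorm_mono_AE:
  assumes "0 < p" "f \<in> borel_measurable borel" "g \<in> borel_measurable borel"
    and "AE v in subspace_lborel V. f (v + w) \<le> g (v + w)"
  shows "inner_qnorm p V f w \<le> inner_qnorm p V g w"
  using assms by (auto simp: inner_qnorm_eq intro!: Lp_qnorm_mono_AE)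

text \<open>
  The iterated notion of "almost everywhere" that belongs to the iterated quasi-norm. For Borel properties
  it agrees with "almost everywhere" in the ambient space.
\<close>

fun mixed_AE :: "'a::euclidean_space mixed_space \<Rightarrow> ('a \<Rightarrow> bool) \<Rightarrow> bool" where
  "mixed_AE [] P = P 0"
| "mixed_AE ((p, V) # \<B>) P = mixed_AE \<B> (\<lambda>w. AE v in subspace_lborel V. P (v + w))"

lemma mixed_AE_mono: "mixed_AE \<B> P \<Longrightarrow> (\<And>x. P x \<Longrightarrow> Q x) \<Longrightarrow> mixed_AE \<B> Q"
proof (induction \<B> P arbitrary: Q rule: mixed_AE.induct)
  case (2 p V \<B> P)
  show ?case
    using 2(2) by (auto intro!: 2(1) elim!: eventually_mono intro: 2(3))
qed auto

lemma mixed_AE_const: "admissible \<B> \<Longrightarrow> mixed_AE \<B> (\<lambda>_. b) = b"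
proof (induction \<B>)
  case (Cons a \<B>)
  obtain p V where a: "a = (p, V)" by fastforce
  with Cons have "subspace V" by simp
  have "(AE v in subspace_lborel V. b) \<longleftrightarrow> b"
  proof (cases b)
    case False
    have "0 < emeasure (subspace_lborel V) (cball 0 1)"
      by (rule emeasure_subspace_lborel_cball_pos[OF \<open>subspace V\<close>])
    also have "\<dots> \<le> emeasure (subspace_lborel V) UNIV"
      by (intro emeasure_mono) auto
    finally show ?thesis using False by (auto simp: eventually_const_iff ae_filter_eq_bot_iff)
  qed simp
  with Cons show ?case by (simp add: a)
qed simp

lemma mixed_qnorm_cong: "mixed_AE \<B> (\<lambda>x. f x = g x) \<Longrightarrow> mixed_qnorm \<B> f = mixed_qnorm \<B> g"
proof (induction \<B> f arbitrary: g rule: mixed_qnorm.induct)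
  case (2 p V \<B> f)
  show ?case unfolding mixed_qnorm.simps
    by (rule 2(1), rule mixed_AE_mono[OF 2(2)[unfolded mixed_AE.simps]])
      (auto simp: subspace_lebesgue_eq_completion intro: Lp_qnorm_completion_cong_AE)
qed auto

lemma mixed_qnorm_mono_AE:
  assumes "admissible \<B>" "f \<in> borel_measurable borel" "g \<in> borel_measurable borel"
    and "mixed_AE \<B> (\<lambda>x. f x \<le> g x)"
  shows "mixed_qnorm \<B> f \<le> mixed_qnorm \<B> g"
  using assms
proof (induction \<B> f arbitrary: g rule: mixed_qnorm.induct)
  case (2 p V \<B> f)
  have V: "subspace V" "admissible \<B>" "0 < p" using 2 by simp_all
  have "mixed_AE \<B> (\<lambda>w. inner_qnorm p V f w \<le> inner_qnorm p V g w)"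
    using 2(5) unfolding mixed_AE.simps
    by (rule mixed_AE_mono) (rule inner_qnorm_mono_AE[OF V(3) 2(3,4)])
  then show ?case unfolding mixed_qnorm_Cons
    using 2(1)[folded inner_qnorm_def, OF V(2)] borel_measurable_inner_qnorm[OF V(1)] 2(3,4) by blast
qed auto

lemma mixed_AE_UNIV: "(\<And>x. P x) \<Longrightarrow> mixed_AE \<B> P"
  by (induction \<B> P rule: mixed_AE.induct) auto

lemma mixed_qnorm_mono:
  assumes "admissible \<B>" "f \<in> borel_measurable borel" "g \<in> borel_measurable borel" "\<And>x. f x \<le> g x"
  shows "mixed_qnorm \<B> f \<le> mixed_qnorm \<B> g"
  using assms by (intro mixed_qnorm_mono_AE mixed_AE_UNIV)

lemma mixed_qnorm_cmult_le:
  assumes "admissible \<B>" "f \<in> borel_measurable borel" "0 \<le> c"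
  shows "mixed_qnorm \<B> (\<lambda>x. ennreal c * f x) \<le> ennreal c * mixed_qnorm \<B> f"
  using assms(1,2)
proof (induction \<B> f rule: mixed_qnorm.induct)
  case (2 p V \<B> f)
  have [measurable]: "f \<in> borel_measurable borel" using 2 by auto
  have V: "subspace V" "admissible \<B>" "0 < p" using 2 by simp_all
  note [measurable] = borel_measurable_inner_qnorm[OF V(1)]
  have le: "inner_qnorm p V (\<lambda>x. ennreal c * f x) w \<le> ennreal c * inner_qnorm p V f w" for w
    using V assms(3) by (simp add: inner_qnorm_eq Lp_qnorm_cmult_le)
  have "mixed_qnorm ((p, V) # \<B>) (\<lambda>x. ennreal c * f x)
      \<le> mixed_qnorm \<B> (\<lambda>w. ennreal c * inner_qnorm p V f w)"
    unfolding mixed_qnorm_Cons by (rule mixed_qnorm_mono[OF V(2) _ _ le]) measurable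
  also have "\<dots> \<le> ennreal c * mixed_qnorm \<B> (inner_qnorm p V f)"
    by (rule 2(1)[folded inner_qnorm_def, OF V(2)]) measurable
  finally show ?case unfolding mixed_qnorm_Cons .
qed auto

primrec mixed_triangle_const :: "'a mixed_space \<Rightarrow> real" where
  "mixed_triangle_const [] = 1"
| "mixed_triangle_const (pV # \<B>) = quasi_triangle_const (fst pV) * mixed_triangle_const \<B>"

lemma mixed_triangle_const_ge_1: "1 \<le> mixed_triangle_const \<B>"
  by (induction \<B>) (auto intro!: mult_ge1_I quasi_triangle_const_ge_1)

lemma mixed_triangle_const_eq_1: "(\<And>p. p \<in> set (map fst \<B>) \<Longrightarrow> 1 \<le> p) \<Longrightarrow> mixed_triangle_const \<B> = 1"
  by (induction \<B>) (auto simp: quasi_triangle_const_def)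

lemma mixed_qnorm_triangle:
  assumes "admissible \<B>" "f \<in> borel_measurable borel" "g \<in> borel_measurable borel"
  shows "mixed_qnorm \<B> (\<lambda>x. f x + g x)
    \<le> ennreal (mixed_triangle_const \<B>) * (mixed_qnorm \<B> f + mixed_qnorm \<B> g)"
  using assms
proof (induction \<B> f arbitrary: g rule: mixed_qnorm.induct)
  case (2 p V \<B> f)
  have [measurable]: "f \<in> borel_measurable borel" "g \<in> borel_measurable borel" using 2 by auto
  have V: "subspace V" "admissible \<B>" "0 < p" using 2 by simp_all
  note [measurable] = borel_measurable_inner_qnorm[OF V(1)]
  let ?C = "quasi_triangle_const p"
  have C: "0 \<le> ?C" using quasi_triangle_const_ge_1[of p] by linarith
  have le: "inner_qnorm p V (\<lambda>x. f x + g x) w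
      \<le> ennreal ?C * (inner_qnorm p V f w + inner_qnorm p V g w)" for w
    using V by (simp add: inner_qnorm_eq Lp_qnorm_triangle)
  have "mixed_qnorm ((p, V) # \<B>) (\<lambda>x. f x + g x)
      \<le> mixed_qnorm \<B> (\<lambda>w. ennreal ?C * (inner_qnorm p V f w + inner_qnorm p V g w))"
    unfolding mixed_qnorm_Cons by (rule mixed_qnorm_mono[OF V(2) _ _ le]) measurable
  also have "\<dots> \<le> ennreal ?C * mixed_qnorm \<B> (\<lambda>w. inner_qnorm p V f w + inner_qnorm p V g w)"
    by (rule mixed_qnorm_cmult_le[OF V(2) _ C]) measurable
  also have "\<dots> \<le> ennreal ?C * (ennreal (mixed_triangle_const \<B>) *
      (mixed_qnorm \<B> (inner_qnorm p V f) + mixed_qnorm \<B> (inner_qnorm p V g)))"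
    by (rule mult_left_mono[OF 2(1)[folded inner_qnorm_def, OF V(2)]]; measurable)
  finally show ?case
    unfolding mixed_qnorm_Cons using C by (simp add: ennreal_mult' mult.assoc)
qed auto

lemma mixed_qnorm_SUP_le:
  fixes f :: "nat \<Rightarrow> 'a::euclidean_space \<Rightarrow> ennreal"
  assumes "admissible \<B>" "\<And>n. f n \<in> borel_measurable borel" "\<And>m n x. m \<le> n \<Longrightarrow> f m x \<le> f n x"
  shows "mixed_qnorm \<B> (\<lambda>x. SUP n. f n x) \<le> (SUP n. mixed_qnorm \<B> (f n))"
  using assms
proof (induction \<B> arbitrary: f)
  case (Cons a \<B>)
  obtain p V where a: "a = (p, V)" by fastforce
  have [measurable]: "f n \<in> borel_measurable borel" for n using Cons by auto
  have V: "subspace V" "admissible \<B>" "0 < p" using Cons by (simp_all add: a)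
  note [measurable] = borel_measurable_inner_qnorm[OF V(1)]
  note inc = Cons.prems(3)
  have le: "inner_qnorm p V (\<lambda>x. SUP n. f n x) w \<le> (SUP n. inner_qnorm p V (f n) w)" for w
    using Lp_qnorm_SUP_le[OF V(3), of "\<lambda>n v. f n (v + w)" "subspace_lborel V"] inc
    by (simp add: inner_qnorm_eq incseq_def le_fun_def)
  have "mixed_qnorm (a # \<B>) (\<lambda>x. SUP n. f n x) \<le> mixed_qnorm \<B> (\<lambda>w. SUP n. inner_qnorm p V (f n) w)"
    unfolding a mixed_qnorm_Cons by (rule mixed_qnorm_mono[OF V(2) _ _ le]) measurable
  also have "\<dots> \<le> (SUP n. mixed_qnorm \<B> (inner_qnorm p V (f n)))"
  proof (rule Cons.IH[OF V(2)])
    fix m n :: nat and w assume "m \<le> n"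
    then show "inner_qnorm p V (f m) w \<le> inner_qnorm p V (f n) w"
      using inc by (intro inner_qnorm_mono_AE V) auto
  qed measurable
  finally show ?case by (simp add: a mixed_qnorm_Cons del: mixed_qnorm.simps)
qed simp

lemma mixed_qnorm_translate:
  assumes "admissible \<B>" "list_all2 (\<in>) vs (map snd \<B>)" "f \<in> borel_measurable borel"
  shows "mixed_qnorm \<B> (\<lambda>x. f (x + sum_list vs)) = mixed_qnorm \<B> f"
  using assms
proof (induction \<B> f arbitrary: vs rule: mixed_qnorm.induct)
  case (2 p V \<B> f)
  have [measurable]: "f \<in> borel_measurable borel" using 2 by auto
  from 2(3) obtain u us where vs: "vs = u # us" "u \<in> V" "list_all2 (\<in>) us (map snd \<B>)"
    by (auto simp: list_all2_Cons2)
  have V: "subspace V" "admissible \<B>" using 2 by simp_all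
  have "inner_qnorm p V (\<lambda>x. f (x + sum_list vs)) w = inner_qnorm p V f (w + sum_list us)" for w
  proof -
    have "inner_qnorm p V f (w + sum_list us)
        = Lp_qnorm (distr (subspace_lborel V) borel (\<lambda>v. v + u)) p (\<lambda>v. f (v + (w + sum_list us)))"
      by (simp add: inner_qnorm_eq subspace_lborel_translate[OF V(1) vs(2)])
    also have "\<dots> = Lp_qnorm (subspace_lborel V) p (\<lambda>v. f (v + u + (w + sum_list us)))"
      by (rule Lp_qnorm_distr) measurable
    also have "\<dots> = inner_qnorm p V (\<lambda>x. f (x + sum_list vs)) w"
      by (simp add: inner_qnorm_eq vs ac_simps)
    finally show ?thesis ..
  qed
  then have "inner_qnorm p V (\<lambda>x. f (x + sum_list vs)) = (\<lambda>w. inner_qnorm p V f (w + sum_list us))"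
    by (rule ext)
  then show ?case
    unfolding mixed_qnorm_Cons
    using 2(1)[folded inner_qnorm_def, OF V(2) vs(3) borel_measurable_inner_qnorm[OF V(1)]] by simp
qed auto

lemma mixed_AE_translate:
  assumes "admissible \<B>" "list_all2 (\<in>) vs (map snd \<B>)" "Measurable.pred borel P"
  shows "mixed_AE \<B> (\<lambda>x. P (x + sum_list vs)) \<longleftrightarrow> mixed_AE \<B> P"
  using assms
proof (induction \<B> P arbitrary: vs rule: mixed_AE.induct)
  case (2 p V \<B> P)
  have [measurable]: "Measurable.pred borel P" using 2 by auto
  from 2(3) obtain u us where vs: "vs = u # us" "u \<in> V" "list_all2 (\<in>) us (map snd \<B>)"
    by (auto simp: list_all2_Cons2)
  have V: "subspace V" "admissible \<B>" using 2 by simp_all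
  have "(AE v in subspace_lborel V. P (v + w + sum_list vs))
      \<longleftrightarrow> (AE v in subspace_lborel V. P (v + (w + sum_list us)))" for w
  proof -
    have "(AE v in distr (subspace_lborel V) borel (\<lambda>v. v + u). P (v + (w + sum_list us)))
        \<longleftrightarrow> (AE v in subspace_lborel V. P (v + u + (w + sum_list us)))"
      by (rule AE_distr_iff) measurable
    then show ?thesis
      unfolding subspace_lborel_translate[OF V(1) vs(2)] by (simp add: vs ac_simps)
  qed
  moreover have "Measurable.pred borel (\<lambda>w. AE v in subspace_lborel V. P (v + w))"
    unfolding pred_def by (rule sets_Collect_AE[OF sigma_finite_subspace_lborel[OF V(1)]]) measurable
  ultimately show ?case
    using 2(1)[OF V(2) vs(3)] by simp
qed auto

text \<open>
  By induction over the layers: exchange \<open>x\<close> with the innermost variable by Tonelli, then apply the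
  induction hypothesis to the Borel property "for almost all \<open>v\<close>".
\<close>

lemma mixed_AE_Fubini:
  fixes Q :: "'e::euclidean_space \<Rightarrow> 'a::euclidean_space \<Rightarrow> bool"
  assumes "admissible \<B>" "Measurable.pred (borel \<Otimes>\<^sub>M borel) (case_prod Q)"
  shows "(AE x in lborel. mixed_AE \<B> (Q x)) \<longleftrightarrow> mixed_AE \<B> (\<lambda>w. AE x in lborel. Q x w)"
  using assms
proof (induction \<B> arbitrary: Q)
  case (Cons a \<B>)
  obtain p V where a: "a = (p, V)" by fastforce
  have V: "subspace V" "admissible \<B>" using Cons by (simp_all add: a)
  note [measurable] = Cons.prems(2)
  interpret V: sigma_finite_measure "subspace_lborel V" by (rule sigma_finite_subspace_lborel[OF V(1)])
  interpret P: pair_sigma_finite "lborel :: 'e measure" "subspace_lborel V" ..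
  have 1: "Measurable.pred (borel \<Otimes>\<^sub>M borel) (\<lambda>(x, w). AE v in subspace_lborel V. Q x (v + w))"
    unfolding pred_def case_prod_unfold
    by (rule sets_Collect_AE[OF sigma_finite_subspace_lborel[OF V(1)]]) measurable
  have 2: "(AE x in lborel. AE v in subspace_lborel V. Q x (v + w))
      \<longleftrightarrow> (AE v in subspace_lborel V. AE x in lborel. Q x (v + w))" for w
    by (rule P.AE_commute) measurable
  show ?case
    using Cons.IH[OF V(2) 1] by (simp add: a 2)
qed simp

lemma AE_lborel_translate:
  fixes a :: "'a::euclidean_space"
  assumes [measurable]: "Measurable.pred borel P"
  shows "(AE x in lborel. P (x + a)) \<longleftrightarrow> (AE x in lborel. P x)"
proof -
  have "(AE x in distr lborel borel ((+) a). P x) \<longleftrightarrow> (AE x in lborel. P (a + x))"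
    by (rule AE_distr_iff) auto
  then show ?thesis unfolding lborel_distr_plus by (simp add: add.commute)
qed

text \<open>
  The components of a vector are translations along the layers, under which one layer after the other is
  invariant; hence the iterated objects are invariant under every translation of the ambient space.
\<close>

definition spanning :: "'a::euclidean_space mixed_space \<Rightarrow> bool" where
  "spanning \<B> \<longleftrightarrow> (\<forall>x. \<exists>vs. list_all2 (\<in>) vs (map snd \<B>) \<and> sum_list vs = x)"

lemma linear_borel_measurable:
  fixes T :: "'a::euclidean_space \<Rightarrow> 'b::euclidean_space"
  assumes "linear T"
  shows "T \<in> borel_measurable borel"
  by (intro borel_measurable_continuous_onI linear_continuous_on
      linear_conv_bounded_linear[THEN iffD1] assms)

text \<open>
  Averaging over translations. The statement "\<open>P (x + S w)\<close> for iterated-almost all \<open>w\<close>" does not depend on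
  \<open>x\<close>, because the iterated measure is invariant under all translations. Averaging it over \<open>x\<close> and
  exchanging the order gives "\<open>P (x + S w)\<close> for almost all \<open>x\<close>", which does not depend on \<open>w\<close>, because
  Lebesgue measure is invariant. The argument is insensitive to the angles between the subspaces and to
  \<open>S\<close>, whose target may be any other Euclidean space.
\<close>

theorem mixed_AE_iff_AE_lborel:
  fixes S :: "'a::euclidean_space \<Rightarrow> 'e::euclidean_space"
  assumes \<B>: "admissible \<B>" "spanning \<B>" and S: "linear S" "surj S"
    and [measurable]: "Measurable.pred borel P"
  shows "mixed_AE \<B> (\<lambda>w. P (S w)) \<longleftrightarrow> (AE x in lborel. P x)"
proof -
  have [measurable]: "S \<in> borel_measurable borel"
    by (rule linear_borel_measurable[OF S(1)])
  have "mixed_AE \<B> (\<lambda>w. P (x + S w)) \<longleftrightarrow> mixed_AE \<B> (\<lambda>w. P (S w))" for x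
  proof -
    (* Independence of x: decompose a preimage of x along the layers. *)
    obtain y where y: "x = S y" using S(2) by blast
    obtain vs where vs: "list_all2 (\<in>) vs (map snd \<B>)" "sum_list vs = y"
      using \<B>(2) by (auto simp: spanning_def)
    have "mixed_AE \<B> (\<lambda>w. P (S (w + sum_list vs))) \<longleftrightarrow> mixed_AE \<B> (\<lambda>w. P (S w))"
      by (rule mixed_AE_translate[OF \<B>(1) vs(1)]) measurable
    then show ?thesis by (simp add: vs y linear_add[OF S(1)] add.commute)
  qed
  then have "mixed_AE \<B> (\<lambda>w. P (S w)) \<longleftrightarrow> (AE x::'e in lborel. mixed_AE \<B> (\<lambda>w. P (x + S w)))"
    by (simp add: eventually_const_iff ae_filter_eq_bot_iff)
  also have "\<dots> \<longleftrightarrow> mixed_AE \<B> (\<lambda>w. AE x in lborel. P (x + S w))"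
    by (rule mixed_AE_Fubini[OF \<B>(1)]) measurable
  also have "\<dots> \<longleftrightarrow> (AE x in lborel. P x)"
    by (simp add: AE_lborel_translate mixed_AE_const[OF \<B>(1)])
  finally show ?thesis .
qed

section \<open>Local integrals\<close>

text \<open>
  The restriction to unit balls makes the iterated integral finite on constants, so that the exponents of
  the quasi-norm can be lowered to a common one layer by layer.
\<close>

fun local_integral :: "'a::euclidean_space mixed_space \<Rightarrow> ('a \<Rightarrow> ennreal) \<Rightarrow> ennreal" where
  "local_integral [] f = f 0"
| "local_integral ((p, V) # \<B>) f =
     local_integral \<B> (\<lambda>w. \<integral>\<^sup>+v. f (v + w) * indicator (cball 0 1) v \<partial>subspace_lborel V)"

text \<open>
  Each layer contributes a vector of norm at most one.
\<close>

lemma local_integral_mono: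
  "(\<And>x. norm x \<le> real (length \<B>) \<Longrightarrow> f x \<le> g x) \<Longrightarrow> local_integral \<B> f \<le> local_integral \<B> g"
proof (induction \<B> f arbitrary: g rule: local_integral.induct)
  case (2 p V \<B> f)
  show ?case unfolding local_integral.simps
  proof (rule 2(1), rule nn_integral_mono)
    fix w v :: 'a assume w: "norm w \<le> real (length \<B>)"
    show "f (v + w) * indicator (cball 0 1) v \<le> g (v + w) * indicator (cball 0 1) v"
      using norm_triangle_ineq[of v w] w by (auto simp: indicator_def intro!: 2(2))
  qed
qed auto

lemma borel_measurable_inner_integral:
  fixes f :: "'b \<Rightarrow> 'a::euclidean_space \<Rightarrow> ennreal"
  assumes "subspace V" and [measurable]: "case_prod f \<in> borel_measurable (N \<Otimes>\<^sub>M borel)"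
  shows "(\<lambda>z. \<integral>\<^sup>+v. f (fst z) (v + snd z) * indicator (cball 0 1) v \<partial>subspace_lborel V)
    \<in> borel_measurable (N \<Otimes>\<^sub>M borel)"
proof -
  interpret sigma_finite_measure "subspace_lborel V" by (rule sigma_finite_subspace_lborel[OF assms(1)])
  show ?thesis by measurable
qed

lemma borel_measurable_inner_integral':
  fixes f :: "'a::euclidean_space \<Rightarrow> ennreal"
  assumes "subspace V" and [measurable]: "f \<in> borel_measurable borel"
  shows "(\<lambda>w. \<integral>\<^sup>+v. f (v + w) * indicator (cball 0 1) v \<partial>subspace_lborel V) \<in> borel_measurable borel"
proof -
  interpret sigma_finite_measure "subspace_lborel V" by (rule sigma_finite_subspace_lborel[OF assms(1)])
  show ?thesis by measurable
qed

lemma local_integral_cmult: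
  assumes "admissible \<B>" "f \<in> borel_measurable borel"
  shows "local_integral \<B> (\<lambda>x. c * f x) = c * local_integral \<B> f"
  using assms
proof (induction \<B> f rule: local_integral.induct)
  case (2 p V \<B> f)
  have [measurable]: "f \<in> borel_measurable borel" using 2 by auto
  then show ?case
    using 2 by (simp add: mult.assoc nn_integral_cmult borel_measurable_inner_integral'
        cong: measurable_cong_sets)
qed auto

lemma local_integral_one:
  assumes "admissible \<B>"
  shows "0 < local_integral \<B> (\<lambda>_. 1) \<and> local_integral \<B> (\<lambda>_. 1) < \<infinity>"
  using assms
proof (induction \<B>)
  case (Cons a \<B>)
  obtain p V where a: "a = (p, V)" by fastforce
  have V: "subspace V" "admissible \<B>" using Cons.prems by (simp_all add: a)
  let ?m = "emeasure (subspace_lborel V) (cball 0 1)"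
  have eq: "local_integral (a # \<B>) (\<lambda>_. 1) = ?m * local_integral \<B> (\<lambda>_. 1)"
    using local_integral_cmult[OF V(2), of "\<lambda>_. 1" ?m] by (simp add: a)
  show ?case unfolding eq
    using Cons.IH[OF V(2)] emeasure_subspace_lborel_cball_pos[OF V(1)]
      emeasure_subspace_lborel_cball_finite[OF V(1), of 1]
    by (simp add: ennreal_zero_less_mult_iff ennreal_mult_less_top)
qed auto

lemma local_integral_Tonelli:
  fixes h :: "'e::euclidean_space \<Rightarrow> 'a::euclidean_space \<Rightarrow> ennreal"
  assumes "admissible \<B>" "case_prod h \<in> borel_measurable (borel \<Otimes>\<^sub>M borel)"
  shows "(\<integral>\<^sup>+x. local_integral \<B> (h x) \<partial>lborel) = local_integral \<B> (\<lambda>w. \<integral>\<^sup>+x. h x w \<partial>lborel)"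
  using assms
proof (induction \<B> arbitrary: h)
  case (Cons a \<B>)
  obtain p V where a: "a = (p, V)" by fastforce
  have V: "subspace V" "admissible \<B>" using Cons by (simp_all add: a)
  note [measurable] = Cons.prems(2)
  interpret V: sigma_finite_measure "subspace_lborel V" by (rule sigma_finite_subspace_lborel[OF V(1)])
  interpret P: pair_sigma_finite "lborel :: 'e measure" "subspace_lborel V" ..
  have 1: "(\<integral>\<^sup>+x. (\<integral>\<^sup>+v. h x (v + w) * indicator (cball 0 1) v \<partial>subspace_lborel V) \<partial>lborel)
    = (\<integral>\<^sup>+v. (\<integral>\<^sup>+x. h x (v + w) \<partial>lborel) * indicator (cball 0 1) v \<partial>subspace_lborel V)" for w
    by (subst P.Fubini'[symmetric]) (auto simp: nn_integral_multc)
  show ?case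
    using Cons.IH[OF V(2), of "\<lambda>x w. \<integral>\<^sup>+v. h x (v + w) * indicator (cball 0 1) v \<partial>subspace_lborel V"]
      borel_measurable_inner_integral[OF V(1) Cons.prems(2)]
    by (simp add: a 1 case_prod_unfold)
qed simp

lemma local_integral_powr_le:
  assumes "admissible \<B>" "0 < s" "\<And>p. p \<in> set (map fst \<B>) \<Longrightarrow> ennreal s \<le> p"
  shows "\<exists>C<\<infinity>. \<forall>f\<in>borel_measurable borel.
    local_integral \<B> (\<lambda>x. ennreal_powr (f x) s) \<le> C * ennreal_powr (mixed_qnorm \<B> f) s"
  using assms(1,3)
proof (induction \<B>)
  case Nil
  show ?case by (intro exI[of _ 1]) auto
next
  case (Cons a \<B>)
  obtain p V where a: "a = (p, V)" by fastforce
  have V: "subspace V" "admissible \<B>" "ennreal s \<le> p" using Cons.prems by (simp_all add: a)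
  obtain C where C: "C < \<infinity>" and le: "\<And>f. f \<in> borel_measurable borel \<Longrightarrow>
      local_integral \<B> (\<lambda>x. ennreal_powr (f x) s) \<le> C * ennreal_powr (mixed_qnorm \<B> f) s"
    using Cons V by auto
  let ?D = "1 + emeasure (subspace_lborel V) (cball 0 1)"
  show ?case
  proof (intro exI[of _ "?D * C"] conjI ballI)
    show "?D * C < \<infinity>"
      using C emeasure_subspace_lborel_cball_finite[OF V(1), of 1] by (simp add: ennreal_mult_less_top)
    fix f :: "'a \<Rightarrow> ennreal" assume [measurable]: "f \<in> borel_measurable borel"
    let ?F = "inner_qnorm p V f"
    have [measurable]: "?F \<in> borel_measurable borel"
      by (rule borel_measurable_inner_qnorm[OF V(1)]) measurable
    have "local_integral (a # \<B>) (\<lambda>x. ennreal_powr (f x) s)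
        \<le> local_integral \<B> (\<lambda>w. ?D * ennreal_powr (?F w) s)"
      unfolding a local_integral.simps
    proof (rule local_integral_mono)
      fix w
      show "(\<integral>\<^sup>+v. ennreal_powr (f (v + w)) s * indicator (cball 0 1) v \<partial>subspace_lborel V)
          \<le> ?D * ennreal_powr (?F w) s"
        using nn_integral_powr_le_Lp_qnorm[OF assms(2) V(3), of "\<lambda>v. f (v + w)" "subspace_lborel V" "cball 0 1"]
        by (simp add: inner_qnorm_eq)
    qed
    also have "\<dots> = ?D * local_integral \<B> (\<lambda>w. ennreal_powr (?F w) s)"
      by (rule local_integral_cmult[OF V(2)]) measurable
    also have "\<dots> \<le> ?D * (C * ennreal_powr (mixed_qnorm \<B> ?F) s)"
      by (intro mult_left_mono le) auto
    finally show "local_integral (a # \<B>) (\<lambda>x. ennreal_powr (f x) s)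
        \<le> ?D * C * ennreal_powr (mixed_qnorm (a # \<B>) f) s"
      by (simp add: a mult.assoc mixed_qnorm_Cons del: mixed_qnorm.simps)
  qed
qed

lemma nn_integral_lborel_translate:
  fixes a :: "'a::euclidean_space"
  assumes [measurable]: "f \<in> borel_measurable borel"
  shows "(\<integral>\<^sup>+x. f (x + a) \<partial>lborel) = (\<integral>\<^sup>+x. f x \<partial>lborel)"
proof -
  have "(\<integral>\<^sup>+x. f x \<partial>distr lborel borel ((+) a)) = (\<integral>\<^sup>+x. f (a + x) \<partial>lborel)"
    by (rule nn_integral_distr) auto
  then show ?thesis by (simp add: lborel_distr_plus add.commute)
qed

text \<open>
  The integral over \<open>K\<close> is a
  constant as a function of \<open>w\<close>. Translating the integration variable by \<open>S w\<close>, enlarging \<open>K\<close> to a ball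
  and exchanging the integrals bounds its local integral by the average, over \<open>x\<close> in that ball, of the
  local integrals of \<open>w \<mapsto> f (x + S w) powr s\<close>. Each of these is controlled by the quasi-norm, which does
  not depend on \<open>x\<close>.
\<close>

theorem nn_integral_bounded_le_mixed_qnorm:
  fixes S :: "'a::euclidean_space \<Rightarrow> 'e::euclidean_space"
  assumes \<B>: "admissible \<B>" "spanning \<B>" and S: "linear S" "surj S"
    and s: "0 < s" "\<And>p. p \<in> set (map fst \<B>) \<Longrightarrow> ennreal s \<le> p"
    and K: "bounded K" and [measurable]: "K \<in> sets borel"
  shows "\<exists>C<\<infinity>. \<forall>f\<in>borel_measurable borel.
    (\<integral>\<^sup>+x. ennreal_powr (f x) s * indicator K x \<partial>lborel)
      \<le> C * ennreal_powr (mixed_qnorm \<B> (\<lambda>w. f (S w))) s"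
proof -
  have bl: "bounded_linear S" using S(1) linear_conv_bounded_linear by blast
  have [measurable]: "S \<in> borel_measurable borel"
    by (intro borel_measurable_continuous_onI linear_continuous_on bl)
  obtain M where M: "\<And>w. norm (S w) \<le> norm w * M" "0 < M"
    using bounded_linear.pos_bounded[OF bl] by blast
  obtain k where k: "\<And>x. x \<in> K \<Longrightarrow> norm x \<le> k"
    using K by (auto simp: bounded_iff)
  (* Translating K by S w with |w| <= length B stays within this radius. *)
  define \<rho> where "\<rho> = k + real (length \<B>) * M"
  obtain C where C: "C < \<infinity>" and le: "\<And>f. f \<in> borel_measurable borel \<Longrightarrow>
      local_integral \<B> (\<lambda>x. ennreal_powr (f x) s) \<le> C * ennreal_powr (mixed_qnorm \<B> f) s"
    using local_integral_powr_le[OF \<B>(1) s] by auto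
  define c where "c = local_integral \<B> (\<lambda>_. 1)"
  have c: "0 < c" "c < \<infinity>" unfolding c_def using local_integral_one[OF \<B>(1)] by auto
  let ?m = "emeasure lborel (cball (0::'e) \<rho>)"
  have m: "?m < \<infinity>" by (rule emeasure_lborel_cball_finite)
  show ?thesis
  proof (intro exI[of _ "C * ?m / c"] conjI ballI)
    show "C * ?m / c < \<infinity>"
      using C m c by (auto simp: ennreal_divide_eq_top_iff less_top[symmetric] ennreal_mult_eq_top_iff)
    fix f :: "'e \<Rightarrow> ennreal" assume [measurable]: "f \<in> borel_measurable borel"
    let ?I = "\<integral>\<^sup>+x. ennreal_powr (f x) s * indicator K x \<partial>lborel"
    let ?N = "mixed_qnorm \<B> (\<lambda>w. f (S w))"
    have "?I * c = local_integral \<B> (\<lambda>_. ?I * 1)"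
      unfolding c_def by (rule local_integral_cmult[OF \<B>(1), symmetric]) simp
    also have "\<dots> \<le> local_integral \<B> (\<lambda>w. \<integral>\<^sup>+x. ennreal_powr (f (x + S w)) s * indicator (cball 0 \<rho>) x \<partial>lborel)"
    proof (rule local_integral_mono)
      fix w :: 'a assume w: "norm w \<le> real (length \<B>)"
      have "?I = (\<integral>\<^sup>+x. ennreal_powr (f (x + S w)) s * indicator K (x + S w) \<partial>lborel)"
        by (rule nn_integral_lborel_translate[symmetric]) measurable
      also have "\<dots> \<le> (\<integral>\<^sup>+x. ennreal_powr (f (x + S w)) s * indicator (cball 0 \<rho>) x \<partial>lborel)"
      proof (intro nn_integral_mono mult_left_mono)
        fix x :: 'e
        show "(indicator K (x + S w) :: ennreal) \<le> indicator (cball 0 \<rho>) x"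
        proof (cases "x + S w \<in> K")
          case True
          have "norm x \<le> norm (x + S w) + norm (S w)"
            using norm_triangle_ineq4[of "x + S w" "S w"] by simp
          also have "\<dots> \<le> k + real (length \<B>) * M"
            using k[OF True] M(1)[of w] M(2) w by (meson add_mono mult_right_mono less_imp_le order_trans)
          finally show ?thesis by (simp add: \<rho>_def indicator_def)
        qed simp
      qed simp
      finally show "?I * 1 \<le> (\<integral>\<^sup>+x. ennreal_powr (f (x + S w)) s * indicator (cball 0 \<rho>) x \<partial>lborel)"
        by simp
    qed
    also have "\<dots> = (\<integral>\<^sup>+x. local_integral \<B> (\<lambda>w. ennreal_powr (f (x + S w)) s * indicator (cball 0 \<rho>) x) \<partial>lborel)"
      by (rule local_integral_Tonelli[OF \<B>(1), symmetric]) measurable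
    also have "\<dots> = (\<integral>\<^sup>+x. indicator (cball 0 \<rho>) x * local_integral \<B> (\<lambda>w. ennreal_powr (f (x + S w)) s) \<partial>lborel)"
    proof (intro nn_integral_cong)
      fix x :: 'e
      have "local_integral \<B> (\<lambda>w. indicator (cball 0 \<rho>) x * ennreal_powr (f (x + S w)) s)
          = indicator (cball 0 \<rho>) x * local_integral \<B> (\<lambda>w. ennreal_powr (f (x + S w)) s)"
        by (rule local_integral_cmult[OF \<B>(1)]) measurable
      then show "local_integral \<B> (\<lambda>w. ennreal_powr (f (x + S w)) s * indicator (cball 0 \<rho>) x)
          = indicator (cball 0 \<rho>) x * local_integral \<B> (\<lambda>w. ennreal_powr (f (x + S w)) s)"
        by (simp add: mult.commute)
    qed
    also have "\<dots> \<le> (\<integral>\<^sup>+x. indicator (cball (0::'e) \<rho>) x * (C * ennreal_powr ?N s) \<partial>lborel)"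
    proof (intro nn_integral_mono mult_left_mono)
      fix x :: 'e
      obtain y where y: "x = S y" using S(2) by blast
      obtain vs where vs: "list_all2 (\<in>) vs (map snd \<B>)" "sum_list vs = y"
        using \<B>(2) by (auto simp: spanning_def)
      have "mixed_qnorm \<B> (\<lambda>w. f (S (w + sum_list vs))) = ?N"
        by (rule mixed_qnorm_translate[OF \<B>(1) vs(1)]) measurable
      then have "mixed_qnorm \<B> (\<lambda>w. f (x + S w)) = ?N"
        by (simp add: vs y linear_add[OF S(1)] add.commute)
      then show "local_integral \<B> (\<lambda>w. ennreal_powr (f (x + S w)) s) \<le> C * ennreal_powr ?N s"
        using le[of "\<lambda>w. f (x + S w)"] by simp
    qed simp
    also have "\<dots> = C * ?m * ennreal_powr ?N s"
      by (subst nn_integral_multc) (auto simp: mult_ac)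
    finally have "?I * c \<le> C * ?m * ennreal_powr ?N s" .
    then have "?I * c / c \<le> C * ?m * ennreal_powr ?N s / c"
      by (rule divide_right_mono_ennreal)
    moreover have "?I * c / c = ?I"
      using c by (intro ennreal_mult_divide_eq) (auto simp: less_top[symmetric])
    moreover have "C * ?m * ennreal_powr ?N s / c = C * ?m / c * ennreal_powr ?N s"
      by (simp add: divide_ennreal_def mult_ac)
    ultimately show "?I \<le> C * ?m / c * ennreal_powr ?N s" by simp
  qed
qed

text \<open>
  The case in which every exponent is infinite, where no finite power is available for the preceding
  bound at the exponent itself.
\<close>

lemma AE_le_mixed_qnorm_infinity:
  fixes S :: "'a::euclidean_space \<Rightarrow> 'e::euclidean_space"
  assumes \<B>: "admissible \<B>" "spanning \<B>" and S: "linear S" "surj S"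
    and p: "\<And>p. p \<in> set (map fst \<B>) \<Longrightarrow> p = \<infinity>"
    and [measurable]: "f \<in> borel_measurable borel"
  shows "AE x in lborel. f x \<le> mixed_qnorm \<B> (\<lambda>w. f (S w))"
proof -
  have [measurable]: "S \<in> borel_measurable borel"
    by (rule linear_borel_measurable[OF S(1)])
  have "mixed_AE \<B> (\<lambda>x. g x \<le> mixed_qnorm \<B> g)" if "g \<in> borel_measurable borel" for g
    using \<B>(1) p that
  proof (induction \<B> g rule: mixed_qnorm.induct)
    case (2 p V \<B> g)
    have [measurable]: "g \<in> borel_measurable borel" using 2 by auto
    have V: "subspace V" "admissible \<B>" "p = \<infinity>" using 2 by simp_all
    have "mixed_AE \<B> (\<lambda>w. inner_qnorm p V g w \<le> mixed_qnorm ((p, V) # \<B>) g)"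
      unfolding mixed_qnorm_Cons
      by (rule 2(1)[folded inner_qnorm_def, OF V(2) _ borel_measurable_inner_qnorm[OF V(1)]])
        (use 2 in auto)
    then show ?case unfolding mixed_AE.simps
      by (rule mixed_AE_mono) (simp add: inner_qnorm_eq V(3) Lp_qnorm_eq esssup_le_iff)
  qed simp
  then have "mixed_AE \<B> (\<lambda>w. f (S w) \<le> mixed_qnorm \<B> (\<lambda>w. f (S w)))"
    by measurable
  then show ?thesis
    by (subst (asm) mixed_AE_iff_AE_lborel[OF \<B> S]) measurable
qed

section \<open>Completeness of weighted quasi-normed function spaces\<close>

lemma cball_lebesgue[measurable]: "cball (a::'a::euclidean_space) r \<in> sets lebesgue"
  by simp

text \<open>
  The properties of a mixed quasi-norm that completeness rests on. All measurability is with respect to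
  Lebesgue measurable functions on the ambient space, so the iterated structure is no longer visible.
  The assumption \<open>local\<close> links the quasi-norm with the topology of local \<open>L\<^sup>s\<close> convergence.
\<close>

locale function_qnorm =
  fixes N :: "('e::euclidean_space \<Rightarrow> ennreal) \<Rightarrow> ennreal" and C s :: real
  assumes C_ge_1: "1 \<le> C" and s_pos: "0 < s"
    and cong_AE: "(AE x in lebesgue. f x = g x) \<Longrightarrow> N f = N g"
    and mono_AE: "\<lbrakk>f \<in> borel_measurable lebesgue; g \<in> borel_measurable lebesgue;
      AE x in lebesgue. f x \<le> g x\<rbrakk> \<Longrightarrow> N f \<le> N g"
    and cmult_le: "\<lbrakk>f \<in> borel_measurable lebesgue; 0 \<le> c\<rbrakk> \<Longrightarrow>
      N (\<lambda>x. ennreal c * f x) \<le> ennreal c * N f"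
    and triangle: "\<lbrakk>f \<in> borel_measurable lebesgue; g \<in> borel_measurable lebesgue\<rbrakk> \<Longrightarrow>
      N (\<lambda>x. f x + g x) \<le> ennreal C * (N f + N g)"
    and SUP_le: "\<lbrakk>\<And>n::nat. F n \<in> borel_measurable lebesgue; \<And>m n x. m \<le> n \<Longrightarrow> F m x \<le> F n x\<rbrakk> \<Longrightarrow>
      N (\<lambda>x. SUP n. F n x) \<le> (SUP n. N (F n))"
    and local: "compact K \<Longrightarrow> \<exists>D<\<infinity>. \<forall>f\<in>borel_measurable lebesgue.
      (\<integral>\<^sup>+x. ennreal_powr (f x) s * indicator K x \<partial>lebesgue) \<le> D * ennreal_powr (N f) s"
begin

lemma zero: "N (\<lambda>_. 0) = 0"
  using cmult_le[of "\<lambda>_. 0" 0] by simp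

lemma cmult:
  assumes [measurable]: "f \<in> borel_measurable lebesgue" and c: "0 \<le> c"
  shows "N (\<lambda>x. ennreal c * f x) = ennreal c * N f"
proof (cases "c = 0")
  case False
  with c have "0 < c" by simp
  have eq: "ennreal (1 / c) * (ennreal c * y) = y" "ennreal c * (ennreal (1 / c) * y) = y" for y
    using \<open>0 < c\<close> by (simp_all add: mult.assoc[symmetric] flip: ennreal_mult)
  have "N f = N (\<lambda>x. ennreal (1 / c) * (ennreal c * f x))" by (simp add: eq)
  also have "\<dots> \<le> ennreal (1 / c) * N (\<lambda>x. ennreal c * f x)"
    using c by (intro cmult_le) auto
  finally have "ennreal c * N f \<le> ennreal c * (ennreal (1 / c) * N (\<lambda>x. ennreal c * f x))"
    by (rule mult_left_mono) simp
  then show ?thesis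
    using cmult_le[OF assms] by (simp add: eq)
qed (simp add: zero)

lemma AE_from_local_integrals:
  assumes "\<And>n::nat. AE x in lebesgue. ennreal_powr (f x) s * indicator (cball 0 (real n)) x \<in> Y"
    and "\<And>y. ennreal_powr y s \<in> Y \<Longrightarrow> P y"
  shows "AE x in lebesgue. P (f x)"
proof -
  have "AE x in lebesgue. \<forall>n::nat. ennreal_powr (f x) s * indicator (cball 0 (real n)) x \<in> Y"
    using assms(1) unfolding AE_all_countable by blast
  then show ?thesis
  proof eventually_elim
    case (elim x)
    obtain n :: nat where "norm x \<le> real n" using real_arch_simple by blast
    with elim have "ennreal_powr (f x) s \<in> Y" by (auto simp: indicator_def dest: spec[of _ n])
    then show ?case by (rule assms(2))
  qed
qed

lemma AE_finite:
  assumes [measurable]: "f \<in> borel_measurable lebesgue" and "N f < \<infinity>"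
  shows "AE x in lebesgue. f x < \<infinity>"
proof (rule AE_from_local_integrals[where Y="- {\<infinity>}"])
  fix n :: nat
  obtain D where "D < \<infinity>" and D: "\<And>f. f\<in>borel_measurable lebesgue \<Longrightarrow>
    (\<integral>\<^sup>+x. ennreal_powr (f x) s * indicator (cball 0 (real n)) x \<partial>lebesgue) \<le> D * ennreal_powr (N f) s"
    using local[OF compact_cball] by blast
  have "D * ennreal_powr (N f) s < \<infinity>"
    using \<open>D < \<infinity>\<close> assms(2) by (simp add: ennreal_mult_less_top)
  with D[OF assms(1)]
  have "(\<integral>\<^sup>+x. ennreal_powr (f x) s * indicator (cball 0 (real n)) x \<partial>lebesgue) \<noteq> \<infinity>"
    by (auto simp: top_unique)
  then have "AE x in lebesgue. ennreal_powr (f x) s * indicator (cball 0 (real n)) x \<noteq> \<infinity>"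
    by (intro nn_integral_noteq_infinite) auto
  then show "AE x in lebesgue. ennreal_powr (f x) s * indicator (cball 0 (real n)) x \<in> - {\<infinity>}"
    by simp
qed (metis ComplD ennreal_powr_top infinity_ennreal_def less_top singletonI)

lemma AE_zero:
  assumes [measurable]: "f \<in> borel_measurable lebesgue" and "N f = 0"
  shows "AE x in lebesgue. f x = 0"
proof (rule AE_from_local_integrals[where Y="{0}"])
  fix n :: nat
  obtain D where "D < \<infinity>" and D: "\<And>f. f\<in>borel_measurable lebesgue \<Longrightarrow>
    (\<integral>\<^sup>+x. ennreal_powr (f x) s * indicator (cball 0 (real n)) x \<partial>lebesgue) \<le> D * ennreal_powr (N f) s"
    using local[OF compact_cball] by blast
  have "(\<integral>\<^sup>+x. ennreal_powr (f x) s * indicator (cball 0 (real n)) x \<partial>lebesgue) = 0"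
    using D[OF assms(1)] assms(2) by simp
  then show "AE x in lebesgue. ennreal_powr (f x) s * indicator (cball 0 (real n)) x \<in> {0}"
    by (subst (asm) nn_integral_0_iff_AE) auto
qed simp

lemma double_ennreal:
  assumes "0 \<le> a" "0 \<le> b"
  shows "ennreal a * (ennreal b + ennreal b) = ennreal (a * (b + b))"
  using assms by (metis add_nonneg_nonneg ennreal_mult ennreal_plus)

text \<open>
  The constant of the quasi-triangle inequality is raised to a power that grows with the number of
  summands. Splitting off one summand at a time and choosing summands of size \<open>(2 * C) ^ - (k + 1)\<close>
  compensates this: each application of the inequality doubles the bound and multiplies it by \<open>C\<close>.
\<close>

lemma geometric_sum_bound:
  assumes [measurable]: "\<And>k. d k \<in> borel_measurable lebesgue"
    and d: "\<And>k. N (d k) \<le> ennreal (1 / (2 * C) ^ Suc k)"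
  shows "N (\<lambda>x. \<Sum>i<m. d (j + i) x) \<le> ennreal (1 / (2 * C) ^ j)"
proof (induction m arbitrary: j)
  case 0
  then show ?case by (simp add: zero)
next
  case (Suc m)
  have C: "0 < C" using C_ge_1 by simp
  have "N (\<lambda>x. \<Sum>i<Suc m. d (j + i) x) = N (\<lambda>x. d j x + (\<Sum>i<m. d (Suc j + i) x))"
    by (simp add: sum.lessThan_Suc_shift del: sum.lessThan_Suc)
  also have "\<dots> \<le> ennreal C * (N (d j) + N (\<lambda>x. \<Sum>i<m. d (Suc j + i) x))"
    by (rule triangle) measurable
  also have "\<dots> \<le> ennreal C * (ennreal (1 / (2 * C) ^ Suc j) + ennreal (1 / (2 * C) ^ Suc j))"
    by (intro mult_left_mono add_mono d Suc.IH) auto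
  also have "\<dots> = ennreal (C * (1 / (2 * C) ^ Suc j + 1 / (2 * C) ^ Suc j))"
    using C by (intro double_ennreal) auto
  also have "C * (1 / (2 * C) ^ Suc j + 1 / (2 * C) ^ Suc j) = 1 / (2 * C) ^ j"
    using C by (simp add: field_simps)
  finally show ?case .
qed

end

text \<open>
  The indices along which a Cauchy sequence moves geometrically fast, chosen in increasing order.
\<close>

lemma sparse_indices:
  fixes P :: "nat \<Rightarrow> nat \<Rightarrow> bool"
  assumes "\<And>k. \<exists>n\<^sub>0. P k n\<^sub>0" and "\<And>k m n. P k m \<Longrightarrow> m \<le> n \<Longrightarrow> P k n"
  obtains \<sigma> where "\<And>k. P k (\<sigma> k)" "\<And>k. \<sigma> k \<le> \<sigma> (Suc k)"
proof -
  define \<sigma> where "\<sigma> = rec_nat (SOME n. P 0 n) (\<lambda>k s. max s (SOME n. P (Suc k) n))"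
  have ex: "P k (SOME n. P k n)" for k using assms(1) by (rule someI_ex)
  show thesis
  proof (rule that[of \<sigma>])
    show "P k (\<sigma> k)" for k
      by (cases k) (auto simp: \<sigma>_def intro: ex assms(2)[OF ex])
    show "\<sigma> k \<le> \<sigma> (Suc k)" for k by (simp add: \<sigma>_def)
  qed
qed

locale weighted_function_qnorm = function_qnorm N C s
  for N :: "('e::euclidean_space \<Rightarrow> ennreal) \<Rightarrow> ennreal" and C s :: real +
  fixes W :: "'e \<Rightarrow> real"
  assumes W_pos: "0 < W x" and W_measurable[measurable]: "W \<in> borel_measurable lebesgue"
    and W_below: "compact K \<Longrightarrow> \<exists>M>0. AE x in lebesgue. x \<in> K \<longrightarrow> 1 \<le> M * W x"
begin

definition wnorm :: "('e \<Rightarrow> complex) \<Rightarrow> ennreal" where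
  "wnorm F = N (\<lambda>x. ennreal (cmod (F x) * W x))"

lemma wnorm_cong_AE: "(AE x in lebesgue. F x = G x) \<Longrightarrow> wnorm F = wnorm G"
  unfolding wnorm_def by (rule cong_AE) (auto elim!: eventually_mono)

lemma wnorm_mult:
  assumes [measurable]: "F \<in> borel_measurable lebesgue"
  shows "wnorm (\<lambda>x. c * F x) = ennreal (cmod c) * wnorm F"
proof -
  have "wnorm (\<lambda>x. c * F x) = N (\<lambda>x. ennreal (cmod c) * ennreal (cmod (F x) * W x))"
    unfolding wnorm_def using W_pos by (simp add: norm_mult mult.assoc ennreal_mult less_imp_le)
  also have "\<dots> = ennreal (cmod c) * wnorm F"
    unfolding wnorm_def by (rule cmult) auto
  finally show ?thesis .
qed

lemma wnorm_add:
  assumes [measurable]: "F \<in> borel_measurable lebesgue" "G \<in> borel_measurable lebesgue"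
  shows "wnorm (\<lambda>x. F x + G x) \<le> ennreal C * (wnorm F + wnorm G)"
proof -
  have "wnorm (\<lambda>x. F x + G x) \<le> N (\<lambda>x. ennreal (cmod (F x) * W x) + ennreal (cmod (G x) * W x))"
    unfolding wnorm_def
  proof (intro mono_AE AE_I2)
    fix x
    have "cmod (F x + G x) * W x \<le> (cmod (F x) + cmod (G x)) * W x"
      using W_pos[of x] by (intro mult_right_mono norm_triangle_ineq) auto
    then show "ennreal (cmod (F x + G x) * W x) \<le> ennreal (cmod (F x) * W x) + ennreal (cmod (G x) * W x)"
      using W_pos[of x] by (simp add: distrib_right flip: ennreal_plus)
  qed measurable
  also have "\<dots> \<le> ennreal C * (wnorm F + wnorm G)"
    unfolding wnorm_def by (rule triangle) measurable
  finally show ?thesis .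
qed

lemma wnorm_eq_0_iff:
  assumes [measurable]: "F \<in> borel_measurable lebesgue"
  shows "wnorm F = 0 \<longleftrightarrow> (AE x in lebesgue. F x = 0)"
proof
  assume "wnorm F = 0"
  then have "AE x in lebesgue. ennreal (cmod (F x) * W x) = 0"
    unfolding wnorm_def by (intro AE_zero) auto
  then show "AE x in lebesgue. F x = 0"
  proof eventually_elim
    case (elim x)
    then show ?case using W_pos[of x] by (simp add: mult_le_0_iff)
  qed
next
  assume "AE x in lebesgue. F x = 0"
  from wnorm_cong_AE[OF this] show "wnorm F = 0" by (simp add: wnorm_def zero)
qed

text \<open>
  Along a sparse subsequence the sum of the absolute values of the increments has finite quasi-norm, by
  monotone convergence and \<open>geometric_sum_bound\<close>. Hence it is finite almost everywhere and the
  subsequence converges there. The tails of the same sum dominate the distance to the limit. The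
  subsequence is part of the conclusion in order to compare \<open>v\<close> with pointwise limits.
\<close>

theorem Riesz_Fischer:
  fixes u :: "nat \<Rightarrow> 'e \<Rightarrow> complex"
  assumes [measurable]: "\<And>n. u n \<in> borel_measurable lebesgue"
    and Cauchy: "\<And>\<epsilon>. 0 < \<epsilon> \<Longrightarrow> \<exists>n\<^sub>0. \<forall>m\<ge>n\<^sub>0. \<forall>n\<ge>n\<^sub>0. wnorm (\<lambda>x. u m x - u n x) \<le> ennreal \<epsilon>"
  obtains v \<sigma> where "v \<in> borel_measurable lebesgue"
    "\<And>k. k \<le> \<sigma> k" "AE x in lebesgue. (\<lambda>k. u (\<sigma> k) x) \<longlonglongrightarrow> v x"
    "\<And>\<epsilon>. 0 < \<epsilon> \<Longrightarrow> \<exists>n\<^sub>0. \<forall>n\<ge>n\<^sub>0. wnorm (\<lambda>x. u n x - v x) \<le> ennreal \<epsilon>"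
proof -
  have C: "0 < C" using C_ge_1 by simp
  define e where "e k = 1 / (2 * C) ^ k" for k
  have e: "0 < e k" for k using C by (simp add: e_def)
  define P where "P k n\<^sub>0 \<longleftrightarrow> k \<le> n\<^sub>0 \<and>
    (\<forall>m\<ge>n\<^sub>0. \<forall>n\<ge>n\<^sub>0. wnorm (\<lambda>x. u m x - u n x) \<le> ennreal (e (Suc k)))" for k n\<^sub>0
  have P_ex: "\<exists>n\<^sub>0. P k n\<^sub>0" for k
  proof -
    obtain n\<^sub>0 where "\<forall>m\<ge>n\<^sub>0. \<forall>n\<ge>n\<^sub>0. wnorm (\<lambda>x. u m x - u n x) \<le> ennreal (e (Suc k))"
      using Cauchy[OF e] by blast
    then have "P k (max k n\<^sub>0)" unfolding P_def by simp
    then show ?thesis by blast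
  qed
  have P_mono: "P k m \<Longrightarrow> m \<le> n \<Longrightarrow> P k n" for k m n unfolding P_def by simp
  obtain \<sigma> where P: "\<And>k. P k (\<sigma> k)" and mono: "\<And>k. \<sigma> k \<le> \<sigma> (Suc k)"
    by (rule sparse_indices[of P, OF P_ex P_mono]) blast+
  have \<sigma>: "wnorm (\<lambda>x. u m x - u n x) \<le> ennreal (e (Suc k))" if "\<sigma> k \<le> m" "\<sigma> k \<le> n" for k m n
    using P[of k] that by (simp add: P_def)
  define d where "d k x = ennreal (cmod (u (\<sigma> (Suc k)) x - u (\<sigma> k) x) * W x)" for k x
  have [measurable]: "d k \<in> borel_measurable lebesgue" for k unfolding d_def by measurable
  have d: "N (d k) \<le> ennreal (1 / (2 * C) ^ Suc k)" for k
    using \<sigma>[of k "\<sigma> (Suc k)" "\<sigma> k"] mono[of k] by (simp add: wnorm_def d_def[abs_def] e_def)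
  (* The tail sums of the increments; T j dominates the distance from the j-th term to the limit. *)
  define T where "T j x = (SUP m. \<Sum>i<m. d (j + i) x)" for j x
  have [measurable]: "T j \<in> borel_measurable lebesgue" for j unfolding T_def by measurable
  have T: "N (T j) \<le> ennreal (e j)" for j
  proof -
    have "N (T j) \<le> (SUP m. N (\<lambda>x. \<Sum>i<m. d (j + i) x))"
      unfolding T_def by (rule SUP_le) (auto intro!: sum_mono2)
    also have "\<dots> \<le> ennreal (e j)"
      unfolding e_def using d by (intro SUP_least geometric_sum_bound) auto
    finally show ?thesis .
  qed
  define v where "v x = lim (\<lambda>k. u (\<sigma> k) x)" for x
  have [measurable]: "v \<in> borel_measurable lebesgue" unfolding v_def by measurable
  have partial: "ennreal (cmod (u (\<sigma> (j + m)) x - u (\<sigma> j) x) * W x) \<le> (\<Sum>i<m. d (j + i) x)" for j m x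
  proof -
    have "cmod (u (\<sigma> (j + m)) x - u (\<sigma> j) x) = cmod (\<Sum>i<m. u (\<sigma> (j + Suc i)) x - u (\<sigma> (j + i)) x)"
      by (subst sum_lessThan_telescope) simp
    also have "\<dots> \<le> (\<Sum>i<m. cmod (u (\<sigma> (j + Suc i)) x - u (\<sigma> (j + i)) x))"
      by (rule norm_sum)
    finally have "cmod (u (\<sigma> (j + m)) x - u (\<sigma> j) x) * W x
        \<le> (\<Sum>i<m. cmod (u (\<sigma> (Suc (j + i))) x - u (\<sigma> (j + i)) x) * W x)"
      using W_pos[of x] by (simp add: sum_distrib_right[symmetric])
    then show ?thesis
      using W_pos[of x] unfolding d_def by (subst sum_ennreal) (auto intro: ennreal_leI)
  qed
  have "AE x in lebesgue. T 0 x < \<infinity>"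
  proof (rule AE_finite)
    have "N (T 0) \<le> ennreal (e 0)" by (rule T)
    also have "\<dots> < \<infinity>" by simp
    finally show "N (T 0) < \<infinity>" .
  qed measurable
  then have conv: "AE x in lebesgue. (\<lambda>k. u (\<sigma> k) x) \<longlonglongrightarrow> v x"
  proof eventually_elim
    case (elim x)
    define a where "a i = u (\<sigma> (Suc i)) x - u (\<sigma> i) x" for i
    obtain b where b: "T 0 x = ennreal b" "0 \<le> b" using elim by (cases "T 0 x") auto
    have "(\<Sum>i<m. cmod (a i) * W x) \<le> b" for m
    proof -
      have "(\<Sum>i<m. d i x) \<le> T 0 x"
        unfolding T_def by (rule SUP_upper2[of m]) auto
      then have "ennreal (\<Sum>i<m. cmod (a i) * W x) \<le> ennreal b"
        using W_pos[of x] unfolding b d_def a_def by (subst (asm) sum_ennreal) auto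
      then show ?thesis using b by simp
    qed
    then have "summable (\<lambda>i. cmod (a i) * W x)"
      using W_pos[of x] by (intro summableI_nonneg_bounded[where x=b]) auto
    then have "summable (\<lambda>i. cmod (a i))"
      using W_pos[of x] summable_mult2[of "\<lambda>i. cmod (a i) * W x" "1 / W x"] by simp
    then have "summable a" by (rule summable_norm_cancel)
    then have "(\<lambda>k. (\<Sum>i<k. a i)) \<longlonglongrightarrow> suminf a" by (rule summable_LIMSEQ)
    then have "(\<lambda>k. u (\<sigma> k) x - u (\<sigma> 0) x) \<longlonglongrightarrow> suminf a"
      unfolding a_def by (simp add: sum_lessThan_telescope[of "\<lambda>k. u (\<sigma> k) x"])
    from tendsto_add[OF this tendsto_const[of "u (\<sigma> 0) x"]]
    have "convergent (\<lambda>k. u (\<sigma> k) x)" by (auto simp: convergent_def)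
    then show ?case by (simp add: v_def convergent_LIMSEQ_iff)
  qed
  have tail: "wnorm (\<lambda>x. u (\<sigma> j) x - v x) \<le> ennreal (e j)" for j
  proof -
    have "AE x in lebesgue. ennreal (cmod (u (\<sigma> j) x - v x) * W x) \<le> T j x"
      using conv
    proof eventually_elim
      case (elim x)
      have "(\<lambda>m. u (\<sigma> (j + m)) x) \<longlonglongrightarrow> v x"
        using LIMSEQ_ignore_initial_segment[OF elim, of j] by (simp add: add.commute)
      then have "(\<lambda>m. ennreal (cmod (u (\<sigma> (j + m)) x - u (\<sigma> j) x) * W x)) \<longlonglongrightarrow> ennreal (cmod (v x - u (\<sigma> j) x) * W x)"
        by (intro tendsto_intros tendsto_ennrealI)
      moreover have "ennreal (cmod (u (\<sigma> (j + m)) x - u (\<sigma> j) x) * W x) \<le> T j x" for m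
        using partial[where m=m and j=j and x=x] unfolding T_def by (rule order_trans) (rule SUP_upper, simp)
      ultimately have "ennreal (cmod (v x - u (\<sigma> j) x) * W x) \<le> T j x"
        by (intro LIMSEQ_le_const2[where X="\<lambda>m. ennreal (cmod (u (\<sigma> (j + m)) x - u (\<sigma> j) x) * W x)"]) auto
      then show ?case by (simp add: norm_minus_commute)
    qed
    then have "wnorm (\<lambda>x. u (\<sigma> j) x - v x) \<le> N (T j)"
      unfolding wnorm_def by (intro mono_AE) measurable
    also note T
    finally show ?thesis .
  qed
  show thesis
  proof (rule that[of v \<sigma>])
    show "k \<le> \<sigma> k" for k using P[of k] by (simp add: P_def)
    show "AE x in lebesgue. (\<lambda>k. u (\<sigma> k) x) \<longlonglongrightarrow> v x" by (rule conv)
    fix \<epsilon> :: real assume \<epsilon>: "0 < \<epsilon>"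
    have "(\<lambda>k. (1 / (2 * C)) ^ k) \<longlonglongrightarrow> 0"
      using C_ge_1 by (intro LIMSEQ_realpow_zero) auto
    then have "(\<lambda>k. C * (e k + e k)) \<longlonglongrightarrow> C * (0 + 0)"
      unfolding e_def by (intro tendsto_intros) (simp_all add: power_one_over)
    then have "\<forall>\<^sub>F k in sequentially. C * (e k + e k) < \<epsilon>"
      using \<epsilon> by (auto dest: order_tendstoD(2))
    then obtain k where k: "C * (e k + e k) < \<epsilon>" by (auto simp: eventually_sequentially)
    have "wnorm (\<lambda>x. u n x - v x) \<le> ennreal \<epsilon>" if n: "\<sigma> k \<le> n" for n
    proof -
      have "wnorm (\<lambda>x. u n x - v x) = wnorm (\<lambda>x. (u n x - u (\<sigma> k) x) + (u (\<sigma> k) x - v x))" by simp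
      also have "\<dots> \<le> ennreal C * (wnorm (\<lambda>x. u n x - u (\<sigma> k) x) + wnorm (\<lambda>x. u (\<sigma> k) x - v x))"
        by (rule wnorm_add) measurable
      also have "\<dots> \<le> ennreal C * (ennreal (e k) + ennreal (e k))"
      proof (intro mult_left_mono add_mono tail)
        have "e (Suc k) \<le> e k"
          using C C_ge_1 unfolding e_def by (intro divide_left_mono power_increasing) auto
        then show "wnorm (\<lambda>x. u n x - u (\<sigma> k) x) \<le> ennreal (e k)"
          using \<sigma>[OF n order_refl] by (meson ennreal_leI order_trans)
      qed simp
      also have "\<dots> = ennreal (C * (e k + e k))"
        using C e[of k] by (intro double_ennreal) auto
      also have "\<dots> \<le> ennreal \<epsilon>" using k by (simp add: ennreal_leI)
      finally show ?thesis .
    qed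
    then show "\<exists>n\<^sub>0. \<forall>n\<ge>n\<^sub>0. wnorm (\<lambda>x. u n x - v x) \<le> ennreal \<epsilon>" by blast
  qed measurable
qed

lemma nn_integral_le_wnorm:
  assumes "compact K"
  shows "\<exists>D<\<infinity>. \<forall>F\<in>borel_measurable lebesgue.
    (\<integral>\<^sup>+x. ennreal (cmod (F x) powr s) * indicator K x \<partial>lebesgue) \<le> D * ennreal_powr (wnorm F) s"
proof -
  obtain M where M: "M > 0" "AE x in lebesgue. x \<in> K \<longrightarrow> 1 \<le> M * W x"
    using W_below[OF assms] by blast
  obtain D where D: "D < \<infinity>" "\<And>f. f \<in> borel_measurable lebesgue \<Longrightarrow>
      (\<integral>\<^sup>+x. ennreal_powr (f x) s * indicator K x \<partial>lebesgue) \<le> D * ennreal_powr (N f) s"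
    using local[OF assms] by auto
  have K: "K \<in> sets lebesgue" using assms by (simp add: borel_compact)
  show ?thesis
  proof (intro exI[of _ "ennreal (M powr s) * D"] conjI ballI)
    show "ennreal (M powr s) * D < \<infinity>" using D by (simp add: ennreal_mult_less_top)
    fix F :: "'e \<Rightarrow> complex" assume [measurable]: "F \<in> borel_measurable lebesgue"
    have "AE x in lebesgue. ennreal (cmod (F x) powr s) * indicator K x
        \<le> ennreal (M powr s) * (ennreal_powr (ennreal (cmod (F x) * W x)) s * indicator K x)"
      using M(2)
    proof eventually_elim
      case (elim x)
      show ?case
      proof (cases "x \<in> K")
        case True
        then have "cmod (F x) * 1 \<le> cmod (F x) * (M * W x)" using elim by (intro mult_left_mono) auto
        then have "cmod (F x) powr s \<le> (M * (cmod (F x) * W x)) powr s"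
          using s_pos by (intro powr_mono2) (auto simp: mult_ac)
        also have "\<dots> = M powr s * (cmod (F x) * W x) powr s"
          using M W_pos[of x] by (intro powr_mult)  
        finally show ?thesis
          using True W_pos[of x] by (simp add: ennreal_powr_ennreal ennreal_leI flip: ennreal_mult)
      qed simp
    qed
    then have "(\<integral>\<^sup>+x. ennreal (cmod (F x) powr s) * indicator K x \<partial>lebesgue)
        \<le> (\<integral>\<^sup>+x. ennreal (M powr s) * (ennreal_powr (ennreal (cmod (F x) * W x)) s * indicator K x) \<partial>lebesgue)"
      by (rule nn_integral_mono_AE)
    also have "\<dots> = ennreal (M powr s) * (\<integral>\<^sup>+x. ennreal_powr (ennreal (cmod (F x) * W x)) s * indicator K x \<partial>lebesgue)"
      using K by (intro nn_integral_cmult) auto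
    also have "\<dots> \<le> ennreal (M powr s) * (D * ennreal_powr (wnorm F) s)"
      unfolding wnorm_def by (intro mult_left_mono D) auto
    finally show "(\<integral>\<^sup>+x. ennreal (cmod (F x) powr s) * indicator K x \<partial>lebesgue)
        \<le> ennreal (M powr s) * D * ennreal_powr (wnorm F) s"
      by (simp add: mult.assoc)
  qed
qed

end

lemma lebesgue_AE_imp_mixed_AE:
  fixes S :: "'a::euclidean_space \<Rightarrow> 'e::euclidean_space"
  assumes \<B>: "admissible \<B>" "spanning \<B>" and S: "linear S" "surj S"
    and P: "AE x in lebesgue. P x"
  shows "mixed_AE \<B> (\<lambda>w. P (S w))"
proof -
  have "AE x in lborel. P x" using P by (simp add: AE_completion_iff)
  then obtain Z where Z: "{x \<in> space lborel. \<not> P x} \<subseteq> Z" "emeasure lborel Z = 0" "Z \<in> sets lborel"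
    by (rule AE_E)
  have "AE x in lborel. x \<notin> Z" using Z by (intro AE_not_in) (auto simp: null_sets_def)
  moreover have "Measurable.pred borel (\<lambda>x. x \<notin> Z)" using Z by auto
  ultimately have "mixed_AE \<B> (\<lambda>w. S w \<notin> Z)"
    using mixed_AE_iff_AE_lborel[OF \<B> S] by blast
  then show ?thesis by (rule mixed_AE_mono) (use Z in auto)
qed

lemma borel_representative:
  fixes f :: "'e::euclidean_space \<Rightarrow> ennreal"
  assumes "f \<in> borel_measurable lebesgue"
  obtains g where "g \<in> borel_measurable borel" "AE x in lebesgue. f x = g x"
  using completion_ex_borel_measurable[OF assms] by (auto simp: AE_completion_iff)

text \<open>
  A Lebesgue measurable function agrees almost everywhere with a Borel function, hence also
  iterated-almost everywhere, so the properties proved by induction for Borel functions carry over.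
\<close>

theorem function_qnorm_mixed:
  fixes S :: "'a::euclidean_space \<Rightarrow> 'e::euclidean_space"
  assumes \<B>: "admissible \<B>" "spanning \<B>" and S: "linear S" "surj S"
    and s: "0 < s" "\<And>p. p \<in> set (map fst \<B>) \<Longrightarrow> ennreal s \<le> p"
  shows "function_qnorm (\<lambda>f :: 'e \<Rightarrow> ennreal. mixed_qnorm \<B> (\<lambda>w. f (S w))) (mixed_triangle_const \<B>) s"
proof -
  let ?N = "\<lambda>f :: 'e \<Rightarrow> ennreal. mixed_qnorm \<B> (\<lambda>w. f (S w))"
  have [measurable]: "S \<in> borel_measurable borel"
    by (rule linear_borel_measurable[OF S(1)])
  have cong: "?N f = ?N g" if "AE x in lebesgue. f x = g x" for f g
    by (rule mixed_qnorm_cong, rule lebesgue_AE_imp_mixed_AE[OF \<B> S that])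
  show ?thesis
  proof
    show "1 \<le> mixed_triangle_const \<B>" by (rule mixed_triangle_const_ge_1)
    show "0 < s" by (rule s)
  next
    fix f g :: "'e \<Rightarrow> ennreal" assume "AE x in lebesgue. f x = g x"
    then show "?N f = ?N g" by (rule cong)
  next
    fix f g :: "'e \<Rightarrow> ennreal"
    assume f: "f \<in> borel_measurable lebesgue" and g: "g \<in> borel_measurable lebesgue"
    obtain f' where f'[measurable]: "f' \<in> borel_measurable borel" and ff': "AE x in lebesgue. f x = f' x"
      using borel_representative[OF f] .
    obtain g' where g'[measurable]: "g' \<in> borel_measurable borel" and gg': "AE x in lebesgue. g x = g' x"
      using borel_representative[OF g] .
    { assume "AE x in lebesgue. f x \<le> g x"
      with ff' gg' have "AE x in lebesgue. f' x \<le> g' x" by eventually_elim simp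
      then have "?N f' \<le> ?N g'"
        by (intro mixed_qnorm_mono_AE[OF \<B>(1)] lebesgue_AE_imp_mixed_AE[OF \<B> S]) measurable
      then show "?N f \<le> ?N g" by (simp add: cong[OF ff'] cong[OF gg']) }
    { fix c :: real assume "0 \<le> c"
      then have "?N (\<lambda>x. ennreal c * f' x) \<le> ennreal c * ?N f'"
        by (intro mixed_qnorm_cmult_le[OF \<B>(1)]) measurable
      moreover have "?N (\<lambda>x. ennreal c * f x) = ?N (\<lambda>x. ennreal c * f' x)"
        by (rule cong) (use ff' in \<open>auto elim!: eventually_mono\<close>)
      ultimately show "?N (\<lambda>x. ennreal c * f x) \<le> ennreal c * ?N f"
        by (simp add: cong[OF ff']) }
    { have "?N (\<lambda>x. f' x + g' x) \<le> ennreal (mixed_triangle_const \<B>) * (?N f' + ?N g')"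
        by (intro mixed_qnorm_triangle[OF \<B>(1)]) measurable
      moreover have "?N (\<lambda>x. f x + g x) = ?N (\<lambda>x. f' x + g' x)"
        by (rule cong) (use ff' gg' in eventually_elim, simp)
      ultimately show "?N (\<lambda>x. f x + g x) \<le> ennreal (mixed_triangle_const \<B>) * (?N f + ?N g)"
        by (simp add: cong[OF ff'] cong[OF gg']) }
  next
    fix F :: "nat \<Rightarrow> 'e \<Rightarrow> ennreal"
    assume F: "\<And>n. F n \<in> borel_measurable lebesgue" and inc: "\<And>m n x. m \<le> n \<Longrightarrow> F m x \<le> F n x"
    have "\<forall>n. \<exists>g. g \<in> borel_measurable borel \<and> (AE x in lebesgue. F n x = g x)"
      using borel_representative[OF F] by metis
    then obtain G where [measurable]: "\<And>n. G n \<in> borel_measurable borel"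
      and G: "\<And>n. AE x in lebesgue. F n x = G n x" by metis
    (* Borel representatives chosen separately need not be increasing; their running maxima are. *)
    define H where "H n x = (SUP k\<in>{..n}. G k x)" for n x
    have [measurable]: "H n \<in> borel_measurable borel" for n unfolding H_def by measurable
    have FH: "AE x in lebesgue. F n x = H n x" for n
    proof -
      have "AE x in lebesgue. \<forall>k. F k x = G k x" using G by (simp add: AE_all_countable)
      then show ?thesis
      proof eventually_elim
        case (elim x)
        have "(SUP k\<in>{..n}. F k x) = F n x"
          using inc by (intro antisym SUP_least SUP_upper) auto
        then show ?case using elim by (simp add: H_def)
      qed
    qed
    have "?N (\<lambda>x. SUP n. F n x) = ?N (\<lambda>x. SUP n. H n x)"
    proof (rule cong)
      have "AE x in lebesgue. \<forall>n. F n x = H n x" using FH by (simp add: AE_all_countable)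
      then show "AE x in lebesgue. (SUP n. F n x) = (SUP n. H n x)" by eventually_elim simp
    qed
    also have "\<dots> \<le> (SUP n. ?N (H n))"
    proof (intro mixed_qnorm_SUP_le[OF \<B>(1)])
      fix m n :: nat and w assume "m \<le> n"
      then show "H m (S w) \<le> H n (S w)" unfolding H_def by (intro SUP_subset_mono) auto
    qed measurable
    also have "\<dots> = (SUP n. ?N (F n))" by (simp add: cong[OF FH])
    finally show "?N (\<lambda>x. SUP n. F n x) \<le> (SUP n. ?N (F n))" .
  next
    fix K :: "'e set" assume K: "compact K"
    then have [measurable]: "K \<in> sets borel" by (rule borel_compact)
    obtain D where D: "D < \<infinity>" "\<And>f. f \<in> borel_measurable borel \<Longrightarrow>
        (\<integral>\<^sup>+x. ennreal_powr (f x) s * indicator K x \<partial>lborel) \<le> D * ennreal_powr (?N f) s"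
      using nn_integral_bounded_le_mixed_qnorm[OF \<B> S s compact_imp_bounded[OF K]] by auto
    show "\<exists>D<\<infinity>. \<forall>f\<in>borel_measurable lebesgue.
      (\<integral>\<^sup>+x. ennreal_powr (f x) s * indicator K x \<partial>lebesgue) \<le> D * ennreal_powr (?N f) s"
    proof (intro exI[of _ D] conjI ballI D(1))
      fix f :: "'e \<Rightarrow> ennreal" assume f: "f \<in> borel_measurable lebesgue"
      obtain f' where f'[measurable]: "f' \<in> borel_measurable borel" and ff': "AE x in lebesgue. f x = f' x"
        using borel_representative[OF f] .
      have "(\<integral>\<^sup>+x. ennreal_powr (f x) s * indicator K x \<partial>lebesgue)
          = (\<integral>\<^sup>+x. ennreal_powr (f' x) s * indicator K x \<partial>lebesgue)"
        by (rule nn_integral_cong_AE) (use ff' in \<open>auto elim!: eventually_mono\<close>)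
      also have "\<dots> = (\<integral>\<^sup>+x. ennreal_powr (f' x) s * indicator K x \<partial>lborel)"
        by (rule nn_integral_completion)
      also have "\<dots> \<le> D * ennreal_powr (?N f) s"
        using D(2)[OF f'] by (simp add: cong[OF ff'])
      finally show "(\<integral>\<^sup>+x. ennreal_powr (f x) s * indicator K x \<partial>lebesgue) \<le> D * ennreal_powr (?N f) s" .
    qed
  qed
qed

section \<open>The Cauchy formula on a torus\<close>

definition unit_interval :: "real measure" where
  "unit_interval = restrict_space lborel {0..1}"

text \<open>
  Tori are parametrised by cubes so that every integrand is bounded on the whole space of a product
  probability measure.
\<close>

definition circ :: "real \<Rightarrow> real \<Rightarrow> complex" where
  "circ R t = of_real R * exp (2 * of_real pi * \<i> * of_real t)"

lemma space_unit_interval[simp]: "space unit_interval = {0..1}"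
  by (simp add: unit_interval_def)

lemma sets_unit_interval: "sets unit_interval = sets (restrict_space borel {0..1})"
  unfolding unit_interval_def by (intro sets_restrict_space_cong) simp

interpretation unit_interval: prob_space unit_interval
  by standard (simp add: unit_interval_def emeasure_restrict_space)

lemma continuous_on_unit_interval_measurable:
  fixes f :: "real \<Rightarrow> 'b::topological_space"
  assumes "continuous_on {0..1} f"
  shows "f \<in> borel_measurable unit_interval"
proof -
  have "f \<in> borel_measurable (restrict_space borel {0..1})"
    by (rule borel_measurable_continuous_on_restrict[OF assms])
  then show ?thesis using measurable_cong_sets[OF sets_unit_interval refl] by blast
qed

lemma norm_circ[simp]: "norm (circ R t) = \<bar>R\<bar>"
  by (simp add: circ_def norm_mult norm_exp_eq_Re)

lemma circ_eq_0_iff[simp]: "circ R t = 0 \<longleftrightarrow> R = 0"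
  by (simp add: circ_def)

lemma continuous_on_circ[continuous_intros]: "continuous_on A (circ R)"
  unfolding circ_def[abs_def] by (intro continuous_intros)

lemma circ_measurable[measurable]: "circ R \<in> borel_measurable unit_interval"
  by (intro continuous_on_unit_interval_measurable continuous_intros)

lemma integral_unit_interval:
  fixes f :: "real \<Rightarrow> complex"
  assumes "continuous_on {0..1} f"
  shows "integrable unit_interval f" "integral\<^sup>L unit_interval f = integral {0..1} f"
proof -
  have si: "set_integrable lborel {0..1} f" by (rule borel_integrable_atLeastAtMost'[OF assms])
  then show "integrable unit_interval f"
    by (simp add: unit_interval_def integrable_restrict_space set_integrable_def)
  show "integral\<^sup>L unit_interval f = integral {0..1} f"
    using set_borel_integral_eq_integral(2)[OF si]
    by (simp add: unit_interval_def integral_restrict_space set_lebesgue_integral_def)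
qed

lemma Cauchy_circ:
  assumes "continuous_on (cball 0 R) g" "g holomorphic_on ball 0 R" "norm z < R"
  shows "(\<integral>t. g (circ R t) * (circ R t / (circ R t - z)) \<partial>unit_interval) = g z"
proof -
  have R: "0 < R" using assms(3) by (meson norm_ge_zero le_less_trans)
  let ?f = "\<lambda>t. g (circ R t) * (circ R t / (circ R t - z))"
  have ne: "circ R t - z \<noteq> 0" for t
    using assms(3) R norm_circ[of R t] by auto
  have "continuous_on {0..1} (g \<circ> circ R)"
    by (rule continuous_on_compose[OF continuous_on_circ continuous_on_subset[OF assms(1)]]) (use R in auto)
  then have cont: "continuous_on {0..1} ?f"
    using ne by (auto simp: comp_def intro!: continuous_intros)
  have "((\<lambda>u. g u / (u - z)) has_contour_integral (2 * of_real pi * \<i> * g z)) (circlepath 0 R)"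
    by (rule Cauchy_integral_circlepath) (use assms in auto)
  then have "((\<lambda>t. g (circlepath 0 R t) / (circlepath 0 R t - z) *
      vector_derivative (circlepath 0 R) (at t within {0..1})) has_integral (2 * of_real pi * \<i> * g z)) {0..1}"
    by (simp add: has_contour_integral_def)
  then have "((\<lambda>t. (2 * of_real pi * \<i>) * ?f t) has_integral (2 * of_real pi * \<i> * g z)) {0..1}"
  proof (rule has_integral_eq[rotated])
    fix t :: real assume t: "t \<in> {0..1}"
    have 1: "circlepath 0 R t = circ R t" by (simp add: circ_def circlepath)
    have 2: "vector_derivative (circlepath 0 R) (at t within {0..1}) = 2 * of_real pi * \<i> * circ R t"
      using t by (simp add: vector_derivative_circlepath01 circ_def)
    show "g (circlepath 0 R t) / (circlepath 0 R t - z) *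
        vector_derivative (circlepath 0 R) (at t within {0..1}) = (2 * of_real pi * \<i>) * ?f t"
      unfolding 1 2 by simp
  qed
  from has_integral_mult_right[OF this, of "1 / (2 * of_real pi * \<i>)"]
  have "(?f has_integral g z) {0..1}" by simp
  then show ?thesis
    using integral_unit_interval(2)[OF cont] by (simp add: integral_unique)
qed

lemma mean_value_circ:
  assumes "g holomorphic_on UNIV"
  shows "(\<integral>t. g (circ 1 t) \<partial>unit_interval) = g 0"
proof -
  show ?thesis
    using Cauchy_circ[of 1 g 0] assms
    by (simp add: holomorphic_on_subset holomorphic_on_imp_continuous_on)
qed

text \<open>
  Negative powers are conjugates of positive ones up to a factor, since \<open>1 / w = cnj w / R\<^sup>2\<close> on the
  circle.
\<close>

lemma circ_moments:
  assumes "0 < R"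
  shows "(\<integral>t. circ R t ^ k / circ R t ^ l \<partial>unit_interval) = (if k = l then 1 else 0)"
proof -
  have ne: "circ R t \<noteq> 0" for t using assms by simp
  have pos: "(\<integral>t. circ R t ^ m \<partial>unit_interval) = (if m = 0 then 1 else 0)" for m
  proof -
    have "(\<integral>t. circ R t ^ m * (circ R t / (circ R t - 0)) \<partial>unit_interval) = 0 ^ m"
      by (rule Cauchy_circ) (use assms in \<open>auto intro!: continuous_intros holomorphic_intros\<close>)
    then show ?thesis using ne by (simp add: power_0_left)
  qed
  show ?thesis
  proof (cases "l \<le> k")
    case True
    have "circ R t ^ k / circ R t ^ l = circ R t ^ (k - l)" for t
      using True ne by (simp add: power_diff)
    then show ?thesis using pos[of "k - l"] True by simp
  next
    case False
    have inv: "1 / circ R t = cnj (circ R t) / of_real (R\<^sup>2)" for t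
    proof -
      have "circ R t * cnj (circ R t) = of_real (R\<^sup>2)"
        using assms complex_norm_square[of "circ R t"] by simp
      then show ?thesis using ne[of t] assms by (simp add: field_simps)
    qed
    have "circ R t ^ k / circ R t ^ l = cnj (circ R t ^ (l - k)) / of_real (R\<^sup>2) ^ (l - k)" for t
    proof -
      have "circ R t ^ k / circ R t ^ l = (1 / circ R t) ^ (l - k)"
        using False ne[of t] by (simp add: power_diff power_one_over field_simps)
      then show ?thesis by (simp add: inv power_divide)
    qed
    then have "(\<integral>t. circ R t ^ k / circ R t ^ l \<partial>unit_interval)
        = (\<integral>t. cnj (circ R t ^ (l - k)) \<partial>unit_interval) / of_real (R\<^sup>2) ^ (l - k)"
      by simp
    also have "(\<integral>t. cnj (circ R t ^ (l - k)) \<partial>unit_interval) = cnj (\<integral>t. circ R t ^ (l - k) \<partial>unit_interval)"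
      by (rule Bochner_Integration.integral_cnj)
    finally show ?thesis using pos[of "l - k"] False by simp
  qed
qed

definition upd :: "complex ^ 'd \<Rightarrow> 'd \<Rightarrow> complex \<Rightarrow> complex ^ 'd" where
  "upd z j w = (\<chi> i. if i = j then w else z $ i)"

text \<open>
  Continuity and holomorphy in each variable is equivalent to complex differentiability. In contrast to
  the latter it is visibly preserved under locally uniform limits, and it is all that the iterated Cauchy
  formula uses.
\<close>

definition separately_holomorphic :: "(complex ^ 'd \<Rightarrow> complex) \<Rightarrow> bool" where
  "separately_holomorphic F \<longleftrightarrow>
     continuous_on UNIV F \<and> (\<forall>z j. (\<lambda>w. F (upd z j w)) holomorphic_on UNIV)"

definition torus_point :: "real \<Rightarrow> 'd set \<Rightarrow> complex ^ 'd \<Rightarrow> ('d \<Rightarrow> real) \<Rightarrow> complex ^ 'd" where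
  "torus_point R S z t = (\<chi> i. if i \<in> S then circ R (t i) else z $ i)"

lemma borel_measurable_vec_lambda:
  fixes f :: "'a \<Rightarrow> 'd::finite \<Rightarrow> complex"
  assumes "\<And>i. (\<lambda>x. f x i) \<in> borel_measurable M"
  shows "(\<lambda>x. \<chi> i. f x i) \<in> borel_measurable M"
proof -
  have "(\<lambda>x. (\<chi> i. f x i) \<bullet> b) \<in> borel_measurable M" if "b \<in> Basis" for b :: "complex ^ 'd"
  proof -
    have "(\<lambda>x. \<Sum>i\<in>UNIV. f x i \<bullet> b $ i) \<in> borel_measurable M"
      by (intro borel_measurable_sum borel_measurable_inner assms) auto
    then show ?thesis by (simp add: inner_vec_def)
  qed
  then show ?thesis by (subst borel_measurable_euclidean_space) blast
qed

lemma circ_component_measurable: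
  "i \<in> S \<Longrightarrow> (\<lambda>t. circ R (t i)) \<in> borel_measurable (Pi\<^sub>M S (\<lambda>_. unit_interval))"
  by (rule measurable_compose[OF _ circ_measurable]) (rule measurable_component_singleton)

lemma torus_point_measurable:
  "torus_point R S z \<in> borel_measurable (Pi\<^sub>M S (\<lambda>_. unit_interval))"
  unfolding torus_point_def[abs_def]
proof (rule borel_measurable_vec_lambda)
  fix i
  show "(\<lambda>t. if i \<in> S then circ R (t i) else z $ i) \<in> borel_measurable (Pi\<^sub>M S (\<lambda>_. unit_interval))"
    by (cases "i \<in> S") (auto intro: circ_component_measurable)
qed

lemma norm_torus_point_le:
  "0 \<le> R \<Longrightarrow> (\<And>i. norm (z $ i) \<le> R) \<Longrightarrow> norm (torus_point R S z t :: complex ^ 'd) \<le> real CARD('d) * R"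
proof -
  assume R: "0 \<le> R" "\<And>i. norm (z $ i) \<le> R"
  have "norm (torus_point R S z t) \<le> (\<Sum>i\<in>UNIV. norm (torus_point R S z t $ i))"
    unfolding norm_vec_def by (rule L2_set_le_sum) simp
  also have "\<dots> \<le> (\<Sum>i\<in>(UNIV::'d set). R)"
    using R by (intro sum_mono) (auto simp: torus_point_def)
  finally show ?thesis by simp
qed

interpretation torus: product_sigma_finite "\<lambda>_. unit_interval" ..

lemma prob_space_torus: "prob_space (Pi\<^sub>M S (\<lambda>_. unit_interval))"
  by (rule prob_space_PiM) (rule unit_interval.prob_space_axioms)

lemma integrable_bounded:
  fixes f :: "'a \<Rightarrow> complex"
  assumes "prob_space M" "f \<in> borel_measurable M" "\<And>x. x \<in> space M \<Longrightarrow> norm (f x) \<le> b"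
  shows "integrable M f" "norm (integral\<^sup>L M f) \<le> b"
proof -
  interpret prob_space M by fact
  show i: "integrable M f"
    by (rule integrable_const_bound[where B=b]) (use assms in auto)
  have "norm (integral\<^sup>L M f) \<le> (\<integral>x. norm (f x) \<partial>M)" by (rule integral_norm_bound)
  also have "\<dots> \<le> (\<integral>x. b \<partial>M)" using assms i by (intro integral_mono) auto
  finally show "norm (integral\<^sup>L M f) \<le> b" by (simp add: prob_space)
qed

lemma continuous_bounded_on_cball:
  fixes F :: "complex ^ 'd \<Rightarrow> complex"
  assumes "continuous_on UNIV F"
  obtains M where "0 < M" "\<And>z. norm z \<le> r \<Longrightarrow> norm (F z) \<le> M"
proof -
  have "compact (F ` cball 0 r)"
    by (intro compact_continuous_image continuous_on_subset[OF assms]) auto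
  then obtain M where "0 < M" "\<And>y. y \<in> F ` cball 0 r \<Longrightarrow> norm y \<le> M"
    using compact_imp_bounded bounded_pos by metis
  then show thesis by (intro that[of M]) auto
qed

text \<open>
  Induction on the set of variables that have been moved to the circle; each step is Cauchy's formula in
  one variable inside the integral over the others.
\<close>

theorem Cauchy_torus:
  fixes F :: "complex ^ 'd \<Rightarrow> complex"
  assumes F: "separately_holomorphic F" and z: "\<And>i. norm (z $ i) < R" and S: "finite S"
  shows "(\<integral>t. F (torus_point R S z t) * (\<Prod>i\<in>S. circ R (t i) / (circ R (t i) - z $ i))
    \<partial>Pi\<^sub>M S (\<lambda>_. unit_interval)) = F z"
  using S
proof (induction S rule: finite_induct)
  case empty
  have "torus_point R {} z t = z" for t by (simp add: torus_point_def vec_eq_iff)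
  then show ?case
    using prob_space.prob_space[OF prob_space_torus[of "{} :: 'd set"]] by simp
next
  case (insert i S)
  have R: "0 < R" using z by (meson norm_ge_zero le_less_trans)
  have [measurable]: "F \<in> borel_measurable borel"
    using F by (intro borel_measurable_continuous_onI) (simp add: separately_holomorphic_def)
  let ?K = "\<lambda>i w. w / (w - z $ i)"
  let ?f = "\<lambda>t. F (torus_point R (insert i S) z t) * (\<Prod>j\<in>insert i S. ?K j (circ R (t j)))"
  obtain M where M: "0 < M" "\<And>w. norm w \<le> real CARD('d) * R \<Longrightarrow> norm (F w) \<le> M"
    using continuous_bounded_on_cball[of F "real CARD('d) * R"] F
    by (auto simp: separately_holomorphic_def)
  have K: "norm (?K j (circ R t)) \<le> R / (R - norm (z $ j))" for j t
  proof -
    have "R - norm (z $ j) \<le> norm (circ R t - z $ j)"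
      using norm_triangle_ineq2[of "circ R t" "z $ j"] R by simp
    then show ?thesis using z[of j] R by (simp add: norm_divide frac_le)
  qed
  have int: "integrable (Pi\<^sub>M (insert i S) (\<lambda>_. unit_interval)) ?f"
  proof (rule integrable_bounded(1)[OF prob_space_torus])
    note [measurable] = torus_point_measurable[of R "insert i S" z]
    have [measurable]: "(\<lambda>t. circ R (t j)) \<in> borel_measurable (Pi\<^sub>M (insert i S) (\<lambda>_. unit_interval))"
      if "j \<in> insert i S" for j
      using that by (rule circ_component_measurable)
    show "?f \<in> borel_measurable (Pi\<^sub>M (insert i S) (\<lambda>_. unit_interval))"
      by (intro borel_measurable_times borel_measurable_prod borel_measurable_divide
          borel_measurable_diff borel_measurable_const) measurable
    fix t :: "'d \<Rightarrow> real"
    have "norm (\<Prod>j\<in>insert i S. ?K j (circ R (t j))) \<le> (\<Prod>j\<in>insert i S. R / (R - norm (z $ j)))"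
      unfolding prod_norm[symmetric] by (intro prod_mono conjI K) auto
    moreover have "norm (F (torus_point R (insert i S) z t)) \<le> M"
      using z R by (intro M norm_torus_point_le) (auto intro: less_imp_le)
    ultimately show "norm (?f t) \<le> M * (\<Prod>j\<in>insert i S. R / (R - norm (z $ j)))"
      unfolding norm_mult using M(1) by (intro mult_mono) auto
  qed
  have "(\<integral>t. ?f t \<partial>Pi\<^sub>M (insert i S) (\<lambda>_. unit_interval))
      = (\<integral>t. (\<integral>y. ?f (t(i := y)) \<partial>unit_interval) \<partial>Pi\<^sub>M S (\<lambda>_. unit_interval))"
    by (rule torus.product_integral_insert[OF insert(1,2) int])
  also have "\<dots> = (\<integral>t. F (torus_point R S z t) * (\<Prod>j\<in>S. ?K j (circ R (t j))) \<partial>Pi\<^sub>M S (\<lambda>_. unit_interval))"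
  proof (intro Bochner_Integration.integral_cong refl)
    fix t :: "'d \<Rightarrow> real"
    let ?g = "\<lambda>w. F (upd (torus_point R S z t) i w)"
    have g: "?g holomorphic_on UNIV" using F by (simp add: separately_holomorphic_def)
    have pt: "torus_point R (insert i S) z (t(i := y)) = upd (torus_point R S z t) i (circ R y)" for y
      by (auto simp: torus_point_def upd_def vec_eq_iff)
    have pr: "(\<Prod>j\<in>S. ?K j (circ R ((t(i := y)) j))) = (\<Prod>j\<in>S. ?K j (circ R (t j)))" for y
      using insert(2) by (intro prod.cong) auto
    have "(\<integral>y. ?f (t(i := y)) \<partial>unit_interval)
        = (\<integral>y. (\<Prod>j\<in>S. ?K j (circ R (t j))) * (?g (circ R y) * ?K i (circ R y)) \<partial>unit_interval)"
      unfolding pt prod.insert[OF insert(1,2)] pr by (simp add: mult_ac)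
    also have "\<dots> = (\<Prod>j\<in>S. ?K j (circ R (t j))) * (\<integral>y. ?g (circ R y) * ?K i (circ R y) \<partial>unit_interval)"
      by (rule integral_mult_right_zero)
    also have "(\<integral>y. ?g (circ R y) * ?K i (circ R y) \<partial>unit_interval) = ?g (z $ i)"
      by (rule Cauchy_circ)
        (use g z in \<open>auto intro: holomorphic_on_subset holomorphic_on_imp_continuous_on\<close>)
    also have "?g (z $ i) = F (torus_point R S z t)"
      using insert(2) by (intro arg_cong[where f=F]) (auto simp: upd_def torus_point_def vec_eq_iff)
    also have "(\<Prod>j\<in>S. ?K j (circ R (t j))) * F (torus_point R S z t)
        = F (torus_point R S z t) * (\<Prod>j\<in>S. ?K j (circ R (t j)))"
      by (rule mult.commute)
    finally show "(\<integral>y. ?f (t(i := y)) \<partial>unit_interval)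
        = F (torus_point R S z t) * (\<Prod>j\<in>S. ?K j (circ R (t j)))" .
  qed
  also have "\<dots> = F z" by (rule insert.IH)
  finally show ?case .
qed

text \<open>
  On a probability space uniform convergence of the finite partial sums passes to the integrals.
\<close>

lemma has_sum_integral:
  fixes f :: "'i \<Rightarrow> 'a \<Rightarrow> complex"
  assumes M: "prob_space M" and f: "\<And>i. f i \<in> borel_measurable M" and g: "g \<in> borel_measurable M"
    and b: "\<And>i x. x \<in> space M \<Longrightarrow> norm (f i x) \<le> b i" "b summable_on UNIV"
    and sum: "\<And>x. x \<in> space M \<Longrightarrow> ((\<lambda>i. f i x) has_sum g x) UNIV"
  shows "((\<lambda>i. integral\<^sup>L M (f i)) has_sum integral\<^sup>L M g) UNIV"
proof -
  interpret prob_space M by fact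
  have unif: "uniform_limit (space M) (\<lambda>A x. \<Sum>i\<in>A. f i x) (\<lambda>x. \<Sum>\<^sub>\<infinity>i. f i x) (finite_subsets_at_top UNIV)"
    by (rule Weierstrass_m_test_general) (use b in auto)
  have int: "integrable M (f i)" for i by (rule integrable_bounded(1)[OF M f b(1)])
  obtain x where "x \<in> space M" using not_empty by blast
  have intg: "integrable M g"
  proof (rule integrable_bounded(1)[OF M g])
    fix x assume x: "x \<in> space M"
    show "norm (g x) \<le> infsum b UNIV"
      by (rule norm_infsum_le[OF sum[OF x] has_sum_infsum[OF b(2)]]) (use b x in auto)
  qed
  show ?thesis unfolding has_sum_def
  proof (rule tendstoI)
    fix e :: real assume e: "0 < e"
    have "\<forall>\<^sub>F A in finite_subsets_at_top UNIV. \<forall>x\<in>space M. dist (\<Sum>i\<in>A. f i x) (\<Sum>\<^sub>\<infinity>i. f i x) < e / 2"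
      using e by (intro uniform_limitD[OF unif]) simp
    then show "\<forall>\<^sub>F A in finite_subsets_at_top UNIV. dist (\<Sum>i\<in>A. integral\<^sup>L M (f i)) (integral\<^sup>L M g) < e"
    proof (eventually_elim)
      case (elim A)
      have "norm ((\<Sum>i\<in>A. integral\<^sup>L M (f i)) - integral\<^sup>L M g) = norm (\<integral>x. (\<Sum>i\<in>A. f i x) - g x \<partial>M)"
        using int intg by (simp add: Bochner_Integration.integral_diff Bochner_Integration.integral_sum)
      also have "\<dots> \<le> e / 2"
      proof (rule integrable_bounded(2)[OF M])
        show "(\<lambda>x. (\<Sum>i\<in>A. f i x) - g x) \<in> borel_measurable M" using f g by measurable
        fix x assume x: "x \<in> space M"
        then show "norm ((\<Sum>i\<in>A. f i x) - g x) \<le> e / 2"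
          using elim infsumI[OF sum[OF x]] by (auto simp: dist_norm less_imp_le)
      qed
      finally show ?case using e by (simp add: dist_norm)
    qed
  qed
qed

lemma summable_mi_geometric:
  fixes q :: "'d::finite \<Rightarrow> complex"
  assumes "\<And>i. norm (q i) < 1"
  shows "(\<lambda>\<alpha>. norm (\<Prod>i\<in>UNIV. q i ^ \<alpha> i)) summable_on UNIV"
proof -
  have "Infinite_Set_Sum.abs_summable_on (\<lambda>\<alpha>. \<Prod>i\<in>UNIV. q i ^ \<alpha> i) (Pi\<^sub>E UNIV (\<lambda>_::'d. UNIV :: nat set))"
  proof (rule abs_summable_on_prod_PiE)
    fix i
    have "summable (\<lambda>k. norm (q i) ^ k)" using assms by (intro summable_geometric) simp
    then show "Infinite_Set_Sum.abs_summable_on (\<lambda>k. q i ^ k) UNIV"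
      by (simp add: abs_summable_on_nat_iff' norm_power)
  qed auto
  then show ?thesis by (simp add: abs_summable_equivalent PiE_UNIV_domain)
qed

lemma has_sum_mi_geometric:
  fixes q :: "'d::finite \<Rightarrow> complex"
  assumes "\<And>i. norm (q i) < 1"
  shows "((\<lambda>\<alpha>. \<Prod>i\<in>UNIV. q i ^ \<alpha> i) has_sum (\<Prod>i\<in>UNIV. 1 / (1 - q i))) UNIV"
proof -
  have 1: "(\<lambda>k. norm (q i ^ k)) summable_on UNIV" for i
    using assms[of i] by (intro norm_summable_imp_summable_on) (simp add: norm_power summable_geometric)
  have "infsum (\<lambda>k. q i ^ k) UNIV = 1 / (1 - q i)" for i
  proof -
    have "((\<lambda>k. q i ^ k) has_sum (1 / (1 - q i))) UNIV"
      using assms[of i] by (intro norm_summable_imp_has_sum geometric_sums) (simp_all add: norm_power summable_geometric)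
    then show ?thesis by (rule infsumI)
  qed
  then have "infsum (\<lambda>\<alpha>. \<Prod>i\<in>UNIV. q i ^ \<alpha> i) (Pi\<^sub>E UNIV (\<lambda>_::'d. UNIV :: nat set)) = (\<Prod>i\<in>UNIV. 1 / (1 - q i))"
    using 1 abs_summable_equivalent by (subst infsum_prod_PiE_abs) (auto simp: abs_summable_equivalent)
  moreover have "(\<lambda>\<alpha>. \<Prod>i\<in>UNIV. q i ^ \<alpha> i) summable_on UNIV"
    using summable_mi_geometric[OF assms] by (rule abs_summable_summable)
  ultimately show ?thesis by (simp add: has_sum_infsum PiE_UNIV_domain has_sum_iff)
qed

section \<open>Power series of entire functions\<close>

lemma norm_mi_power_le:
  assumes "\<And>i. norm (z $ i) \<le> R"
  shows "norm (mi_power z \<alpha>) \<le> R ^ mi_abs \<alpha>"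
proof -
  have "norm (mi_power z \<alpha>) = (\<Prod>i\<in>UNIV. norm (z $ i) ^ \<alpha> i)"
    by (simp add: mi_power_def norm_power flip: prod_norm)
  also have "\<dots> \<le> (\<Prod>i\<in>UNIV. R ^ \<alpha> i)"
    using assms by (intro prod_mono conjI power_mono) auto
  also have "\<dots> = R ^ mi_abs \<alpha>" by (simp add: mi_abs_def power_sum)
  finally show ?thesis .
qed

lemma summable_power_mi_abs:
  fixes q :: real
  assumes "0 \<le> q" "q < 1"
  shows "(\<lambda>\<alpha> :: 'd::finite \<Rightarrow> nat. q ^ mi_abs \<alpha>) summable_on UNIV"
  using summable_mi_geometric[of "\<lambda>_::'d. complex_of_real q"] assms
  by (simp add: mi_abs_def power_sum norm_power flip: prod_norm)

definition torus_coeff :: "(complex ^ 'd \<Rightarrow> complex) \<Rightarrow> real \<Rightarrow> ('d::finite \<Rightarrow> nat) \<Rightarrow> complex" where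
  "torus_coeff F R \<alpha> =
    (\<integral>t. F (torus_point R UNIV 0 t) / (\<Prod>i\<in>UNIV. circ R (t i) ^ \<alpha> i) \<partial>Pi\<^sub>M UNIV (\<lambda>_. unit_interval))"

lemma torus_point_UNIV: "torus_point R UNIV z = torus_point R UNIV 0"
  by (simp add: torus_point_def fun_eq_iff)

lemma mi_power_torus_point: "mi_power (torus_point R UNIV z t) \<alpha> = (\<Prod>i\<in>UNIV. circ R (t i) ^ \<alpha> i)"
  by (simp add: mi_power_def torus_point_def)

lemma norm_prod_circ: "0 \<le> R \<Longrightarrow> norm (\<Prod>i\<in>UNIV. circ R (t i) ^ \<alpha> i) = R ^ mi_abs \<alpha>"
  by (simp add: norm_power mi_abs_def power_sum flip: prod_norm)

lemma torus_prod_measurable: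
  "(\<lambda>t. \<Prod>i\<in>UNIV. circ R (t i) ^ \<alpha> i) \<in> borel_measurable (Pi\<^sub>M UNIV (\<lambda>_::'d::finite. unit_interval))"
  by (intro borel_measurable_prod borel_measurable_power circ_component_measurable) auto

lemma torus_compose_measurable:
  fixes F :: "complex ^ 'd \<Rightarrow> complex"
  assumes "continuous_on UNIV F"
  shows "(\<lambda>t. F (torus_point R UNIV 0 t)) \<in> borel_measurable (Pi\<^sub>M UNIV (\<lambda>_. unit_interval))"
  by (rule measurable_compose[OF torus_point_measurable borel_measurable_continuous_onI[OF assms]])

text \<open>
  Expand each Cauchy kernel \<open>w / (w - z)\<close> into a geometric series and integrate term by term.
\<close>

lemma torus_expansion:
  fixes F :: "complex ^ 'd \<Rightarrow> complex"
  assumes F: "separately_holomorphic F" and z: "\<And>i. norm (z $ i) < R"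
  shows "((\<lambda>\<alpha>. torus_coeff F R \<alpha> * mi_power z \<alpha>) has_sum F z) UNIV"
proof -
  have R: "0 < R" using z by (meson norm_ge_zero le_less_trans)
  have cont: "continuous_on UNIV F" using F by (simp add: separately_holomorphic_def)
  obtain M where M: "0 < M" "\<And>w. norm w \<le> real CARD('d) * R \<Longrightarrow> norm (F w) \<le> M"
    using continuous_bounded_on_cball[OF cont] by metis
  let ?T = "Pi\<^sub>M UNIV (\<lambda>_::'d. unit_interval)"
  let ?w = "torus_point R UNIV (0 :: complex ^ 'd)"
  have MF: "norm (F (?w t)) \<le> M" for t
    using R by (intro M norm_torus_point_le) auto
  let ?f = "\<lambda>\<alpha> t. F (?w t) / (\<Prod>i\<in>UNIV. circ R (t i) ^ \<alpha> i) * mi_power z \<alpha>"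
  let ?g = "\<lambda>t. F (?w t) * (\<Prod>i\<in>UNIV. circ R (t i) / (circ R (t i) - z $ i))"
  note [measurable] = torus_compose_measurable[OF cont] torus_prod_measurable
  have [measurable]: "(\<lambda>t. circ R (t j)) \<in> borel_measurable ?T" for j :: 'd
    by (rule circ_component_measurable) simp
  have eq: "(\<Prod>i\<in>UNIV. (z $ i / circ R (t i)) ^ \<alpha> i) = mi_power z \<alpha> / (\<Prod>i\<in>UNIV. circ R (t i) ^ \<alpha> i)" for t \<alpha>
    by (simp add: mi_power_def power_divide prod_dividef)
  have "((\<lambda>\<alpha>. \<integral>t. ?f \<alpha> t \<partial>?T) has_sum (\<integral>t. ?g t \<partial>?T)) UNIV"
  proof (rule has_sum_integral[OF prob_space_torus])
    show "?f \<alpha> \<in> borel_measurable ?T" for \<alpha> by measurable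
    show "?g \<in> borel_measurable ?T"
      by (intro borel_measurable_times borel_measurable_prod borel_measurable_divide
          borel_measurable_diff borel_measurable_const) measurable
    let ?q = "\<lambda>i. complex_of_real (norm (z $ i) / R)"
    have "(\<lambda>\<alpha>. norm (\<Prod>i\<in>UNIV. ?q i ^ \<alpha> i)) summable_on UNIV"
      using z R by (intro summable_mi_geometric) (simp add: norm_divide)
    then show "(\<lambda>\<alpha>. M * norm (\<Prod>i\<in>UNIV. ?q i ^ \<alpha> i)) summable_on UNIV"
      by (rule summable_on_cmult_right)
    fix \<alpha> and t :: "'d \<Rightarrow> real"
    have "norm (?f \<alpha> t) = norm (F (?w t)) * norm (\<Prod>i\<in>UNIV. (z $ i / circ R (t i)) ^ \<alpha> i)"
      by (simp add: eq norm_mult norm_divide)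
    also have "norm (\<Prod>i\<in>UNIV. (z $ i / circ R (t i)) ^ \<alpha> i) = norm (\<Prod>i\<in>UNIV. ?q i ^ \<alpha> i)"
      using R by (simp add: norm_power norm_divide flip: prod_norm)
    also have "norm (F (?w t)) * \<dots> \<le> M * \<dots>"
      by (intro mult_right_mono MF) simp
    finally show "norm (?f \<alpha> t) \<le> M * norm (\<Prod>i\<in>UNIV. ?q i ^ \<alpha> i)" .
  next
    fix t :: "'d \<Rightarrow> real"
    have "((\<lambda>\<alpha>. \<Prod>i\<in>UNIV. (z $ i / circ R (t i)) ^ \<alpha> i) has_sum (\<Prod>i\<in>UNIV. 1 / (1 - z $ i / circ R (t i)))) UNIV"
      using z R by (intro has_sum_mi_geometric) (simp add: norm_divide)
    moreover have "1 / (1 - z $ i / circ R (t i)) = circ R (t i) / (circ R (t i) - z $ i)" for i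
      using R by (simp add: field_simps)
    ultimately have "((\<lambda>\<alpha>. F (?w t) * (\<Prod>i\<in>UNIV. (z $ i / circ R (t i)) ^ \<alpha> i)) has_sum ?g t) UNIV"
      by (intro has_sum_cmult_right) simp
    then show "((\<lambda>\<alpha>. ?f \<alpha> t) has_sum ?g t) UNIV" by (simp add: eq)
  qed
  also have "(\<lambda>\<alpha>. \<integral>t. ?f \<alpha> t \<partial>?T) = (\<lambda>\<alpha>. torus_coeff F R \<alpha> * mi_power z \<alpha>)"
    by (simp only: torus_coeff_def integral_mult_left_zero)
  also have "(\<integral>t. ?g t \<partial>?T) = F z"
    using Cauchy_torus[OF F z, of UNIV] by (simp add: torus_point_UNIV[of R z])
  finally show ?thesis .
qed

lemma norm_torus_coeff_le:
  fixes F :: "complex ^ 'd \<Rightarrow> complex"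
  assumes cont: "continuous_on UNIV F" and R: "0 < R"
  obtains M where "0 < M" "\<And>\<alpha>. norm (torus_coeff F R \<alpha>) \<le> M / R ^ mi_abs \<alpha>"
proof -
  obtain M where M: "0 < M" "\<And>w. norm w \<le> real CARD('d) * R \<Longrightarrow> norm (F w) \<le> M"
    using continuous_bounded_on_cball[OF cont] by metis
  note [measurable] = torus_compose_measurable[OF cont] torus_prod_measurable
  have "norm (torus_coeff F R \<alpha>) \<le> M / R ^ mi_abs \<alpha>" for \<alpha>
    unfolding torus_coeff_def
  proof (rule integrable_bounded(2)[OF prob_space_torus])
    fix t :: "'d \<Rightarrow> real"
    have "norm (F (torus_point R UNIV 0 t)) \<le> M"
      using R by (intro M norm_torus_point_le) auto
    then show "norm (F (torus_point R UNIV 0 t) / (\<Prod>i\<in>UNIV. circ R (t i) ^ \<alpha> i)) \<le> M / R ^ mi_abs \<alpha>"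
      using R by (simp add: norm_divide norm_prod_circ divide_right_mono)
  qed measurable
  with M(1) show thesis by (rule that)
qed

lemma has_sum_singleton_support:
  fixes f :: "'a \<Rightarrow> complex"
  assumes "\<And>x. x \<noteq> a \<Longrightarrow> f x = 0"
  shows "(f has_sum f a) UNIV"
proof -
  have "(f has_sum f a) {a}" using has_sum_finite[of "{a}" f] by simp
  then show ?thesis by (rule has_sum_cong_neutral[THEN iffD1, rotated -1]) (use assms in auto)
qed

text \<open>
  Orthogonality of the monomials on the torus. This shows both that the coefficients do not depend on the
  radius and that the Bargmann transform is injective.
\<close>

lemma torus_coeff_power_series:
  fixes G :: "complex ^ 'd \<Rightarrow> complex"
  assumes R: "0 < R" and cont: "continuous_on UNIV G"
    and summable: "(\<lambda>\<alpha>. norm (b \<alpha>) * R ^ mi_abs \<alpha>) summable_on UNIV"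
    and sum: "\<And>w. (\<And>i. norm (w $ i) = R) \<Longrightarrow> ((\<lambda>\<alpha>. b \<alpha> * mi_power w \<alpha>) has_sum G w) UNIV"
  shows "torus_coeff G R \<beta> = b \<beta>"
proof -
  let ?T = "Pi\<^sub>M UNIV (\<lambda>_::'d. unit_interval)"
  let ?w = "torus_point R UNIV (0 :: complex ^ 'd)"
  let ?P = "\<lambda>\<alpha> t. \<Prod>i\<in>(UNIV::'d set). circ R (t i) ^ \<alpha> i"
  let ?f = "\<lambda>\<alpha> t. b \<alpha> * ?P \<alpha> t / ?P \<beta> t"
  note [measurable] = torus_compose_measurable[OF cont] torus_prod_measurable
  have "((\<lambda>\<alpha>. \<integral>t. ?f \<alpha> t \<partial>?T) has_sum (\<integral>t. G (?w t) / ?P \<beta> t \<partial>?T)) UNIV"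
  proof (rule has_sum_integral[OF prob_space_torus])
    show "?f \<alpha> \<in> borel_measurable ?T" for \<alpha> by measurable
    show "(\<lambda>t. G (?w t) / ?P \<beta> t) \<in> borel_measurable ?T" by measurable
    show "(\<lambda>\<alpha>. norm (b \<alpha>) * R ^ mi_abs \<alpha> * (1 / R ^ mi_abs \<beta>)) summable_on UNIV"
      using summable by (rule summable_on_cmult_left)
    fix \<alpha> and t :: "'d \<Rightarrow> real"
    show "norm (?f \<alpha> t) \<le> norm (b \<alpha>) * R ^ mi_abs \<alpha> * (1 / R ^ mi_abs \<beta>)"
      using R by (simp add: norm_divide norm_mult norm_prod_circ)
  next
    fix t :: "'d \<Rightarrow> real"
    have "((\<lambda>\<alpha>. b \<alpha> * ?P \<alpha> t) has_sum G (?w t)) UNIV"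
      using sum[of "?w t"] R unfolding mi_power_torus_point by (simp add: torus_point_def)
    from has_sum_cmult_right[OF this, of "1 / ?P \<beta> t"]
    show "((\<lambda>\<alpha>. ?f \<alpha> t) has_sum (G (?w t) / ?P \<beta> t)) UNIV" by simp
  qed
  moreover have "(\<integral>t. ?f \<alpha> t \<partial>?T) = b \<alpha> * (if \<alpha> = \<beta> then 1 else 0)" for \<alpha>
  proof -
    have "(\<integral>t. ?P \<alpha> t / ?P \<beta> t \<partial>?T) = (\<integral>t. (\<Prod>i\<in>UNIV. circ R (t i) ^ \<alpha> i / circ R (t i) ^ \<beta> i) \<partial>?T)"
      by (simp add: prod_dividef)
    also have "\<dots> = (\<Prod>i\<in>UNIV. \<integral>t. circ R t ^ \<alpha> i / circ R t ^ \<beta> i \<partial>unit_interval)"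
      using R by (intro torus.product_integral_prod integral_unit_interval(1) continuous_intros) auto
    also have "\<dots> = (if \<alpha> = \<beta> then 1 else 0)"
      using R by (auto simp: circ_moments fun_eq_iff)
    finally show ?thesis by (simp flip: times_divide_eq_right)
  qed
  ultimately have "((\<lambda>\<alpha>. b \<alpha> * (if \<alpha> = \<beta> then 1 else 0)) has_sum torus_coeff G R \<beta>) UNIV"
    by (simp add: torus_coeff_def)
  moreover have "((\<lambda>\<alpha>. b \<alpha> * (if \<alpha> = \<beta> then 1 else 0)) has_sum b \<beta>) UNIV"
    using has_sum_singleton_support[of \<beta> "\<lambda>\<alpha>. b \<alpha> * (if \<alpha> = \<beta> then 1 else 0)"] by simp
  ultimately show ?thesis by (rule has_sum_unique)
qed

text \<open>
  Exactly the coefficient growth for which the power series converges everywhere. For the coefficients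
  \<open>c \<alpha> / sqrt (mi_fact \<alpha>)\<close> of a Bargmann transform it is the defining condition of \<open>H_flat1'\<close>.
\<close>

definition entire_coeffs :: "(('d::finite \<Rightarrow> nat) \<Rightarrow> complex) \<Rightarrow> bool" where
  "entire_coeffs b \<longleftrightarrow> (\<forall>r>0. \<exists>C>0. \<forall>\<alpha>. norm (b \<alpha>) \<le> C * r ^ mi_abs \<alpha>)"

lemma entire_coeffs_summable:
  fixes z :: "complex ^ 'd"
  assumes b: "entire_coeffs b" and z: "\<And>i. norm (z $ i) \<le> R" and R: "0 < R"
  shows "(\<lambda>\<alpha>. norm (b \<alpha>) * R ^ mi_abs \<alpha>) summable_on UNIV"
    and "(\<lambda>\<alpha>. norm (b \<alpha> * mi_power z \<alpha>)) summable_on UNIV"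
proof -
  obtain C where C: "C > 0" "\<And>\<alpha>. norm (b \<alpha>) \<le> C * (1 / (2 * R)) ^ mi_abs \<alpha>"
    using b R unfolding entire_coeffs_def by (meson divide_pos_pos mult_pos_pos zero_less_numeral zero_less_one)
  have bound: "norm (b \<alpha>) * R ^ mi_abs \<alpha> \<le> C * (1 / 2) ^ mi_abs \<alpha>" for \<alpha>
  proof -
    have "norm (b \<alpha>) * R ^ mi_abs \<alpha> \<le> C * (1 / (2 * R)) ^ mi_abs \<alpha> * R ^ mi_abs \<alpha>"
      using C R by (intro mult_right_mono) auto
    also have "\<dots> = C * (1 / 2) ^ mi_abs \<alpha>"
      using R by (simp add: power_divide power_mult_distrib)
    finally show ?thesis .
  qed
  have geo: "(\<lambda>\<alpha> :: 'd \<Rightarrow> nat. C * (1 / 2) ^ mi_abs \<alpha>) summable_on UNIV"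
    by (intro summable_on_cmult_right summable_power_mi_abs) auto
  show sum: "(\<lambda>\<alpha>. norm (b \<alpha>) * R ^ mi_abs \<alpha>) summable_on UNIV"
    by (rule summable_on_comparison_test[OF geo bound]) (use R in auto)
  show "(\<lambda>\<alpha>. norm (b \<alpha> * mi_power z \<alpha>)) summable_on UNIV"
    by (rule summable_on_comparison_test[OF sum])
      (use norm_mi_power_le[OF z] in \<open>auto simp: norm_mult intro!: mult_left_mono\<close>)
qed

definition mi_power_deriv :: "('d::finite \<Rightarrow> nat) \<Rightarrow> complex ^ 'd \<Rightarrow> complex ^ 'd \<Rightarrow> complex" where
  "mi_power_deriv \<alpha> z h =
    (\<Sum>i\<in>UNIV. of_nat (\<alpha> i) * h $ i * (z $ i) ^ (\<alpha> i - 1) * (\<Prod>j\<in>UNIV - {i}. (z $ j) ^ \<alpha> j))"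

lemma has_derivative_mi_power:
  "((\<lambda>z. mi_power z \<alpha>) has_derivative mi_power_deriv \<alpha> z) (at z within S)"
  unfolding mi_power_def mi_power_deriv_def[abs_def]
  by (rule has_derivative_prod) (rule has_derivative_eq_rhs, rule derivative_intros,
      rule bounded_linear_imp_has_derivative[OF bounded_linear_vec_nth], simp add: mult_ac)

lemma norm_mi_power_deriv_le:
  assumes z: "\<And>i. norm (z $ i) \<le> R" and R: "1 \<le> R"
  shows "norm (mi_power_deriv \<alpha> z h) \<le> (2 * R) ^ mi_abs \<alpha> * norm h"
proof -
  have "norm (mi_power_deriv \<alpha> z h) \<le> (\<Sum>i\<in>UNIV. real (\<alpha> i) * norm h * R ^ mi_abs \<alpha>)"
    unfolding mi_power_deriv_def
  proof (rule sum_norm_le)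
    fix i
    have "norm (\<Prod>j\<in>UNIV - {i}. (z $ j) ^ \<alpha> j) \<le> (\<Prod>j\<in>UNIV - {i}. R ^ \<alpha> j)"
      unfolding prod_norm[symmetric] norm_power using z by (intro prod_mono conjI power_mono) auto
    moreover have "norm (z $ i ^ (\<alpha> i - 1)) \<le> R ^ \<alpha> i"
    proof -
      have "norm (z $ i ^ (\<alpha> i - 1)) \<le> R ^ (\<alpha> i - 1)" using z by (simp add: norm_power power_mono)
      also have "\<dots> \<le> R ^ \<alpha> i" using R by (intro power_increasing) auto
      finally show ?thesis .
    qed
    ultimately have "norm (z $ i ^ (\<alpha> i - 1)) * norm (\<Prod>j\<in>UNIV - {i}. (z $ j) ^ \<alpha> j)
        \<le> R ^ \<alpha> i * (\<Prod>j\<in>UNIV - {i}. R ^ \<alpha> j)"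
      using R by (intro mult_mono) auto
    also have "\<dots> = R ^ mi_abs \<alpha>"
      using prod.remove[of UNIV i "\<lambda>j. R ^ \<alpha> j"] by (simp add: mi_abs_def power_sum)
    finally have *: "norm (z $ i ^ (\<alpha> i - 1)) * norm (\<Prod>j\<in>UNIV - {i}. (z $ j) ^ \<alpha> j) \<le> R ^ mi_abs \<alpha>" .
    have "norm (of_nat (\<alpha> i) * h $ i * z $ i ^ (\<alpha> i - 1) * (\<Prod>j\<in>UNIV - {i}. z $ j ^ \<alpha> j))
      = (real (\<alpha> i) * norm (h $ i)) * (norm (z $ i ^ (\<alpha> i - 1)) * norm (\<Prod>j\<in>UNIV - {i}. (z $ j) ^ \<alpha> j))"
      by (simp add: norm_mult mult.assoc)
    also have "\<dots> \<le> (real (\<alpha> i) * norm h) * R ^ mi_abs \<alpha>"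
      using * Finite_Cartesian_Product.norm_nth_le[of h i] by (intro mult_mono) auto
    finally show "norm (of_nat (\<alpha> i) * h $ i * z $ i ^ (\<alpha> i - 1) * (\<Prod>j\<in>UNIV - {i}. z $ j ^ \<alpha> j))
      \<le> real (\<alpha> i) * norm h * R ^ mi_abs \<alpha>" .
  qed
  also have "\<dots> = real (mi_abs \<alpha>) * (norm h * R ^ mi_abs \<alpha>)"
    by (simp add: mi_abs_def mult.assoc flip: sum_distrib_right)
  also have "\<dots> \<le> 2 ^ mi_abs \<alpha> * (norm h * R ^ mi_abs \<alpha>)"
    using R of_nat_less_two_power[of "mi_abs \<alpha>", where 'a=real] by (intro mult_right_mono) auto
  also have "\<dots> = (2 * R) ^ mi_abs \<alpha> * norm h" by (simp add: power_mult_distrib mult_ac)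
  finally show ?thesis .
qed

lemma mi_power_deriv_scale: "mi_power_deriv \<alpha> z (c *s h) = c * mi_power_deriv \<alpha> z h"
  by (simp add: mi_power_deriv_def sum_distrib_left mult_ac)

lemma multi_index_enumeration:
  obtains e :: "nat \<Rightarrow> 'd::finite \<Rightarrow> nat" where "bij_betw e UNIV UNIV"
proof -
  have "inj (\<lambda>n. \<lambda>_::'d. n :: nat)" by (auto simp: inj_on_def fun_eq_iff)
  then have "infinite (UNIV :: ('d \<Rightarrow> nat) set)"
    by (meson finite_imageD finite_subset infinite_UNIV_nat top_greatest)
  then show thesis
    by (intro that[OF bij_betw_from_nat_into]) auto
qed

text \<open>
  Differentiate term by term on a ball of radius \<open>R\<close>. Coefficients bounded by \<open>C * (1 / (4 * R)) ^ |\<alpha>|\<close> beat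
  the growth \<open>(2 * R) ^ |\<alpha>|\<close> of the derivatives of the monomials. The multi-indices are enumerated by the
  natural numbers so that the theorem on differentiating a series of functions applies.
\<close>

theorem entire_power_series:
  fixes b :: "('d::finite \<Rightarrow> nat) \<Rightarrow> complex"
  assumes b: "entire_coeffs b"
  shows "entire (\<lambda>z. \<Sum>\<^sub>\<infinity>\<alpha>. b \<alpha> * mi_power z \<alpha>)"
  unfolding entire_def
proof
  fix z :: "complex ^ 'd"
  obtain e :: "nat \<Rightarrow> 'd \<Rightarrow> nat" where e: "bij_betw e UNIV UNIV" by (rule multi_index_enumeration)
  define R where "R = norm z + 1"
  have R: "1 \<le> R" "0 < R" "norm z < R" by (simp_all add: R_def add_nonneg_pos)
  define S where "S = ball (0 :: complex ^ 'd) R"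
  have S: "norm (x $ i) \<le> R" if "x \<in> S" for x i
    using that Finite_Cartesian_Product.norm_nth_le[of x i] by (simp add: S_def)
  obtain C where C: "C > 0" "\<And>\<alpha>. norm (b \<alpha>) \<le> C * (1 / (4 * R)) ^ mi_abs \<alpha>"
    using b R(2) unfolding entire_coeffs_def by (meson divide_pos_pos mult_pos_pos zero_less_numeral zero_less_one)
  define B where "B n = C * (1 / 2) ^ mi_abs (e n)" for n
  define f where "f n x = b (e n) * mi_power x (e n)" for n x
  define f' where "f' n x h = b (e n) * mi_power_deriv (e n) x h" for n x h
  have sums: "(\<lambda>n. f n x) sums (\<Sum>\<^sub>\<infinity>\<alpha>. b \<alpha> * mi_power x \<alpha>)" if "x \<in> S" for x
  proof -
    have "((\<lambda>\<alpha>. b \<alpha> * mi_power x \<alpha>) has_sum (\<Sum>\<^sub>\<infinity>\<alpha>. b \<alpha> * mi_power x \<alpha>)) UNIV"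
      using entire_coeffs_summable(2)[OF b S[OF that] R(2)] by (intro has_sum_infsum) (rule abs_summable_summable)
    then show ?thesis
      unfolding f_def by (intro has_sum_imp_sums) (simp add: has_sum_reindex_bij_betw[OF e, of "\<lambda>\<alpha>. b \<alpha> * mi_power x \<alpha>"])
  qed
  have B: "summable B" "0 \<le> B n" for n
  proof -
    have "(\<lambda>\<alpha> :: 'd \<Rightarrow> nat. C * (1 / 2) ^ mi_abs \<alpha>) summable_on UNIV"
      by (intro summable_on_cmult_right summable_power_mi_abs) auto
    then have "B summable_on UNIV"
      unfolding B_def by (simp add: summable_on_reindex_bij_betw[OF e, of "\<lambda>\<alpha>. C * (1 / 2) ^ mi_abs \<alpha>"])
    then show "summable B" by (rule summable_on_imp_summable)
    show "0 \<le> B n" using C by (simp add: B_def)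
  qed
  have bound: "norm (f' n x h) \<le> B n * norm h" if "x \<in> S" for n x h
  proof -
    have "norm (f' n x h) \<le> C * (1 / (4 * R)) ^ mi_abs (e n) * ((2 * R) ^ mi_abs (e n) * norm h)"
      unfolding f'_def norm_mult using C R S[OF that]
      by (intro mult_mono norm_mi_power_deriv_le) auto
    also have "\<dots> = C * ((1 / (4 * R)) * (2 * R)) ^ mi_abs (e n) * norm h"
      by (simp only: power_mult_distrib mult_ac)
    also have "(1 / (4 * R)) * (2 * R) = 1 / 2" using R by simp
    finally show ?thesis by (simp add: B_def)
  qed
  have summ: "summable (\<lambda>n. f' n x h)" if "x \<in> S" for x h
    using bound[OF that] by (intro summable_comparison_test'[OF summable_mult2[OF B(1)]]) auto
  define g' where "g' x h = (\<Sum>n. f' n x h)" for x h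
  have "\<exists>g. \<forall>x\<in>S. (\<lambda>n. f n x) sums g x \<and> (g has_derivative g' x) (at x within S)"
  proof (rule has_derivative_series)
    show "convex S" by (simp add: S_def)
    show "(f n has_derivative f' n x) (at x within S)" for n x
      unfolding f_def[abs_def] f'_def[abs_def] by (intro has_derivative_mult_right has_derivative_mi_power)
    show z: "z \<in> S" using R by (simp add: S_def)
    show "(\<lambda>n. f n z) sums (\<Sum>\<^sub>\<infinity>\<alpha>. b \<alpha> * mi_power z \<alpha>)" by (rule sums[OF z])
    fix \<epsilon> :: real assume \<epsilon>: "0 < \<epsilon>"
    obtain N where N: "\<And>n. n \<ge> N \<Longrightarrow> norm (\<Sum>i. B (i + n)) < \<epsilon>"
      using suminf_exist_split[OF \<epsilon> B(1)] by blast
    have "norm ((\<Sum>i<n. f' i x h) - g' x h) \<le> \<epsilon> * norm h" if n: "N \<le> n" and x: "x \<in> S" for n x h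
    proof -
      have "norm ((\<Sum>i<n. f' i x h) - g' x h) = norm (\<Sum>i. f' (i + n) x h)"
        unfolding g'_def suminf_minus_initial_segment[OF summ[OF x]] by (rule norm_minus_commute)
      also have "\<dots> \<le> (\<Sum>i. B (i + n) * norm h)"
      proof (rule norm_suminf_le)
        show "norm (f' (i + n) x h) \<le> B (i + n) * norm h" for i by (rule bound[OF x])
        show "summable (\<lambda>i. B (i + n) * norm h)"
          using B(1) by (intro summable_mult2 summable_ignore_initial_segment)
      qed
      also have "\<dots> = (\<Sum>i. B (i + n)) * norm h"
        using B(1) by (intro suminf_mult2[symmetric] summable_ignore_initial_segment)
      also have "\<dots> \<le> \<epsilon> * norm h"
        using N[OF n] by (intro mult_right_mono) auto
      finally show ?thesis .
    qed
    then show "\<forall>\<^sub>F n in sequentially. \<forall>x\<in>S. \<forall>h. norm ((\<Sum>i<n. f' i x h) - g' x h) \<le> \<epsilon> * norm h"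
      unfolding eventually_sequentially by blast
  qed
  then obtain g where g: "\<And>x. x \<in> S \<Longrightarrow> (\<lambda>n. f n x) sums g x"
    "\<And>x. x \<in> S \<Longrightarrow> (g has_derivative g' x) (at x within S)" by blast
  have z: "z \<in> S" "open S" using R by (simp_all add: S_def)
  have "(g has_derivative g' z) (at z)"
    using g(2)[OF z(1)] by (simp add: at_within_open[OF z])
  then have "((\<lambda>z. \<Sum>\<^sub>\<infinity>\<alpha>. b \<alpha> * mi_power z \<alpha>) has_derivative g' z) (at z)"
    by (rule has_derivative_transform_within_open[OF _ z(2,1)]) (use g(1) sums sums_unique2 in blast)
  moreover have "g' z (c *s h) = c * g' z h" for c h
    unfolding g'_def f'_def using suminf_mult[OF summ[OF z(1)], of c h]
    by (simp add: mi_power_deriv_scale f'_def mult.left_commute)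
  ultimately show "\<exists>D. ((\<lambda>z. \<Sum>\<^sub>\<infinity>\<alpha>. b \<alpha> * mi_power z \<alpha>) has_derivative D) (at z) \<and> (\<forall>c v. D (c *s v) = c * D v)"
    by blast
qed

lemma linear_smult_vec: "linear (\<lambda>w. w *s (q :: complex ^ 'd))"
  by (rule linearI) (simp_all add: vec_eq_iff algebra_simps)

lemma entire_holomorphic_on_line:
  assumes "entire F"
  shows "(\<lambda>w. F (p + w *s q)) holomorphic_on UNIV"
proof (rule holomorphic_onI)
  fix w :: complex
  obtain D where D: "(F has_derivative D) (at (p + w *s q))" "\<And>c v. D (c *s v) = c * D v"
    using assms unfolding entire_def by blast
  have "((\<lambda>w. p + w *s q) has_derivative (\<lambda>v. v *s q)) (at w)"
    using bounded_linear_imp_has_derivative[OF linear_smult_vec[unfolded linear_conv_bounded_linear]]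
    by (auto intro!: derivative_eq_intros)
  from diff_chain_at[OF this D(1)]
  have "((\<lambda>w. F (p + w *s q)) has_derivative (*) (D q)) (at w)"
    by (simp add: o_def D(2) mult.commute[of _ "D q"])
  then show "(\<lambda>w. F (p + w *s q)) field_differentiable at w within UNIV"
    unfolding field_differentiable_def has_field_derivative_def by auto
qed

lemma entire_imp_continuous: "entire F \<Longrightarrow> continuous_on A F"
  unfolding entire_def by (meson continuous_at_imp_continuous_on has_derivative_continuous)

lemma upd_eq: "upd z j w = upd z j 0 + w *s axis j 1"
  by (simp add: upd_def axis_def vec_eq_iff)

lemma entire_imp_separately_holomorphic: "entire F \<Longrightarrow> separately_holomorphic F"
  unfolding separately_holomorphic_def
  by (subst upd_eq) (simp add: entire_imp_continuous entire_holomorphic_on_line)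

lemma separately_holomorphic_limit:
  fixes f :: "nat \<Rightarrow> complex ^ 'd \<Rightarrow> complex"
  assumes f: "\<And>n. separately_holomorphic (f n)"
    and lim: "\<And>r. uniform_limit (cball 0 r) f g sequentially"
  shows "separately_holomorphic g"
  unfolding separately_holomorphic_def
proof (intro conjI allI)
  show "continuous_on UNIV g"
  proof (rule continuous_at_imp_continuous_on, rule ballI)
    fix x :: "complex ^ 'd"
    have "continuous_on (cball 0 (norm x + 1)) g"
      by (rule uniform_limit_theorem[OF always_eventually lim])
        (use f in \<open>auto simp: separately_holomorphic_def intro: continuous_on_subset\<close>)
    then have "continuous_on (ball 0 (norm x + 1)) g" by (rule continuous_on_subset) auto
    then show "isCont g x" by (simp add: continuous_on_eq_continuous_at)
  qed
  fix z :: "complex ^ 'd" and j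
  show "(\<lambda>w. g (upd z j w)) holomorphic_on UNIV"
  proof (rule holomorphic_uniform_sequence)
    show "(\<lambda>w. f n (upd z j w)) holomorphic_on UNIV" for n
      using f by (simp add: separately_holomorphic_def)
    fix x :: complex
    define r where "r = norm (upd z j 0) + (norm x + 1)"
    have "upd z j w \<in> cball 0 r" if "w \<in> cball x 1" for w
    proof -
      have "norm w \<le> norm x + 1"
        using that norm_triangle_ineq[of x "w - x"] by (simp add: dist_norm norm_minus_commute)
      moreover have "norm (w *s axis j 1 :: complex ^ 'd) \<le> norm w"
      proof -
        have "norm (w *s axis j 1 :: complex ^ 'd) \<le> (\<Sum>i\<in>UNIV. norm ((w *s axis j 1 :: complex ^ 'd) $ i))"
          unfolding norm_vec_def by (rule L2_set_le_sum) simp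
        also have "\<dots> = (\<Sum>i\<in>UNIV. if i = j then norm w else 0)"
          by (intro sum.cong) (auto simp: axis_def)
        finally show ?thesis by simp
      qed
      ultimately show ?thesis
        using norm_triangle_ineq[of "upd z j 0" "w *s axis j 1"] by (simp add: upd_eq[of z j w] r_def)
    qed
    then have "uniform_limit (cball x 1) (\<lambda>n w. f n (upd z j w)) (\<lambda>w. g (upd z j w)) sequentially"
      using lim[of r] unfolding uniform_limit_iff by (fast elim: eventually_mono)
    then show "\<exists>d>0. cball x d \<subseteq> UNIV \<and>
        uniform_limit (cball x d) (\<lambda>n w. f n (upd z j w)) (\<lambda>w. g (upd z j w)) sequentially"
      by (intro exI[of _ 1]) simp
  qed simp
qed

text \<open>
  The coefficients on the torus of radius \<open>R\<close> are bounded by a multiple of \<open>R ^ - |\<alpha>|\<close> and independent of \<open>R\<close>.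
\<close>

theorem separately_holomorphic_power_series:
  fixes F :: "complex ^ 'd \<Rightarrow> complex"
  assumes F: "separately_holomorphic F"
  obtains b where "entire_coeffs b" "\<And>z. ((\<lambda>\<alpha>. b \<alpha> * mi_power z \<alpha>) has_sum F z) UNIV"
proof -
  have cont: "continuous_on UNIV F" using F by (simp add: separately_holomorphic_def)
  have coeff: "torus_coeff F 1 = torus_coeff F R" if R: "1 < R" for R
  proof
    fix \<beta>
    show "torus_coeff F 1 \<beta> = torus_coeff F R \<beta>"
    proof (rule torus_coeff_power_series[OF _ cont])
      obtain M where M: "0 < M" "\<And>\<alpha>. norm (torus_coeff F R \<alpha>) \<le> M / R ^ mi_abs \<alpha>"
        using norm_torus_coeff_le[OF cont, of R] R by auto
      have "(\<lambda>\<alpha> :: 'd \<Rightarrow> nat. M * (1 / R) ^ mi_abs \<alpha>) summable_on UNIV"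
        using R by (intro summable_on_cmult_right summable_power_mi_abs) auto
      then show "(\<lambda>\<alpha>. norm (torus_coeff F R \<alpha>) * 1 ^ mi_abs \<alpha>) summable_on UNIV"
        by (rule summable_on_comparison_test) (use M(2) in \<open>auto simp: power_divide\<close>)
      show "((\<lambda>\<alpha>. torus_coeff F R \<alpha> * mi_power w \<alpha>) has_sum F w) UNIV" if "\<And>i. norm (w $ i) = 1" for w
        using that R by (intro torus_expansion[OF F]) auto
    qed simp
  qed
  show thesis
  proof (rule that[of "torus_coeff F 1"])
    show "entire_coeffs (torus_coeff F 1)"
      unfolding entire_coeffs_def
    proof (intro allI impI)
      fix r :: real assume r: "0 < r"
      (* A radius above one, as coeff requires, with 1 / R <= r. *)
      define R where "R = max 2 (1 / r)"
      have R: "1 < R" "1 / R \<le> r"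
        using r by (auto simp: R_def divide_le_eq max_def field_simps)
      obtain M where M: "0 < M" "\<And>\<alpha>. norm (torus_coeff F R \<alpha>) \<le> M / R ^ mi_abs \<alpha>"
        using norm_torus_coeff_le[OF cont, of R] R by auto
      have "norm (torus_coeff F 1 \<alpha>) \<le> M * r ^ mi_abs \<alpha>" for \<alpha>
      proof -
        have "norm (torus_coeff F 1 \<alpha>) \<le> M * (1 / R) ^ mi_abs \<alpha>"
          using M(2)[of \<alpha>] by (simp add: coeff[OF R(1)] power_divide)
        also have "\<dots> \<le> M * r ^ mi_abs \<alpha>"
          using M(1) R by (intro mult_left_mono power_mono) auto
        finally show ?thesis .
      qed
      with M(1) show "\<exists>C>0. \<forall>\<alpha>. norm (torus_coeff F 1 \<alpha>) \<le> C * r ^ mi_abs \<alpha>" by blast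
    qed
    fix z :: "complex ^ 'd"
    define R where "R = norm z + 2"
    have R: "1 < R" using norm_ge_zero[of z] unfolding R_def by linarith
    have "norm (z $ i) < R" for i
      using Finite_Cartesian_Product.norm_nth_le[of z i] by (simp add: R_def)
    then show "((\<lambda>\<alpha>. torus_coeff F 1 \<alpha> * mi_power z \<alpha>) has_sum F z) UNIV"
      unfolding coeff[OF R] by (rule torus_expansion[OF F])
  qed
qed

corollary separately_holomorphic_imp_entire:
  assumes "separately_holomorphic F"
  shows "entire F"
proof -
  obtain b where b: "entire_coeffs b" "\<And>z. ((\<lambda>\<alpha>. b \<alpha> * mi_power z \<alpha>) has_sum F z) UNIV"
    using separately_holomorphic_power_series[OF assms] by metis
  have "F = (\<lambda>z. \<Sum>\<^sub>\<infinity>\<alpha>. b \<alpha> * mi_power z \<alpha>)"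
    using infsumI[OF b(2)] by auto
  then show ?thesis using entire_power_series[OF b(1)] by simp
qed

section \<open>Sub-mean value properties\<close>

text \<open>
  Average \<open>f (T x + y)\<close> over \<open>x\<close> in the whole space and \<open>y\<close> in the unit ball. In one order translation
  invariance gives the integral of \<open>f \<circ> T\<close> times the volume of the ball; in the other order it gives the
  integral of \<open>f\<close> times the volume of the preimage of a ball under an isometry, which is a ball.
\<close>

lemma nn_integral_linear_isometry:
  fixes T :: "'a::euclidean_space \<Rightarrow> 'a" and f :: "'a \<Rightarrow> ennreal"
  assumes T: "linear T" "surj T" "\<And>x. norm (T x) = norm x"
    and [measurable]: "f \<in> borel_measurable borel"
  shows "(\<integral>\<^sup>+x. f (T x) \<partial>lborel) = (\<integral>\<^sup>+x. f x \<partial>lborel)"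
proof -
  note [measurable] = linear_borel_measurable[OF T(1)]
  let ?B = "cball (0 :: 'a) 1"
  let ?h = "indicator ?B :: 'a \<Rightarrow> ennreal"
  let ?m = "emeasure lborel ?B"
  have m: "0 < ?m" "?m < \<infinity>"
    using emeasure_lborel_cball_finite[of "0::'a" 1] unit_ball_vol_pos[of "real DIM('a)"]
    by (auto simp: emeasure_cball less_top[symmetric])
  have "(\<integral>\<^sup>+y. (\<integral>\<^sup>+x. ?h y * f (T x + y) \<partial>lborel) \<partial>lborel) = (\<integral>\<^sup>+y. ?h y * (\<integral>\<^sup>+x. f (T x) \<partial>lborel) \<partial>lborel)"
  proof (rule nn_integral_cong)
    fix y :: 'a
    obtain u where u: "y = T u" using T(2) by blast
    have "(\<integral>\<^sup>+x. f (T (x + u)) \<partial>lborel) = (\<integral>\<^sup>+x. f (T x) \<partial>lborel)"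
      by (rule nn_integral_lborel_translate) measurable
    then show "(\<integral>\<^sup>+x. ?h y * f (T x + y) \<partial>lborel) = ?h y * (\<integral>\<^sup>+x. f (T x) \<partial>lborel)"
      by (simp add: nn_integral_cmult u linear_add[OF T(1)])
  qed
  also have "\<dots> = ?m * (\<integral>\<^sup>+x. f (T x) \<partial>lborel)"
    by (simp add: nn_integral_multc)
  finally have 1: "(\<integral>\<^sup>+y. (\<integral>\<^sup>+x. ?h y * f (T x + y) \<partial>lborel) \<partial>lborel) = ?m * (\<integral>\<^sup>+x. f (T x) \<partial>lborel)" .
  have "(\<integral>\<^sup>+y. (\<integral>\<^sup>+x. ?h y * f (T x + y) \<partial>lborel) \<partial>lborel)
      = (\<integral>\<^sup>+x. (\<integral>\<^sup>+y. ?h y * f (T x + y) \<partial>lborel) \<partial>lborel)"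
    by (rule lborel_pair.Fubini') measurable
  also have "\<dots> = (\<integral>\<^sup>+x. (\<integral>\<^sup>+y. ?h (y - T x) * f y \<partial>lborel) \<partial>lborel)"
  proof (rule nn_integral_cong)
    fix x :: 'a
    have "(\<integral>\<^sup>+y. ?h (y + T x - T x) * f (y + T x) \<partial>lborel) = (\<integral>\<^sup>+y. ?h (y - T x) * f y \<partial>lborel)"
      by (rule nn_integral_lborel_translate) measurable
    then show "(\<integral>\<^sup>+y. ?h y * f (T x + y) \<partial>lborel) = (\<integral>\<^sup>+y. ?h (y - T x) * f y \<partial>lborel)"
      by (simp add: add.commute)
  qed
  also have "\<dots> = (\<integral>\<^sup>+y. (\<integral>\<^sup>+x. ?h (y - T x) * f y \<partial>lborel) \<partial>lborel)"
    by (rule lborel_pair.Fubini'[symmetric]) measurable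
  also have "\<dots> = (\<integral>\<^sup>+y. ?m * f y \<partial>lborel)"
  proof (rule nn_integral_cong)
    fix y :: 'a
    obtain u where u: "y = T u" using T(2) by blast
    have "norm (y - T x) = norm (x - u)" for x
      using T(3)[of "u - x"] by (simp add: u linear_diff[OF T(1)] norm_minus_commute)
    then have "?h (y - T x) = ?h (x + (- u))" for x by (simp add: indicator_def)
    moreover have "(\<integral>\<^sup>+x. ?h (x + (- u)) \<partial>lborel) = (\<integral>\<^sup>+x. ?h x \<partial>lborel)"
      by (rule nn_integral_lborel_translate) measurable
    ultimately show "(\<integral>\<^sup>+x. ?h (y - T x) * f y \<partial>lborel) = ?m * f y"
      by (simp add: nn_integral_multc)
  qed
  also have "\<dots> = ?m * (\<integral>\<^sup>+y. f y \<partial>lborel)" by (rule nn_integral_cmult) simp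
  finally show ?thesis
    using m 1 by (auto simp: ennreal_mult_cancel_left)
qed

lemma norm_unimodular_smult:
  fixes z :: "complex ^ 'd"
  assumes "norm c = 1"
  shows "norm (c *s z) = norm z"
  using assms by (simp add: norm_vec_def norm_mult)

text \<open>
  On each complex line through \<open>z\<close> the value at \<open>z\<close> is the mean over circles. Integrating over \<open>w\<close> in a ball
  and exchanging the integrals, the rotation \<open>w \<mapsto> circ 1 t *s w\<close> disappears because Lebesgue measure is
  invariant under unitary maps.
\<close>

theorem entire_sub_mean_value:
  fixes F :: "complex ^ 'd \<Rightarrow> complex"
  assumes F: "entire F"
  shows "ennreal (norm (F z)) * emeasure lborel (cball (0 :: complex ^ 'd) \<delta>)
    \<le> (\<integral>\<^sup>+w. ennreal (norm (F w)) * indicator (cball z \<delta>) w \<partial>lborel)"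
proof -
  have cont: "continuous_on UNIV F" by (rule entire_imp_continuous[OF F])
  have [measurable]: "F \<in> borel_measurable borel" by (rule borel_measurable_continuous_onI[OF cont])
  let ?B = "cball (0 :: complex ^ 'd) \<delta>"
  have smult_measurable: "(\<lambda>p. fst p *s snd p :: complex ^ 'd) \<in> borel_measurable (borel \<Otimes>\<^sub>M borel)"
    unfolding vector_scalar_mult_def
    by (rule borel_measurable_vec_lambda, intro borel_measurable_times)
      (measurable, rule measurable_compose[OF measurable_snd],
        intro borel_measurable_continuous_onI continuous_intros)
  have [measurable]: "(\<lambda>p. circ 1 (fst p) *s snd p :: complex ^ 'd) \<in> borel_measurable (unit_interval \<Otimes>\<^sub>M borel)"
    using measurable_compose[OF _ smult_measurable, of "\<lambda>p. (circ 1 (fst p), snd p)"] by simp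
  have mean: "ennreal (norm (F z)) \<le> (\<integral>\<^sup>+t. ennreal (norm (F (z + circ 1 t *s w))) \<partial>unit_interval)" for w
  proof -
    have hol: "(\<lambda>c. F (z + c *s w)) holomorphic_on UNIV" by (rule entire_holomorphic_on_line[OF F])
    have "continuous_on UNIV (\<lambda>c. F (z + c *s w))" using hol by (rule holomorphic_on_imp_continuous_on)
    then have "continuous_on {0..1} ((\<lambda>c. F (z + c *s w)) \<circ> circ 1)"
      by (intro continuous_on_compose continuous_on_circ) (auto intro: continuous_on_subset)
    then have int: "integrable unit_interval (\<lambda>t. F (z + circ 1 t *s w))"
      by (intro integral_unit_interval(1)) (simp add: o_def)
    have "F z = (\<integral>t. F (z + circ 1 t *s w) \<partial>unit_interval)"
      using mean_value_circ[OF hol] by simp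
    then have "norm (F z) \<le> (\<integral>t. norm (F (z + circ 1 t *s w)) \<partial>unit_interval)"
      by (metis integral_norm_bound)
    then have "ennreal (norm (F z)) \<le> ennreal (\<integral>t. norm (F (z + circ 1 t *s w)) \<partial>unit_interval)"
      by (rule ennreal_leI)
    also have "\<dots> = (\<integral>\<^sup>+t. ennreal (norm (F (z + circ 1 t *s w))) \<partial>unit_interval)"
      using int by (intro nn_integral_eq_integral[symmetric]) auto
    finally show ?thesis .
  qed
  interpret P: pair_sigma_finite unit_interval "lborel :: (complex ^ 'd) measure" ..
  have "ennreal (norm (F z)) * emeasure lborel ?B = (\<integral>\<^sup>+w. ennreal (norm (F z)) * indicator ?B w \<partial>lborel)"
    by (simp add: nn_integral_cmult_indicator)
  also have "\<dots> \<le> (\<integral>\<^sup>+w. (\<integral>\<^sup>+t. ennreal (norm (F (z + circ 1 t *s w))) * indicator ?B w \<partial>unit_interval) \<partial>lborel)"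
  proof (rule nn_integral_mono)
    fix w :: "complex ^ 'd"
    show "ennreal (norm (F z)) * indicator ?B w
        \<le> (\<integral>\<^sup>+t. ennreal (norm (F (z + circ 1 t *s w))) * indicator ?B w \<partial>unit_interval)"
      using mean[of w] by (cases "w \<in> ?B") auto
  qed
  also have "\<dots> = (\<integral>\<^sup>+t. (\<integral>\<^sup>+w. ennreal (norm (F (z + circ 1 t *s w))) * indicator ?B w \<partial>lborel) \<partial>unit_interval)"
    by (rule P.Fubini') measurable
  also have "\<dots> = (\<integral>\<^sup>+t. (\<integral>\<^sup>+w. ennreal (norm (F w)) * indicator (cball z \<delta>) w \<partial>lborel) \<partial>unit_interval)"
  proof (rule nn_integral_cong)
    fix t
    let ?T = "\<lambda>w :: complex ^ 'd. circ 1 t *s w"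
    have nT: "norm (?T w) = norm w" for w by (rule norm_unimodular_smult) simp
    have lin: "linear ?T" by (rule linearI) (simp_all add: vec_eq_iff algebra_simps)
    have "?T (inverse (circ 1 t) *s w) = w" for w by (simp add: vector_smult_assoc)
    then have "surj ?T" by (metis surjI)
    have "(\<integral>\<^sup>+w. ennreal (norm (F (z + ?T w))) * indicator ?B w \<partial>lborel)
        = (\<integral>\<^sup>+w. ennreal (norm (F (z + ?T w))) * indicator ?B (?T w) \<partial>lborel)"
      by (intro nn_integral_cong) (simp add: indicator_def nT)
    also have "\<dots> = (\<integral>\<^sup>+w. ennreal (norm (F (z + w))) * indicator ?B w \<partial>lborel)"
      by (rule nn_integral_linear_isometry[OF lin \<open>surj ?T\<close> nT, of "\<lambda>w. ennreal (norm (F (z + w))) * indicator ?B w"]) measurable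
    also have "\<dots> = (\<integral>\<^sup>+w. ennreal (norm (F (w + z))) * indicator (cball z \<delta>) (w + z) \<partial>lborel)"
      by (intro nn_integral_cong) (simp add: indicator_def dist_norm add.commute)
    also have "\<dots> = (\<integral>\<^sup>+w. ennreal (norm (F w)) * indicator (cball z \<delta>) w \<partial>lborel)"
      by (rule nn_integral_lborel_translate) measurable
    finally show "(\<integral>\<^sup>+w. ennreal (norm (F (z + ?T w))) * indicator ?B w \<partial>lborel)
        = (\<integral>\<^sup>+w. ennreal (norm (F w)) * indicator (cball z \<delta>) w \<partial>lborel)" .
  qed
  also have "\<dots> = (\<integral>\<^sup>+w. ennreal (norm (F w)) * indicator (cball z \<delta>) w \<partial>lborel)"
    by (simp add: unit_interval.emeasure_space_1[simplified])
  finally show ?thesis .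
qed

text \<open>
  Maximise \<open>(1 - dist z w) powr (n / s) * f w\<close> over the unit ball, with maximum \<open>Q\<close> at \<open>w\<^sub>0\<close>. On the ball
  around \<open>w\<^sub>0\<close> of half the distance to the boundary, \<open>f\<close> is at most \<open>Q * \<delta> powr (- (n / s))\<close>. Hence one can
  replace \<open>f\<close> by this bound to the power \<open>1 - s\<close> times \<open>f powr s\<close> in the mean value inequality at \<open>w\<^sub>0\<close>, and
  \<open>Q powr s\<close> remains after cancellation. The weight exponent \<open>n / s\<close> is the one for which the powers of
  \<open>\<delta>\<close> cancel.
\<close>

theorem sub_mean_value_powr:
  fixes f :: "'a::euclidean_space \<Rightarrow> real" and z :: 'a
  assumes cont: "continuous_on UNIV f" and nonneg: "\<And>x. 0 \<le> f x"
    and sub: "\<And>z \<delta>. 0 < \<delta> \<Longrightarrow> ennreal (f z) * emeasure lborel (cball (0::'a) \<delta>)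
      \<le> (\<integral>\<^sup>+w. ennreal (f w) * indicator (cball z \<delta>) w \<partial>lborel)"
    and s: "0 < s" "s \<le> 1"
  shows "ennreal (f z powr s) \<le> ennreal (2 powr (DIM('a) / s) / unit_ball_vol (DIM('a))) *
    (\<integral>\<^sup>+w. ennreal (f w powr s) * indicator (cball z 1) w \<partial>lborel)"
proof -
  define n where "n = real DIM('a)"
  define \<nu> where "\<nu> = unit_ball_vol n"
  have n: "0 < n" by (simp add: n_def)
  have \<nu>: "0 < \<nu>" by (simp add: \<nu>_def n_def unit_ball_vol_pos)
  have [measurable]: "f \<in> borel_measurable borel" by (rule borel_measurable_continuous_onI[OF cont])
  define \<phi> where "\<phi> w = (1 - dist z w) powr (n / s) * f w" for w
  have "continuous_on (cball z 1) \<phi>"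
    unfolding \<phi>_def
    by (intro continuous_on_mult continuous_on_powr' continuous_on_subset[OF cont] continuous_intros)
      (use n s in auto)
  then obtain w\<^sub>0 where w\<^sub>0: "w\<^sub>0 \<in> cball z 1" and max: "\<And>w. w \<in> cball z 1 \<Longrightarrow> \<phi> w \<le> \<phi> w\<^sub>0"
    using continuous_attains_sup[of "cball z 1" \<phi>] by fastforce
  define Q where "Q = \<phi> w\<^sub>0"
  have fz: "f z \<le> Q" using max[of z] by (simp add: Q_def \<phi>_def)
  let ?A = "\<integral>\<^sup>+w. ennreal (f w powr s) * indicator (cball z 1) w \<partial>lborel"
  show ?thesis
  proof (cases "Q \<le> 0")
    case True
    then have "f z = 0" using fz nonneg[of z] by simp
    then show ?thesis by simp
  next
    case False
    then have Q: "0 < Q" by simp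
    define \<delta> where "\<delta> = (1 - dist z w\<^sub>0) / 2"
    have \<delta>: "0 < \<delta>"
      using w\<^sub>0 Q n s by (cases "dist z w\<^sub>0 = 1") (auto simp: \<delta>_def Q_def \<phi>_def)
    have f0: "f w\<^sub>0 = Q * (2 * \<delta>) powr (- (n / s))"
    proof -
      have "2 * \<delta> = 1 - dist z w\<^sub>0" by (simp add: \<delta>_def)
      then have "Q = (2 * \<delta>) powr (n / s) * f w\<^sub>0" by (simp add: Q_def \<phi>_def)
      then show ?thesis using \<delta> by (simp add: powr_minus field_simps)
    qed
    have near: "dist z w + \<delta> \<le> 1" if "w \<in> cball w\<^sub>0 \<delta>" for w
    proof -
      have "dist z w \<le> dist z w\<^sub>0 + dist w\<^sub>0 w" by (rule dist_triangle)
      with that show ?thesis by (simp add: \<delta>_def field_simps)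
    qed
    have f_le: "f w \<le> Q * \<delta> powr (- (n / s))" if w: "w \<in> cball w\<^sub>0 \<delta>" for w
    proof -
      have "\<delta> powr (n / s) * f w \<le> (1 - dist z w) powr (n / s) * f w"
        using near[OF w] \<delta> n s nonneg by (intro mult_right_mono powr_mono2) auto
      also have "\<dots> \<le> Q" using max[of w] near[OF w] \<delta> by (simp add: Q_def \<phi>_def)
      finally show ?thesis using \<delta> by (simp add: powr_minus field_simps)
    qed
    define L where "L = (Q * \<delta> powr (- (n / s))) powr (1 - s)"
    have pt: "f w \<le> L * f w powr s" if w: "w \<in> cball w\<^sub>0 \<delta>" for w
    proof -
      have "f w = f w powr (1 - s) * f w powr s"
        using nonneg[of w] by (cases "f w = 0") (auto simp flip: powr_add)
      also have "\<dots> \<le> L * f w powr s"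
        unfolding L_def using f_le[OF w] nonneg s by (intro mult_right_mono powr_mono2) auto
      finally show ?thesis .
    qed
    have "ennreal (f w\<^sub>0 * (\<nu> * \<delta> powr n)) = ennreal (f w\<^sub>0) * emeasure lborel (cball (0::'a) \<delta>)"
      using \<delta> nonneg \<nu>
      by (simp add: emeasure_cball n_def \<nu>_def powr_realpow flip: ennreal_mult)
    also have "\<dots> \<le> (\<integral>\<^sup>+w. ennreal (f w) * indicator (cball w\<^sub>0 \<delta>) w \<partial>lborel)"
      by (rule sub[OF \<delta>])
    also have "\<dots> \<le> (\<integral>\<^sup>+w. ennreal L * (ennreal (f w powr s) * indicator (cball z 1) w) \<partial>lborel)"
    proof (rule nn_integral_mono)
      fix w :: 'a
      show "ennreal (f w) * indicator (cball w\<^sub>0 \<delta>) w \<le> ennreal L * (ennreal (f w powr s) * indicator (cball z 1) w)"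
      proof (cases "w \<in> cball w\<^sub>0 \<delta>")
        case True
        then have "w \<in> cball z 1" using near[OF True] \<delta> by simp
        then show ?thesis using pt[OF True] True by (simp add: L_def ennreal_leI flip: ennreal_mult)
      qed simp
    qed
    also have "\<dots> = ennreal L * ?A"
      by (rule nn_integral_cmult) measurable
    finally have main: "ennreal (f w\<^sub>0 * (\<nu> * \<delta> powr n)) \<le> ennreal L * ?A" .
    define c where "c = 2 powr (n / s) / \<nu>"
    have c: "0 < c" using \<nu> by (simp add: c_def)
    have L: "0 < L" using Q \<delta> by (simp add: L_def)
    have "Q powr s * L = c * (f w\<^sub>0 * (\<nu> * \<delta> powr n))"
    proof -
      have L_eq: "L = Q powr (1 - s) * \<delta> powr (- (n / s) * (1 - s))"
        using Q \<delta> by (simp add: L_def powr_mult powr_powr)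
      have "Q powr s * Q powr (1 - s) = Q" using Q by (simp flip: powr_add)
      then have "Q powr s * L = Q * \<delta> powr (- (n / s) * (1 - s))"
        unfolding L_eq by (simp only: mult.assoc[symmetric])
      also have "- (n / s) * (1 - s) = - (n / s) + n" using s by (simp add: field_simps)
      also have "Q * \<delta> powr (- (n / s) + n) = c * (f w\<^sub>0 * (\<nu> * \<delta> powr n))"
      proof -
        have e: "\<delta> powr (- (n / s) + n) = \<delta> powr (- (n / s)) * \<delta> powr n" by (rule powr_add)
        have f: "f w\<^sub>0 = Q * (2 powr (- (n / s)) * \<delta> powr (- (n / s)))"
          using \<delta> by (simp add: f0 powr_mult)
        have "2 powr (n / s) * 2 powr (- (n / s)) = (1::real)" by (simp flip: powr_add)
        then show ?thesis unfolding e f c_def using \<nu> by (simp add: field_simps)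
      qed
      finally show ?thesis .
    qed
    then have "ennreal (Q powr s * L) \<le> ennreal c * (ennreal L * ?A)"
      using c main by (simp add: ennreal_mult' mult_left_mono)
    then have "ennreal L * ennreal (Q powr s) \<le> ennreal L * (ennreal c * ?A)"
      using L by (simp add: ennreal_mult' mult_ac)
    then have "ennreal (Q powr s) \<le> ennreal c * ?A"
      using L by (subst (asm) ennreal_mult_le_mult_iff) auto
    moreover have "ennreal (f z powr s) \<le> ennreal (Q powr s)"
      using fz nonneg s by (intro ennreal_leI powr_mono2) auto
    ultimately have "ennreal (f z powr s) \<le> ennreal c * ?A" by (rule order_trans[rotated])
    then show ?thesis by (simp add: c_def n_def \<nu>_def)
  qed
qed

corollary entire_powr_le_integral:
  fixes F :: "complex ^ 'd \<Rightarrow> complex"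
  assumes F: "entire F" and s: "0 < s" "s \<le> 1"
  shows "ennreal (norm (F z) powr s)
    \<le> ennreal (2 powr (DIM(complex ^ 'd) / s) / unit_ball_vol (DIM(complex ^ 'd))) *
      (\<integral>\<^sup>+w. ennreal (norm (F w) powr s) * indicator (cball z 1) w \<partial>lborel)"
  by (rule sub_mean_value_powr)
    (use s entire_sub_mean_value[OF F] entire_imp_continuous[OF F] in \<open>auto intro!: continuous_intros\<close>)

section \<open>Completeness of spaces of entire functions\<close>

text \<open>
  The range \<open>s \<le> 1\<close> is the one in which powers of the modulus have the sub-mean value property above; the
  exponent of the local bound can always be lowered into it.
\<close>

locale entire_function_qnorm = weighted_function_qnorm N C s W
  for N :: "(complex ^ 'd \<Rightarrow> ennreal) \<Rightarrow> ennreal" and C s :: real and W +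
  assumes s_le_1: "s \<le> 1"
begin

lemma entire_measurable: "entire F \<Longrightarrow> F \<in> borel_measurable lebesgue"
  for F :: "complex ^ 'd \<Rightarrow> complex"
  by (simp add: borel_measurable_continuous_onI entire_imp_continuous measurable_completion)

lemma entire_powr_le_wnorm:
  obtains D where "0 \<le> D" "\<And>F z. entire F \<Longrightarrow> norm z \<le> \<rho> \<Longrightarrow>
    ennreal (norm (F z) powr s) \<le> ennreal D * ennreal_powr (wnorm F) s"
proof -
  let ?K = "cball (0 :: complex ^ 'd) (\<rho> + 1)"
  define c where "c = 2 powr (DIM(complex ^ 'd) / s) / unit_ball_vol (DIM(complex ^ 'd))"
  have c: "0 \<le> c" by (simp add: c_def less_imp_le)
  obtain D where D: "D < \<infinity>" "\<And>F. F \<in> borel_measurable lebesgue \<Longrightarrow>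
      (\<integral>\<^sup>+x. ennreal (cmod (F x) powr s) * indicator ?K x \<partial>lebesgue) \<le> D * ennreal_powr (wnorm F) s"
    using nn_integral_le_wnorm[OF compact_cball] by blast
  obtain D' where D': "D = ennreal D'" "0 \<le> D'" using D(1) by (cases D) auto
  show thesis
  proof (rule that[of "c * D'"])
    show "0 \<le> c * D'" using c D' by simp
    fix F :: "complex ^ 'd \<Rightarrow> complex" and z :: "complex ^ 'd"
    assume F: "entire F" and z: "norm z \<le> \<rho>"
    have "ennreal (norm (F z) powr s) \<le> ennreal c *
        (\<integral>\<^sup>+w. ennreal (norm (F w) powr s) * indicator (cball z 1) w \<partial>lborel)"
      unfolding c_def by (rule entire_powr_le_integral[OF F s_pos s_le_1])
    also have "\<dots> \<le> ennreal c * (\<integral>\<^sup>+w. ennreal (norm (F w) powr s) * indicator ?K w \<partial>lborel)"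
    proof (intro mult_left_mono nn_integral_mono)
      fix w :: "complex ^ 'd"
      have "w \<in> ?K" if "w \<in> cball z 1"
        using that z norm_triangle_ineq[of z "w - z"] by (simp add: dist_norm norm_minus_commute)
      then show "(indicator (cball z 1) w :: ennreal) \<le> indicator ?K w" by (simp add: indicator_def)
    qed auto
    also have "(\<integral>\<^sup>+w. ennreal (norm (F w) powr s) * indicator ?K w \<partial>lborel)
        = (\<integral>\<^sup>+w. ennreal (norm (F w) powr s) * indicator ?K w \<partial>lebesgue)"
      by (rule nn_integral_completion[symmetric])
    also have "ennreal c * \<dots> \<le> ennreal c * (D * ennreal_powr (wnorm F) s)"
      by (intro mult_left_mono D(2) entire_measurable F) auto
    finally show "ennreal (norm (F z) powr s) \<le> ennreal (c * D') * ennreal_powr (wnorm F) s"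
      using c D' by (simp add: ennreal_mult mult.assoc)
  qed
qed

lemma entire_diff: "entire F \<Longrightarrow> entire G \<Longrightarrow> entire (\<lambda>z. F z - G z)"
  for F G :: "complex ^ 'd \<Rightarrow> complex"
proof (unfold entire_def, intro allI)
  fix z
  assume "\<forall>z. \<exists>D. (F has_derivative D) (at z) \<and> (\<forall>c v. D (c *s v) = c * D v)"
    "\<forall>z. \<exists>D. (G has_derivative D) (at z) \<and> (\<forall>c v. D (c *s v) = c * D v)"
  then obtain D E where "(F has_derivative D) (at z)" "\<And>c v. D (c *s v) = c * D v"
    "(G has_derivative E) (at z)" "\<And>c v. E (c *s v) = c * E v" by meson
  then show "\<exists>D. ((\<lambda>z. F z - G z) has_derivative D) (at z) \<and> (\<forall>c v. D (c *s v) = c * D v)"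
    by (intro exI[of _ "\<lambda>v. D v - E v"]) (auto intro!: derivative_intros simp: algebra_simps)
qed

text \<open>
  The sub-mean value property turns local \<open>L\<^sup>s\<close> control into pointwise control of entire functions.
\<close>

lemma wnorm_Cauchy_imp_uniformly_Cauchy:
  fixes u :: "nat \<Rightarrow> complex ^ 'd \<Rightarrow> complex"
  assumes u: "\<And>n. entire (u n)"
    and Cauchy: "\<And>\<epsilon>. 0 < \<epsilon> \<Longrightarrow> \<exists>n\<^sub>0. \<forall>m\<ge>n\<^sub>0. \<forall>n\<ge>n\<^sub>0. wnorm (\<lambda>x. u m x - u n x) \<le> ennreal \<epsilon>"
  shows "uniformly_Cauchy_on (cball 0 \<rho>) u"
proof (rule uniformly_Cauchy_onI)
  fix e :: real assume e: "0 < e"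
  obtain D where D: "0 \<le> D" "\<And>F z. entire F \<Longrightarrow> norm z \<le> \<rho> \<Longrightarrow>
    ennreal (norm (F z) powr s) \<le> ennreal D * ennreal_powr (wnorm F) s"
    by (rule entire_powr_le_wnorm[where \<rho>=\<rho>]) blast
  (* Chosen so that D * \<epsilon> powr s stays below e powr s; the summand one covers D = 0. *)
  define \<epsilon> where "\<epsilon> = e * (1 / (D + 1)) powr (1 / s)"
  have \<epsilon>: "0 < \<epsilon>" using e D(1) by (simp add: \<epsilon>_def)
  have "D * \<epsilon> powr s = e powr s * (D / (D + 1))"
    using e D(1) s_pos by (simp add: \<epsilon>_def powr_mult powr_powr)
  also have "\<dots> < e powr s * 1"
    using e D(1) by (intro mult_strict_left_mono) auto
  finally have small: "D * \<epsilon> powr s < e powr s" by simp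
  obtain n\<^sub>0 where n\<^sub>0: "\<And>m n. m \<ge> n\<^sub>0 \<Longrightarrow> n \<ge> n\<^sub>0 \<Longrightarrow> wnorm (\<lambda>x. u m x - u n x) \<le> ennreal \<epsilon>"
    using Cauchy[OF \<epsilon>] by blast
  have "dist (u m z) (u n z) < e" if z: "z \<in> cball 0 \<rho>" and mn: "m \<ge> n\<^sub>0" "n \<ge> n\<^sub>0" for m n z
  proof -
    have "ennreal (norm (u m z - u n z) powr s) \<le> ennreal D * ennreal_powr (wnorm (\<lambda>x. u m x - u n x)) s"
      using z by (intro D(2) entire_diff u) simp
    also have "\<dots> \<le> ennreal D * ennreal_powr (ennreal \<epsilon>) s"
      using s_pos by (intro mult_left_mono ennreal_powr_mono n\<^sub>0 mn) auto
    also have "\<dots> = ennreal (D * \<epsilon> powr s)"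
      using \<epsilon> D(1) by (simp add: ennreal_powr_ennreal ennreal_mult)
    finally have "norm (u m z - u n z) powr s \<le> D * \<epsilon> powr s"
      using D(1) by simp
    then have "norm (u m z - u n z) powr s < e powr s" using small by simp
    then show ?thesis
      using e s_pos powr_mono2[of s e "norm (u m z - u n z)"] by (fastforce simp: dist_norm not_less)
  qed
  then show "\<exists>M. \<forall>x\<in>cball 0 \<rho>. \<forall>m\<ge>M. \<forall>n\<ge>M. dist (u m x) (u n x) < e" by blast
qed

text \<open>
  A Cauchy sequence of entire functions converges locally uniformly to an entire function \<open>g\<close>. By
  \<open>Riesz_Fischer\<close> it also converges in quasi-norm to some \<open>v\<close>, which is an almost everywhere limit of a
  subsequence and therefore equals \<open>g\<close>.
\<close>

theorem entire_complete:
  fixes u :: "nat \<Rightarrow> complex ^ 'd \<Rightarrow> complex"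
  assumes u: "\<And>n. entire (u n)"
    and Cauchy: "\<And>\<epsilon>. 0 < \<epsilon> \<Longrightarrow> \<exists>n\<^sub>0. \<forall>m\<ge>n\<^sub>0. \<forall>n\<ge>n\<^sub>0. wnorm (\<lambda>x. u m x - u n x) \<le> ennreal \<epsilon>"
  obtains g where "entire g" "\<And>\<epsilon>. 0 < \<epsilon> \<Longrightarrow> \<exists>n\<^sub>0. \<forall>n\<ge>n\<^sub>0. wnorm (\<lambda>x. u n x - g x) \<le> ennreal \<epsilon>"
proof -
  define g where "g z = lim (\<lambda>n. u n z)" for z
  have lim: "uniform_limit (cball 0 \<rho>) u g sequentially" for \<rho>
    using Cauchy_uniformly_convergent[OF wnorm_Cauchy_imp_uniformly_Cauchy[OF u Cauchy]]
    by (simp add: uniformly_convergent_uniform_limit_iff g_def[abs_def])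
  have "entire g"
    by (rule separately_holomorphic_imp_entire,
        rule separately_holomorphic_limit[OF entire_imp_separately_holomorphic[OF u] lim])
  have ptw: "(\<lambda>n. u n z) \<longlonglongrightarrow> g z" for z
    by (rule tendsto_uniform_limitI[OF lim[of "norm z"]]) simp
  obtain v \<sigma> where \<sigma>: "\<And>k. k \<le> \<sigma> k" and v: "AE x in lebesgue. (\<lambda>k. u (\<sigma> k) x) \<longlonglongrightarrow> v x"
    and conv: "\<And>\<epsilon>. 0 < \<epsilon> \<Longrightarrow> \<exists>n\<^sub>0. \<forall>n\<ge>n\<^sub>0. wnorm (\<lambda>x. u n x - v x) \<le> ennreal \<epsilon>"
    by (rule Riesz_Fischer[OF entire_measurable[OF u] Cauchy]) blast+
  have "filterlim \<sigma> at_top sequentially"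
    by (rule filterlim_at_top_mono[OF filterlim_ident]) (simp add: \<sigma>)
  from v have "AE x in lebesgue. v x = g x"
  proof eventually_elim
    case (elim x)
    then show ?case
      using filterlim_compose[OF ptw[of x] \<open>filterlim \<sigma> at_top sequentially\<close>] by (rule LIMSEQ_unique)
  qed
  then have "wnorm (\<lambda>x. u n x - v x) = wnorm (\<lambda>x. u n x - g x)" for n
    by (intro wnorm_cong_AE) (auto elim: eventually_mono)
  with conv \<open>entire g\<close> show thesis by (intro that[of g]) auto
qed

lemma entire_wnorm_eq_0_iff:
  assumes F: "entire F"
  shows "wnorm F = 0 \<longleftrightarrow> F = (\<lambda>_. 0)"
proof
  assume "wnorm F = 0"
  then have ae: "AE z in lebesgue. F z = 0" by (simp add: wnorm_eq_0_iff entire_measurable F)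
  show "F = (\<lambda>_. 0)"
  proof (rule ccontr)
    assume "F \<noteq> (\<lambda>_. 0)"
    moreover have "open {z. F z \<noteq> 0}"
      using open_vimage[of "- {0}" F] entire_imp_continuous[OF F] by (auto simp: vimage_def)
    ultimately have "\<not> negligible {z. F z \<noteq> 0}"
      by (intro open_not_negligible) auto
    moreover have "{z. F z \<noteq> 0} \<in> null_sets lebesgue"
      using ae by (simp add: completion.AE_iff_null_sets)
    ultimately show False by (simp add: negligible_iff_null_sets)
  qed
qed (simp add: wnorm_eq_0_iff)

end

section \<open>Phase space and the complex space\<close>

definition phase_point :: "complex ^ 'd \<Rightarrow> (real ^ 'd) \<times> (real ^ 'd)" where
  "phase_point z = (sqrt 2 *\<^sub>R Re_vec z, - sqrt 2 *\<^sub>R Im_vec z)"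

definition complex_point :: "(real ^ 'd) \<times> (real ^ 'd) \<Rightarrow> complex ^ 'd" where
  "complex_point X = (\<chi> j. Complex (fst X $ j / sqrt 2) (- (snd X $ j / sqrt 2)))"

definition U_factor :: "complex ^ 'd \<Rightarrow> complex" where
  "U_factor z =
     complex_of_real ((2 * pi) powr (real CARD('d) / 2) * exp (((norm (Re_vec z))\<^sup>2 + (norm (Im_vec z))\<^sup>2) / 2))
     * exp (- \<i> * complex_of_real (Re_vec z \<bullet> Im_vec z))"

lemma complex_point_phase_point[simp]: "complex_point (phase_point z) = z"
  by (simp add: complex_point_def phase_point_def Re_vec_def Im_vec_def vec_eq_iff complex_eq_iff)

lemma phase_point_complex_point[simp]: "phase_point (complex_point X) = X"
  by (cases X) (simp add: complex_point_def phase_point_def Re_vec_def Im_vec_def vec_eq_iff)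

lemma linear_complex_point: "linear complex_point"
  by (rule linearI) (simp_all add: complex_point_def vec_eq_iff complex_eq_iff add_divide_distrib)

lemma linear_phase_point: "linear phase_point"
  by (rule linearI) (simp_all add: phase_point_def Re_vec_def Im_vec_def vec_eq_iff algebra_simps)

lemma surj_complex_point: "surj complex_point"
  by (metis complex_point_phase_point surjI)

lemma phase_point_measurable[measurable]: "phase_point \<in> borel_measurable borel"
  by (rule linear_borel_measurable[OF linear_phase_point])

lemma U_factor_nonzero: "U_factor z \<noteq> 0"
  by (simp add: U_factor_def)

lemma U_op_eq: "U_op F z = U_factor z * F (phase_point z)"
  by (simp add: U_op_def U_factor_def phase_point_def Let_def)

lemma inv_U_op:
  fixes F :: "complex ^ 'd \<Rightarrow> complex"
  shows "inv U_op F X = F (complex_point X) / U_factor (complex_point X)"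
proof -
  have inj: "inj (U_op :: ((real ^ 'd) \<times> (real ^ 'd) \<Rightarrow> complex) \<Rightarrow> complex ^ 'd \<Rightarrow> complex)"
    by (rule bij_is_inj[OF bij_U_op])
  define G where "G X = F (complex_point X) / U_factor (complex_point X)" for X
  have "U_op G = F"
    by (rule ext) (simp add: G_def U_op_eq U_factor_nonzero)
  then have "inv U_op F = G" using inv_f_f[OF inj, of G] by simp
  then show ?thesis by (simp add: G_def)
qed

lemma continuous_on_U_factor: "continuous_on A (\<lambda>z. norm (U_factor z))"
proof -
  have "linear Re_vec" "linear Im_vec"
    by (rule linearI; simp add: Re_vec_def Im_vec_def vec_eq_iff)+
  then have [continuous_intros]: "continuous_on A Re_vec" "continuous_on A Im_vec"
    by (auto intro: linear_continuous_on simp: linear_conv_bounded_linear)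
  show ?thesis unfolding U_factor_def by (intro continuous_intros) auto
qed

text \<open>
  Pulled back to \<open>complex ^ 'd\<close>, the quasi-norm of \<open>B(\<omega>, \<B>)\<close> is a mixed quasi-norm of \<open>|F|\<close> times this function: the
  Gaussian factor of the operator joins the weight, and its unimodular factor drops out.
\<close>

definition phase_weight :: "((real ^ 'd) \<times> (real ^ 'd) \<Rightarrow> real) \<Rightarrow> complex ^ 'd \<Rightarrow> real" where
  "phase_weight \<omega> z = \<omega> (phase_point z) / norm (U_factor z)"

text \<open>
  Both Lebesgue measures are compared with the iterated measure of the one-layer decomposition; the
  comparison allows the identity on the one side and \<open>complex_point\<close> on the other.
\<close>

lemma AE_phase_point:
  fixes P :: "(real ^ 'd) \<times> (real ^ 'd) \<Rightarrow> bool"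
  assumes "AE X in lebesgue. P X"
  shows "AE z in lebesgue. P (phase_point z)"
proof -
  let ?\<B> = "[(1, UNIV :: ((real ^ 'd) \<times> (real ^ 'd)) set)] :: ((real ^ 'd) \<times> (real ^ 'd)) mixed_space"
  have \<B>: "admissible ?\<B>" "spanning ?\<B>"
    by (auto simp: spanning_def list_all2_Cons2 intro!: exI[of _ "[_]"])
  have "AE X in lborel. P X" using assms by (simp add: AE_completion_iff)
  then obtain Z where Z: "{X \<in> space lborel. \<not> P X} \<subseteq> Z" "emeasure lborel Z = 0" "Z \<in> sets lborel"
    by (rule AE_E)
  have [measurable]: "Z \<in> sets borel" using Z(3) by simp
  have "AE X in lborel. X \<notin> Z" using Z by (intro AE_not_in) (auto simp: null_sets_def)
  then have "mixed_AE ?\<B> (\<lambda>X. id X \<notin> Z)"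
    by (subst mixed_AE_iff_AE_lborel[OF \<B>]) (auto simp: linear_id)
  then have "mixed_AE ?\<B> (\<lambda>X. phase_point (complex_point X) \<notin> Z)" by simp
  then have "AE z in lborel. phase_point z \<notin> Z"
    by (subst (asm) mixed_AE_iff_AE_lborel[OF \<B> linear_complex_point surj_complex_point]) measurable
  then have "AE z in lborel. P (phase_point z)"
    by eventually_elim (use Z in auto)
  then show ?thesis by (rule AE_completion)
qed

lemma phase_weight_measurable:
  assumes "\<omega> \<in> borel_measurable lebesgue"
  shows "phase_weight \<omega> \<in> borel_measurable lebesgue"
proof -
  obtain \<omega>' where [measurable]: "\<omega>' \<in> borel_measurable borel" and ae: "AE X in lebesgue. \<omega> X = \<omega>' X"
    using completion_ex_borel_measurable_real[OF assms] by (auto simp: AE_completion_iff)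
  have [measurable]: "(\<lambda>z. norm (U_factor z)) \<in> borel_measurable borel"
    by (rule borel_measurable_continuous_onI[OF continuous_on_U_factor])
  have "(\<lambda>z. \<omega>' (phase_point z) / norm (U_factor z)) \<in> borel_measurable borel" by measurable
  then have "(\<lambda>z. \<omega>' (phase_point z) / norm (U_factor z)) \<in> borel_measurable lebesgue"
    by (simp add: measurable_completion)
  moreover have "AE z in lborel. \<omega>' (phase_point z) / norm (U_factor z) = phase_weight \<omega> z"
    using AE_phase_point[OF ae] by (auto simp: AE_completion_iff phase_weight_def elim!: eventually_mono)
  ultimately show ?thesis by (rule measurable_completion_AE_eq)
qed

text \<open>
  Local boundedness of \<open>1 / \<omega>\<close> makes convergence in the weighted quasi-norm imply local convergence;
  the Gaussian factor is bounded on compact sets by continuity.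
\<close>

lemma phase_weight_bounded_below:
  assumes \<omega>: "weight \<omega>" and K: "compact K"
  shows "\<exists>M>0. AE z in lebesgue. z \<in> K \<longrightarrow> 1 \<le> M * phase_weight \<omega> z"
proof -
  have bl: "bounded_linear phase_point" using linear_phase_point linear_conv_bounded_linear by blast
  let ?K = "phase_point ` K"
  have K': "compact ?K"
    by (rule compact_continuous_image[OF linear_continuous_on[OF bl] K])
  have fin: "esssup (lebesgue_on ?K) (\<lambda>X. ennreal (norm (1 / \<omega> X))) < \<infinity>"
    using \<omega> K' by (auto simp: weight_def Lp_loc_def Lp_qnorm_def)
  then obtain m where m: "esssup (lebesgue_on ?K) (\<lambda>X. ennreal (norm (1 / \<omega> X))) = ennreal m" "0 \<le> m"
    by (cases "esssup (lebesgue_on ?K) (\<lambda>X. ennreal (norm (1 / \<omega> X)))") auto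
  have "AE X in lebesgue_on ?K. ennreal (norm (1 / \<omega> X)) \<le> ennreal m"
    unfolding m(1)[symmetric] by (rule esssup_AE)
  then have "AE X in lebesgue. X \<in> ?K \<longrightarrow> ennreal (norm (1 / \<omega> X)) \<le> ennreal m"
    using K' by (subst (asm) AE_restrict_space_iff) (auto simp: borel_compact)
  from AE_phase_point[OF this] have ae: "AE z in lebesgue. z \<in> K \<longrightarrow> ennreal (norm (1 / \<omega> (phase_point z))) \<le> ennreal m"
    by (auto elim!: eventually_mono)
  obtain b where b: "\<And>z. z \<in> K \<Longrightarrow> norm (U_factor z) \<le> b" "0 < b"
  proof -
    have "compact ((\<lambda>z. norm (U_factor z)) ` K)"
      by (rule compact_continuous_image[OF continuous_on_U_factor K])
    then obtain b where "0 < b" "\<And>y. y \<in> (\<lambda>z. norm (U_factor z)) ` K \<Longrightarrow> norm y \<le> b"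
      using compact_imp_bounded bounded_pos by metis
    then show thesis by (intro that[of b]) force+
  qed
  have pos: "0 < \<omega> X" for X using \<omega> unfolding weight_def by blast
  show ?thesis
  proof (intro exI[of _ "(m + 1) * b"] conjI)
    show "0 < (m + 1) * b" using m b by simp
    show "AE z in lebesgue. z \<in> K \<longrightarrow> 1 \<le> (m + 1) * b * phase_weight \<omega> z"
      using ae
    proof eventually_elim
      case (elim z)
      show ?case
      proof
        assume z: "z \<in> K"
        then have "1 / \<omega> (phase_point z) \<le> m" using elim m pos[of "phase_point z"] by simp
        then have "1 \<le> m * \<omega> (phase_point z)" using pos[of "phase_point z"] by (simp add: divide_le_eq)
        also have "\<dots> \<le> (m + 1) * \<omega> (phase_point z)"
          using pos[of "phase_point z"] by (intro mult_right_mono) auto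
        finally have "1 * 1 \<le> ((m + 1) * \<omega> (phase_point z)) * (b / norm (U_factor z))"
          using b(1)[OF z] U_factor_nonzero[of z] by (intro mult_mono) auto
        then show "1 \<le> (m + 1) * b * phase_weight \<omega> z" by (simp add: phase_weight_def mult_ac)
      qed
    qed
  qed
qed

section \<open>Quasi-norms on functions and on classes of functions\<close>

lemma vector_space_fun_scale: "vector_space fun_scale"
  by standard (auto simp: fun_scale_def fun_eq_iff algebra_simps)

lemma vector_space_ae_scale: "vector_space (ae_scale :: complex \<Rightarrow> 'a::euclidean_space ae_fun \<Rightarrow> _)"
  by standard (transfer; simp add: algebra_simps)+

lemma subspace_iff:
  assumes "vector_space smul"
  shows "module.subspace smul X \<longleftrightarrow>
    0 \<in> X \<and> (\<forall>x\<in>X. \<forall>y\<in>X. x + y \<in> X) \<and> (\<forall>c. \<forall>x\<in>X. smul c x \<in> X)"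
  using assms by (simp add: module.subspace_def module_iff_vector_space)

text \<open>
  The structure of \<open>M(\<omega>, \<B>)\<close> is that of \<open>A(\<omega>, \<B>)\<close>, carried along the Bargmann transform.
\<close>

lemma transport_quasi_norm_on:
  assumes T: "\<And>x y. x \<in> X \<Longrightarrow> y \<in> X \<Longrightarrow> T (x + y) = T x + T y"
      "\<And>c x. x \<in> X \<Longrightarrow> T (smul c x) = smul' c (T x)"
    and bij: "bij_betw T X Y" and zero: "0 \<in> X"
    and N: "\<And>x. N x = N' (T x)"
    and Y: "quasi_norm_on C smul' Y N'"
  shows "quasi_norm_on C smul X N"
proof -
  have TY: "T x \<in> Y" if "x \<in> X" for x using bij that by (rule bij_betwE[rule_format])
  have T0: "T 0 = 0" using T(1)[OF zero zero] by simp
  have "T x = 0 \<longleftrightarrow> x = 0" if "x \<in> X" for x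
    using bij that zero T0 by (metis bij_betw_def inj_on_contraD)
  then show ?thesis
    using Y unfolding quasi_norm_on_def by (auto simp: N T TY)
qed

lemma transport_complete_wrt:
  assumes T: "\<And>x y. x \<in> X \<Longrightarrow> y \<in> X \<Longrightarrow> T (x - y) = T x - T y"
    and bij: "bij_betw T X Y" and N: "\<And>x. N x = N' (T x)"
    and Y: "complete_wrt Y N'"
  shows "complete_wrt X N"
  unfolding complete_wrt_def
proof (intro allI impI)
  fix u :: "nat \<Rightarrow> 'a"
  assume u: "range u \<subseteq> X" and Cauchy: "\<forall>\<epsilon>>0. \<exists>n\<^sub>0. \<forall>m\<ge>n\<^sub>0. \<forall>n\<ge>n\<^sub>0. N (u m - u n) < \<epsilon>"
  have uX: "u n \<in> X" for n using u by auto
  have "range (\<lambda>n. T (u n)) \<subseteq> Y" using uX bij_betwE[OF bij] by auto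
  moreover have "\<forall>\<epsilon>>0. \<exists>n\<^sub>0. \<forall>m\<ge>n\<^sub>0. \<forall>n\<ge>n\<^sub>0. N' (T (u m) - T (u n)) < \<epsilon>"
    using Cauchy by (simp add: N T uX)
  ultimately obtain y where "y \<in> Y" "(\<lambda>n. N' (T (u n) - y)) \<longlonglongrightarrow> 0"
    using Y unfolding complete_wrt_def by blast
  moreover then obtain x where "x \<in> X" "y = T x"
    using bij by (auto simp: bij_betw_def)
  ultimately show "\<exists>x\<in>X. (\<lambda>n. N (u n - x)) \<longlonglongrightarrow> 0"
    by (intro bexI[of _ x]) (simp_all add: N T uX)
qed

context weighted_function_qnorm
begin

text \<open>
  These turn out to be the functions whose classes form \<open>B(\<omega>, \<B>)\<close>.
\<close>

definition finite_norm_functions :: "('e \<Rightarrow> complex) set" where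
  "finite_norm_functions = {F \<in> borel_measurable lebesgue. wnorm F < \<infinity>}"

definition real_norm :: "('e \<Rightarrow> complex) \<Rightarrow> real" where
  "real_norm F = enn2real (wnorm F)"

lemma real_norm_nonneg: "0 \<le> real_norm F"
  by (simp add: real_norm_def)

lemma ennreal_real_norm: "F \<in> finite_norm_functions \<Longrightarrow> ennreal (real_norm F) = wnorm F"
  by (simp add: finite_norm_functions_def real_norm_def)

lemma add_finite_norm:
  assumes "F \<in> finite_norm_functions" "G \<in> finite_norm_functions"
  shows "F + G \<in> finite_norm_functions" "real_norm (F + G) \<le> C * (real_norm F + real_norm G)"
proof -
  have [measurable]: "F \<in> borel_measurable lebesgue" "G \<in> borel_measurable lebesgue"
    using assms by (auto simp: finite_norm_functions_def)
  have C: "0 \<le> C" using C_ge_1 by simp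
  have "wnorm (F + G) \<le> ennreal C * (wnorm F + wnorm G)"
    using wnorm_add[of F G] by (simp add: plus_fun_def)
  also have "\<dots> = ennreal (C * (real_norm F + real_norm G))"
    unfolding assms[THEN ennreal_real_norm, symmetric]
    using C by (simp add: ennreal_mult' real_norm_nonneg)
  finally have le: "wnorm (F + G) \<le> ennreal (C * (real_norm F + real_norm G))" .
  have "F + G \<in> borel_measurable lebesgue" unfolding plus_fun_def by measurable
  then show "F + G \<in> finite_norm_functions"
    using le by (auto simp: finite_norm_functions_def intro: le_less_trans)
  show "real_norm (F + G) \<le> C * (real_norm F + real_norm G)"
    using le C unfolding real_norm_def[of "F + G"] by (intro enn2real_leI) (simp_all add: real_norm_nonneg)
qed

lemma scale_finite_norm:
  assumes "F \<in> finite_norm_functions"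
  shows "fun_scale c F \<in> finite_norm_functions" "real_norm (fun_scale c F) = cmod c * real_norm F"
  using assms
  by (auto simp: finite_norm_functions_def real_norm_def fun_scale_def wnorm_mult ennreal_mult_less_top enn2real_mult)

lemma diff_eq_add_scale: "F - G = F + fun_scale (-1) G"
  by (simp add: fun_eq_iff fun_scale_def)

lemma diff_finite_norm:
  "F \<in> finite_norm_functions \<Longrightarrow> G \<in> finite_norm_functions \<Longrightarrow> F - G \<in> finite_norm_functions"
  unfolding diff_eq_add_scale by (intro add_finite_norm scale_finite_norm)

lemma zero_finite_norm: "0 \<in> finite_norm_functions"
  by (auto simp: finite_norm_functions_def zero_fun_def wnorm_def zero)

lemma quasi_norm_on_finite_norm:
  assumes "X \<subseteq> finite_norm_functions" and "\<And>F. F \<in> X \<Longrightarrow> wnorm F = 0 \<longleftrightarrow> F = 0"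
  shows "quasi_norm_on C fun_scale X real_norm"
  unfolding quasi_norm_on_def
proof (intro conjI ballI allI)
  fix F G c assume "F \<in> X"
  then have F: "F \<in> finite_norm_functions" using assms by auto
  show "0 \<le> real_norm F" by (simp add: real_norm_def)
  show "real_norm F = 0 \<longleftrightarrow> F = 0"
    using assms(2)[OF \<open>F \<in> X\<close>] F
    by (simp add: real_norm_def enn2real_eq_0_iff finite_norm_functions_def less_top[symmetric])
  show "real_norm (fun_scale c F) = cmod c * real_norm F" by (rule scale_finite_norm[OF F])
  assume "G \<in> X"
  then have G: "G \<in> finite_norm_functions" using assms by auto
  show "real_norm (F + G) \<le> C * (real_norm F + real_norm G)" by (rule add_finite_norm(2)[OF F G])
qed

lemma wnorm_Cauchy:
  assumes u: "\<And>n. u n \<in> finite_norm_functions"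
    and Cauchy: "\<forall>\<epsilon>>0. \<exists>n\<^sub>0. \<forall>m\<ge>n\<^sub>0. \<forall>n\<ge>n\<^sub>0. real_norm (u m - u n) < \<epsilon>"
    and \<epsilon>: "0 < \<epsilon>"
  shows "\<exists>n\<^sub>0. \<forall>m\<ge>n\<^sub>0. \<forall>n\<ge>n\<^sub>0. wnorm (\<lambda>x. u m x - u n x) \<le> ennreal \<epsilon>"
proof -
  have "wnorm (\<lambda>x. u m x - u n x) = ennreal (real_norm (u m - u n))" for m n
    using ennreal_real_norm[OF diff_finite_norm[OF u u]] by (simp add: fun_diff_def)
  with Cauchy \<epsilon> show ?thesis by (metis ennreal_leI less_imp_le)
qed

lemma wnorm_limit:
  assumes u: "\<And>n. u n \<in> finite_norm_functions" and v: "v \<in> borel_measurable lebesgue"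
    and lim: "\<And>\<epsilon>. 0 < \<epsilon> \<Longrightarrow> \<exists>n\<^sub>0. \<forall>n\<ge>n\<^sub>0. wnorm (\<lambda>x. u n x - v x) \<le> ennreal \<epsilon>"
  shows "v \<in> finite_norm_functions" "(\<lambda>n. real_norm (u n - v)) \<longlonglongrightarrow> 0"
proof -
  obtain n where n: "wnorm (\<lambda>x. u n x - v x) \<le> ennreal 1" using lim[of 1] by auto
  have "u n - v \<in> borel_measurable lebesgue"
    using u[of n] v unfolding fun_diff_def finite_norm_functions_def
    by (intro borel_measurable_diff) auto
  moreover have "wnorm (u n - v) < \<infinity>" using n by (auto simp: fun_diff_def intro: le_less_trans)
  ultimately have "u n - v \<in> finite_norm_functions" by (simp add: finite_norm_functions_def)
  from diff_finite_norm[OF u[of n] this] show "v \<in> finite_norm_functions" by simp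
  show "(\<lambda>n. real_norm (u n - v)) \<longlonglongrightarrow> 0"
  proof (rule LIMSEQ_I)
    fix e :: real assume e: "0 < e"
    then obtain n\<^sub>0 where "\<And>n. n \<ge> n\<^sub>0 \<Longrightarrow> wnorm (\<lambda>x. u n x - v x) \<le> ennreal (e / 2)"
      using lim[of "e / 2"] by auto
    then have "real_norm (u n - v) \<le> e / 2" if "n \<ge> n\<^sub>0" for n
      unfolding real_norm_def fun_diff_def using that e by (intro enn2real_leI) auto
    then have "norm (real_norm (u n - v) - 0) < e" if "n \<ge> n\<^sub>0" for n
      using that e real_norm_nonneg[of "u n - v"] by fastforce
    then show "\<exists>n\<^sub>0. \<forall>n\<ge>n\<^sub>0. norm (real_norm (u n - v) - 0) < e" by blast
  qed
qed

lemma ae_abs_rep: "abs_ae_fun (rep_ae_fun f) = (f :: 'e ae_fun)"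
  by (rule Quotient_abs_rep[OF Quotient_ae_fun])

lemma rep_abs_ae: "AE x in lebesgue. rep_ae_fun (abs_ae_fun F) x = (F :: 'e \<Rightarrow> complex) x"
  using ae_fun.abs_eq_iff[of "rep_ae_fun (abs_ae_fun F)" F] by (simp add: ae_abs_rep)

lemma rep_ae_cong:
  assumes "AE x in lebesgue. F x = (G :: 'e \<Rightarrow> complex) x"
  shows "F \<in> finite_norm_functions \<longleftrightarrow> G \<in> finite_norm_functions" "real_norm F = real_norm G"
proof -
  have FG: "AE x in lborel. F x = G x" using assms by (simp add: AE_completion_iff)
  then have GF: "AE x in lborel. G x = F x" by (auto elim: eventually_mono)
  have "F \<in> borel_measurable lebesgue \<longleftrightarrow> G \<in> borel_measurable lebesgue"
    using measurable_completion_AE_eq[OF _ FG] measurable_completion_AE_eq[OF _ GF] by blast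
  then show "F \<in> finite_norm_functions \<longleftrightarrow> G \<in> finite_norm_functions" "real_norm F = real_norm G"
    using wnorm_cong_AE[OF assms] by (auto simp: finite_norm_functions_def real_norm_def)
qed

lemma rep_ae_operations:
  fixes f g :: "'e ae_fun"
  shows "AE x in lebesgue. rep_ae_fun (f + g) x = (rep_ae_fun f + rep_ae_fun g) x"
    and "AE x in lebesgue. rep_ae_fun (f - g) x = (rep_ae_fun f - rep_ae_fun g) x"
    and "AE x in lebesgue. rep_ae_fun (ae_scale c f) x = fun_scale c (rep_ae_fun f) x"
    and "AE x in lebesgue. rep_ae_fun (0 :: 'e ae_fun) x = 0"
proof -
  have "f + g = abs_ae_fun (rep_ae_fun f + rep_ae_fun g)"
    using plus_ae_fun.abs_eq[of "rep_ae_fun f" "rep_ae_fun g"] by (simp add: ae_abs_rep plus_fun_def)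
  then show "AE x in lebesgue. rep_ae_fun (f + g) x = (rep_ae_fun f + rep_ae_fun g) x"
    using rep_abs_ae by metis
  have "f - g = abs_ae_fun (rep_ae_fun f - rep_ae_fun g)"
    using minus_ae_fun.abs_eq[of "rep_ae_fun f" "rep_ae_fun g"] by (simp add: ae_abs_rep fun_diff_def)
  then show "AE x in lebesgue. rep_ae_fun (f - g) x = (rep_ae_fun f - rep_ae_fun g) x"
    using rep_abs_ae by metis
  have "ae_scale c f = abs_ae_fun (fun_scale c (rep_ae_fun f))"
    using ae_scale.abs_eq[of c "rep_ae_fun f"] by (simp add: ae_abs_rep fun_scale_def)
  then show "AE x in lebesgue. rep_ae_fun (ae_scale c f) x = fun_scale c (rep_ae_fun f) x"
    using rep_abs_ae by metis
  show "AE x in lebesgue. rep_ae_fun (0 :: 'e ae_fun) x = 0"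
    using rep_abs_ae[of "\<lambda>_. 0"] by (simp add: zero_ae_fun.abs_eq)
qed

definition norm_classes :: "'e ae_fun set" where
  "norm_classes = abs_ae_fun ` finite_norm_functions"

lemma norm_classes_iff: "f \<in> norm_classes \<longleftrightarrow> rep_ae_fun f \<in> finite_norm_functions"
  using rep_ae_cong(1)[OF rep_abs_ae] ae_abs_rep[of f] by (auto simp: norm_classes_def intro: rev_image_eqI)

text \<open>
  The representative chosen for a sum of classes differs from the sum of the representatives on a null
  set only, which the quasi-norm does not see.
\<close>

theorem classes_quasi_normed:
  "module.subspace ae_scale norm_classes"
  "quasi_norm_on C ae_scale norm_classes (\<lambda>f. real_norm (rep_ae_fun f))"
proof -
  show "module.subspace ae_scale norm_classes"
    unfolding subspace_iff[OF vector_space_ae_scale]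
  proof (intro conjI ballI allI)
    have "AE x in lebesgue. rep_ae_fun (0 :: 'e ae_fun) x = (0 :: 'e \<Rightarrow> complex) x"
      using rep_ae_operations(4) by simp
    then show "(0 :: 'e ae_fun) \<in> norm_classes"
      unfolding norm_classes_iff using rep_ae_cong(1) zero_finite_norm by blast
    fix f g :: "'e ae_fun" and c
    assume "f \<in> norm_classes"
    then have f: "rep_ae_fun f \<in> finite_norm_functions" by (simp only: norm_classes_iff)
    show "ae_scale c f \<in> norm_classes"
      unfolding norm_classes_iff rep_ae_cong(1)[OF rep_ae_operations(3)] by (rule scale_finite_norm(1)[OF f])
    assume "g \<in> norm_classes"
    then have g: "rep_ae_fun g \<in> finite_norm_functions" by (simp only: norm_classes_iff)
    show "f + g \<in> norm_classes"
      unfolding norm_classes_iff rep_ae_cong(1)[OF rep_ae_operations(1)] by (rule add_finite_norm(1)[OF f g])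
  qed
  show "quasi_norm_on C ae_scale norm_classes (\<lambda>f. real_norm (rep_ae_fun f))"
    unfolding quasi_norm_on_def
  proof (intro conjI ballI allI)
    fix f g :: "'e ae_fun" and c assume f: "f \<in> norm_classes"
    then have F: "rep_ae_fun f \<in> finite_norm_functions" by (simp add: norm_classes_iff)
    then have [measurable]: "rep_ae_fun f \<in> borel_measurable lebesgue" by (simp add: finite_norm_functions_def)
    show "0 \<le> real_norm (rep_ae_fun f)" by (simp add: real_norm_def)
    have "real_norm (rep_ae_fun f) = 0 \<longleftrightarrow> wnorm (rep_ae_fun f) = 0"
      using F by (simp add: real_norm_def enn2real_eq_0_iff finite_norm_functions_def less_top[symmetric])
    also have "\<dots> \<longleftrightarrow> (AE x in lebesgue. rep_ae_fun f x = 0)" by (rule wnorm_eq_0_iff) measurable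
    also have "\<dots> \<longleftrightarrow> abs_ae_fun (rep_ae_fun f) = abs_ae_fun (\<lambda>_. 0)" by (simp add: ae_fun.abs_eq_iff)
    also have "\<dots> \<longleftrightarrow> f = 0" by (simp add: ae_abs_rep zero_ae_fun_def)
    finally show "real_norm (rep_ae_fun f) = 0 \<longleftrightarrow> f = 0" .
    show "real_norm (rep_ae_fun (ae_scale c f)) = cmod c * real_norm (rep_ae_fun f)"
      unfolding rep_ae_cong(2)[OF rep_ae_operations(3)] by (rule scale_finite_norm(2)[OF F])
    assume "g \<in> norm_classes"
    then have G: "rep_ae_fun g \<in> finite_norm_functions" by (simp add: norm_classes_iff)
    show "real_norm (rep_ae_fun (f + g)) \<le> C * (real_norm (rep_ae_fun f) + real_norm (rep_ae_fun g))"
      unfolding rep_ae_cong(2)[OF rep_ae_operations(1)] by (rule add_finite_norm(2)[OF F G])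
  qed
qed

theorem classes_complete: "complete_wrt norm_classes (\<lambda>f. real_norm (rep_ae_fun f))"
  unfolding complete_wrt_def
proof (intro allI impI)
  fix U :: "nat \<Rightarrow> 'e ae_fun"
  assume U: "range U \<subseteq> norm_classes"
    and Cauchy: "\<forall>\<epsilon>>0. \<exists>n\<^sub>0. \<forall>m\<ge>n\<^sub>0. \<forall>n\<ge>n\<^sub>0. real_norm (rep_ae_fun (U m - U n)) < \<epsilon>"
  define u where "u n = rep_ae_fun (U n)" for n
  have u: "u n \<in> finite_norm_functions" for n using U norm_classes_iff by (auto simp: u_def)
  then have um: "u n \<in> borel_measurable lebesgue" for n by (simp add: finite_norm_functions_def)
  have diff: "real_norm (rep_ae_fun (U m - g)) = real_norm (u m - rep_ae_fun g)" for m g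
    unfolding u_def by (rule rep_ae_cong(2)[OF rep_ae_operations(2)])
  have C': "\<forall>\<epsilon>>0. \<exists>n\<^sub>0. \<forall>m\<ge>n\<^sub>0. \<forall>n\<ge>n\<^sub>0. real_norm (u m - u n) < \<epsilon>"
    using Cauchy unfolding diff u_def .
  obtain v where v: "v \<in> borel_measurable lebesgue"
    and lim: "\<And>\<epsilon>. 0 < \<epsilon> \<Longrightarrow> \<exists>n\<^sub>0. \<forall>n\<ge>n\<^sub>0. wnorm (\<lambda>x. u n x - v x) \<le> ennreal \<epsilon>"
    by (rule Riesz_Fischer[OF um wnorm_Cauchy[OF u C']]) blast+
  note w = wnorm_limit[OF u v lim]
  have "real_norm (u n - rep_ae_fun (abs_ae_fun v)) = real_norm (u n - v)" for n
    by (rule rep_ae_cong(2)) (use rep_abs_ae[of v] in \<open>auto elim!: eventually_mono\<close>)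
  then have "(\<lambda>n. real_norm (rep_ae_fun (U n - abs_ae_fun v))) \<longlonglongrightarrow> 0"
    using w(2) by (simp add: diff)
  moreover have "abs_ae_fun v \<in> norm_classes" using w(1) by (simp add: norm_classes_def)
  ultimately show "\<exists>x\<in>norm_classes. (\<lambda>n. real_norm (rep_ae_fun (U n - x))) \<longlonglongrightarrow> 0" by blast
qed

end

context entire_function_qnorm
begin

lemma entire_zero: "entire (0 :: complex ^ 'd \<Rightarrow> complex)"
  unfolding entire_def zero_fun_def by (intro allI exI[of _ "\<lambda>_. 0"]) auto

lemma entire_scale:
  fixes F :: "complex ^ 'd \<Rightarrow> complex"
  assumes "entire F"
  shows "entire (fun_scale c F)"
  unfolding entire_def fun_scale_def
proof
  fix z
  obtain D where "(F has_derivative D) (at z)" "\<And>c v. D (c *s v) = c * D v"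
    using assms unfolding entire_def by blast
  then show "\<exists>D. ((\<lambda>z. c * F z) has_derivative D) (at z) \<and> (\<forall>c v. D (c *s v) = c * D v)"
    by (intro exI[of _ "\<lambda>v. c * D v"]) (auto intro!: has_derivative_mult_right)
qed

lemma entire_add:
  fixes F G :: "complex ^ 'd \<Rightarrow> complex"
  assumes "entire F" "entire G"
  shows "entire (F + G)"
  using entire_diff[OF assms(1) entire_scale[OF assms(2), of "-1"]]
  by (simp add: fun_scale_def plus_fun_def)

definition entire_functions :: "(complex ^ 'd \<Rightarrow> complex) set" where
  "entire_functions = Collect entire \<inter> finite_norm_functions"

theorem entire_functions_quasi_normed:
  "module.subspace fun_scale entire_functions"
  "quasi_norm_on C fun_scale entire_functions real_norm"
proof -
  show "module.subspace fun_scale entire_functions"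
    unfolding subspace_iff[OF vector_space_fun_scale] entire_functions_def
    by (auto intro: entire_add entire_scale entire_zero add_finite_norm(1) scale_finite_norm(1) zero_finite_norm)
  show "quasi_norm_on C fun_scale entire_functions real_norm"
    by (rule quasi_norm_on_finite_norm)
      (auto simp: entire_functions_def entire_wnorm_eq_0_iff zero_fun_def)
qed

theorem entire_functions_complete: "complete_wrt entire_functions real_norm"
  unfolding complete_wrt_def
proof (intro allI impI)
  fix u :: "nat \<Rightarrow> complex ^ 'd \<Rightarrow> complex"
  assume range: "range u \<subseteq> entire_functions"
    and Cauchy: "\<forall>\<epsilon>>0. \<exists>n\<^sub>0. \<forall>m\<ge>n\<^sub>0. \<forall>n\<ge>n\<^sub>0. real_norm (u m - u n) < \<epsilon>"
  have "u n \<in> entire_functions" for n using range by blast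
  then have u: "entire (u n)" "u n \<in> finite_norm_functions" for n by (simp_all add: entire_functions_def)
  obtain g where g: "entire g"
    and lim: "\<And>\<epsilon>. 0 < \<epsilon> \<Longrightarrow> \<exists>n\<^sub>0. \<forall>n\<ge>n\<^sub>0. wnorm (\<lambda>x. u n x - g x) \<le> ennreal \<epsilon>"
    by (rule entire_complete[OF u(1) wnorm_Cauchy[OF u(2) Cauchy]]) blast+
  note w = wnorm_limit[OF u(2) entire_measurable[OF g] lim]
  then show "\<exists>x\<in>entire_functions. (\<lambda>n. real_norm (u n - x)) \<longlonglongrightarrow> 0"
    using g by (auto simp: entire_functions_def)
qed

end

section \<open>The Bargmann transform\<close>

lemma mi_fact_pos: "0 < mi_fact \<alpha>"
  by (simp add: mi_fact_def prod_pos)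

definition bargmann_coeff :: "'d::finite hermite_series \<Rightarrow> ('d \<Rightarrow> nat) \<Rightarrow> complex" where
  "bargmann_coeff c \<alpha> = c \<alpha> / complex_of_real (sqrt (mi_fact \<alpha>))"

lemma bargmann_eq: "bargmann c = (\<lambda>z. \<Sum>\<^sub>\<infinity>\<alpha>. bargmann_coeff c \<alpha> * mi_power z \<alpha>)"
  by (simp add: bargmann_def[abs_def] bargmann_coeff_def)

lemma entire_coeffs_bargmann_coeff: "entire_coeffs (bargmann_coeff c) \<longleftrightarrow> c \<in> H_flat1'"
proof -
  have "norm (bargmann_coeff c \<alpha>) \<le> C * r ^ mi_abs \<alpha> \<longleftrightarrow> cmod (c \<alpha>) \<le> C * r ^ mi_abs \<alpha> * sqrt (mi_fact \<alpha>)" for C r \<alpha>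
    using mi_fact_pos[of \<alpha>] by (simp add: bargmann_coeff_def norm_divide pos_divide_le_eq)
  then show ?thesis by (simp add: entire_coeffs_def H_flat1'_def)
qed

lemma bargmann_has_sum:
  assumes "c \<in> H_flat1'"
  shows "((\<lambda>\<alpha>. bargmann_coeff c \<alpha> * mi_power z \<alpha>) has_sum bargmann c z) UNIV"
proof -
  have "norm (z $ i) \<le> norm z + 1" for i
    using Finite_Cartesian_Product.norm_nth_le[of z i] by simp
  then have "(\<lambda>\<alpha>. norm (bargmann_coeff c \<alpha> * mi_power z \<alpha>)) summable_on UNIV"
    using assms by (intro entire_coeffs_summable(2)[of _ z "norm z + 1"])
      (auto simp: entire_coeffs_bargmann_coeff add_nonneg_pos)
  then show ?thesis
    unfolding bargmann_eq by (intro has_sum_infsum) (rule abs_summable_summable)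
qed

lemma bargmann_entire: "c \<in> H_flat1' \<Longrightarrow> entire (bargmann c)"
  unfolding bargmann_eq by (rule entire_power_series) (simp add: entire_coeffs_bargmann_coeff)

text \<open>
  The Bargmann transform of \<open>c\<close> is the power series with coefficients \<open>c \<alpha> / sqrt (mi_fact \<alpha>)\<close>. Uniqueness of
  coefficients gives injectivity, and the expansion of entire functions gives surjectivity.
\<close>

theorem bargmann_bij_entire: "bij_betw bargmann (H_flat1' :: 'd::finite hermite_series set) (Collect entire)"
  unfolding bij_betw_def
proof
  show "inj_on bargmann (H_flat1' :: 'd hermite_series set)"
  proof (rule inj_onI)
    fix c c' :: "'d hermite_series"
    assume c: "c \<in> H_flat1'" and c': "c' \<in> H_flat1'" and eq: "bargmann c = bargmann c'"
    have coeff: "torus_coeff (bargmann c) 1 = bargmann_coeff c" if c: "c \<in> H_flat1'" for c :: "'d hermite_series"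
    proof
      fix \<beta>
      show "torus_coeff (bargmann c) 1 \<beta> = bargmann_coeff c \<beta>"
      proof (rule torus_coeff_power_series)
        show "continuous_on UNIV (bargmann c)" by (rule entire_imp_continuous[OF bargmann_entire[OF c]])
        show "(\<lambda>\<alpha>. norm (bargmann_coeff c \<alpha>) * 1 ^ mi_abs \<alpha>) summable_on UNIV"
          by (rule entire_coeffs_summable(1)[of _ 0]) (use c in \<open>auto simp: entire_coeffs_bargmann_coeff\<close>)
      qed (use bargmann_has_sum[OF c] in auto)
    qed
    have "bargmann_coeff c = bargmann_coeff c'" using coeff[OF c] coeff[OF c'] eq by simp
    then have "bargmann_coeff c \<alpha> = bargmann_coeff c' \<alpha>" for \<alpha> by simp
    then show "c = c'"
      using mi_fact_pos by (auto simp: bargmann_coeff_def fun_eq_iff less_le)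
  qed
  show "bargmann ` (H_flat1' :: 'd hermite_series set) = Collect entire"
  proof safe
    fix c :: "'d hermite_series" assume "c \<in> H_flat1'"
    then show "entire (bargmann c)" by (rule bargmann_entire)
  next
    fix F :: "complex ^ 'd \<Rightarrow> complex" assume F: "entire F"
    obtain b where b: "entire_coeffs b" "\<And>z. ((\<lambda>\<alpha>. b \<alpha> * mi_power z \<alpha>) has_sum F z) UNIV"
      using separately_holomorphic_power_series[OF entire_imp_separately_holomorphic[OF F]] by metis
    define c where "c \<alpha> = b \<alpha> * complex_of_real (sqrt (mi_fact \<alpha>))" for \<alpha>
    have bc: "bargmann_coeff c = b"
      using mi_fact_pos by (auto simp: bargmann_coeff_def c_def fun_eq_iff less_le)
    have "c \<in> H_flat1'" using b(1) by (simp add: bc flip: entire_coeffs_bargmann_coeff)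
    moreover have "F = bargmann c"
      unfolding bargmann_eq bc using infsumI[OF b(2)] by auto
    ultimately show "F \<in> bargmann ` H_flat1'" by blast
  qed
qed

lemma bargmann_add:
  assumes "c \<in> H_flat1'" "c' \<in> H_flat1'"
  shows "bargmann (c + c') = bargmann c + bargmann c'"
proof
  fix z
  have "((\<lambda>\<alpha>. bargmann_coeff c \<alpha> * mi_power z \<alpha> + bargmann_coeff c' \<alpha> * mi_power z \<alpha>) has_sum
      (bargmann c z + bargmann c' z)) UNIV"
    by (intro has_sum_add bargmann_has_sum assms)
  moreover have "bargmann_coeff (c + c') \<alpha> * mi_power z \<alpha>
      = bargmann_coeff c \<alpha> * mi_power z \<alpha> + bargmann_coeff c' \<alpha> * mi_power z \<alpha>" for \<alpha>
    by (simp add: bargmann_coeff_def add_divide_distrib distrib_right)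
  ultimately show "bargmann (c + c') z = (bargmann c + bargmann c') z"
    unfolding bargmann_eq[of "c + c'"] by (simp add: infsumI)
qed

lemma bargmann_scale:
  assumes "c \<in> H_flat1'"
  shows "bargmann (fun_scale k c) = fun_scale k (bargmann c)"
proof
  fix z
  have "((\<lambda>\<alpha>. k * (bargmann_coeff c \<alpha> * mi_power z \<alpha>)) has_sum (k * bargmann c z)) UNIV"
    by (intro has_sum_cmult_right bargmann_has_sum assms)
  then show "bargmann (fun_scale k c) z = fun_scale k (bargmann c) z"
    unfolding bargmann_eq[of "fun_scale k c"]
    by (simp add: infsumI bargmann_coeff_def fun_scale_def mult.assoc)
qed

lemma subspace_H_flat1': "module.subspace fun_scale (H_flat1' :: 'd::finite hermite_series set)"
  unfolding subspace_iff[OF vector_space_fun_scale]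
proof (intro conjI ballI allI)
  show "(0 :: 'd hermite_series) \<in> H_flat1'"
    by (auto simp: H_flat1'_def mi_fact_def prod_nonneg intro!: exI[of _ 1])
  fix c c' :: "'d hermite_series" and k :: complex
  assume c: "c \<in> H_flat1'"
  show "fun_scale k c \<in> H_flat1'"
    unfolding H_flat1'_def
  proof (safe)
    fix r :: real assume "0 < r"
    then obtain C where C: "C > 0" "\<And>\<alpha>. cmod (c \<alpha>) \<le> C * r ^ mi_abs \<alpha> * sqrt (mi_fact \<alpha>)"
      using c by (auto simp: H_flat1'_def)
    have "cmod (fun_scale k c \<alpha>) \<le> ((cmod k + 1) * C) * r ^ mi_abs \<alpha> * sqrt (mi_fact \<alpha>)" for \<alpha>
    proof -
      have "cmod k * cmod (c \<alpha>) \<le> (cmod k + 1) * (C * r ^ mi_abs \<alpha> * sqrt (mi_fact \<alpha>))"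
        using C(2)[of \<alpha>] by (intro mult_mono) auto
      then show ?thesis by (simp add: fun_scale_def norm_mult mult.assoc)
    qed
    then show "\<exists>C>0. \<forall>\<alpha>. cmod (fun_scale k c \<alpha>) \<le> C * r ^ mi_abs \<alpha> * sqrt (mi_fact \<alpha>)"
      using C(1) by (intro exI[of _ "(cmod k + 1) * C"]) (auto intro!: mult_pos_pos add_nonneg_pos)
  qed
  assume c': "c' \<in> H_flat1'"
  show "c + c' \<in> H_flat1'"
    unfolding H_flat1'_def
  proof (safe)
    fix r :: real assume "0 < r"
    then obtain C C' where C: "C > 0" "\<And>\<alpha>. cmod (c \<alpha>) \<le> C * r ^ mi_abs \<alpha> * sqrt (mi_fact \<alpha>)"
      and C': "C' > 0" "\<And>\<alpha>. cmod (c' \<alpha>) \<le> C' * r ^ mi_abs \<alpha> * sqrt (mi_fact \<alpha>)"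
      using c c' by (auto simp: H_flat1'_def) metis
    have "cmod ((c + c') \<alpha>) \<le> (C + C') * r ^ mi_abs \<alpha> * sqrt (mi_fact \<alpha>)" for \<alpha>
      using norm_triangle_ineq[of "c \<alpha>" "c' \<alpha>"] C(2)[of \<alpha>] C'(2)[of \<alpha>]
      by (simp add: distrib_right)
    then show "\<exists>C>0. \<forall>\<alpha>. cmod ((c + c') \<alpha>) \<le> C * r ^ mi_abs \<alpha> * sqrt (mi_fact \<alpha>)"
      using C(1) C'(1) by (intro exI[of _ "C + C'"]) auto
  qed
qed

section \<open>The spaces of the theorem\<close>

lemma mixed_quasi_norm_space_admissible:
  assumes "mixed_quasi_norm_space \<B>"
  shows "admissible \<B>" "spanning \<B>"
  using assms
  by (auto simp: mixed_quasi_norm_space_def admissible_def spanning_def direct_sum_decomposition_def)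

text \<open>
  The setting of the theorem. For the rest of the argument the spaces are identified with the abstract
  spaces of functions of finite quasi-norm on \<open>complex ^ 'd\<close>.
\<close>

locale weighted_phase_space =
  fixes \<omega> :: "(real ^ 'd) \<times> (real ^ 'd) \<Rightarrow> real"
    and \<B> :: "((real ^ 'd) \<times> (real ^ 'd)) mixed_space"
    and r :: ennreal
  assumes weight: "weight \<omega>" and mixed: "mixed_quasi_norm_space \<B>"
    and r: "0 < r" "r \<le> \<nu>\<^sub>1 \<B>"
begin

lemma weight_pos: "0 < \<omega> X"
  using weight unfolding weight_def by blast

lemma r_le_exponent: "p \<in> set (map fst \<B>) \<Longrightarrow> r \<le> p"
  using r(2) unfolding \<nu>\<^sub>1_def by (meson List.finite_set Min_le order_trans)

text \<open>
  Some positive exponent that is at most one and at most every exponent of \<open>\<B>\<close>; since \<open>r\<close> may be infinite it is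
  truncated.
\<close>

definition local_exponent :: real where
  "local_exponent = enn2real (min 1 r)"

lemma local_exponent: "0 < local_exponent" "local_exponent \<le> 1"
  "p \<in> set (map fst \<B>) \<Longrightarrow> ennreal local_exponent \<le> p"
proof -
  have e: "ennreal local_exponent = min 1 r"
    unfolding local_exponent_def by (intro ennreal_enn2real) (auto simp: min_less_iff_disj)
  have "0 < ennreal local_exponent" unfolding e using r(1) by simp
  then show "0 < local_exponent" by simp
  have "ennreal local_exponent \<le> ennreal 1" unfolding e by simp
  then show "local_exponent \<le> 1" by simp
  show "p \<in> set (map fst \<B>) \<Longrightarrow> ennreal local_exponent \<le> p"
    unfolding e using r_le_exponent by (meson min.cobounded2 order_trans)
qed

text \<open>
  The mixed quasi-norm of phase space, read on \<open>complex ^ 'd\<close>.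
\<close>

definition point_norm :: "(complex ^ 'd \<Rightarrow> ennreal) \<Rightarrow> ennreal" where
  "point_norm f = mixed_qnorm \<B> (\<lambda>X. f (complex_point X))"

lemma weighted_function_qnorm_point_norm:
  assumes "0 < s" "\<And>p. p \<in> set (map fst \<B>) \<Longrightarrow> ennreal s \<le> p"
  shows "weighted_function_qnorm point_norm (mixed_triangle_const \<B>) s (phase_weight \<omega>)"
proof -
  note \<B> = mixed_quasi_norm_space_admissible[OF mixed]
  have "function_qnorm point_norm (mixed_triangle_const \<B>) s"
    unfolding point_norm_def[abs_def]
    by (rule function_qnorm_mixed[OF \<B> linear_complex_point surj_complex_point assms])
  then show ?thesis
    unfolding weighted_function_qnorm_def weighted_function_qnorm_axioms_def
    using phase_weight_bounded_below[OF weight] phase_weight_measurable[of \<omega>] weight weight_pos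
    by (simp add: weight_def Lp_loc_def phase_weight_def[of \<omega>] U_factor_nonzero)
qed

sublocale entire_function_qnorm point_norm "mixed_triangle_const \<B>" local_exponent "phase_weight \<omega>"
  using weighted_function_qnorm_point_norm[OF local_exponent(1,3)] local_exponent(2)
  by (simp add: entire_function_qnorm_def entire_function_qnorm_axioms_def)

lemma B_qnorm_eq_wnorm: "B_qnorm \<omega> \<B> F = wnorm F"
proof -
  have "cmod (inv U_op F X * complex_of_real (\<omega> X))
      = cmod (F (complex_point X)) * phase_weight \<omega> (complex_point X)" for X
    by (simp add: inv_U_op phase_weight_def norm_mult norm_divide abs_of_pos[OF weight_pos])
  then show ?thesis
    by (simp add: B_qnorm_def phase_qnorm_def wnorm_def point_norm_def)
qed

text \<open>
  For finite \<open>r\<close> the local bound is used with \<open>s = r\<close>. If \<open>r\<close> is infinite, then so are all exponents and the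
  weighted function is essentially bounded.
\<close>

lemma finite_norm_imp_Lp_loc:
  assumes F: "F \<in> finite_norm_functions"
  shows "F \<in> Lp_loc r"
proof -
  have Fm[measurable]: "F \<in> borel_measurable lebesgue" and fin: "wnorm F < \<infinity>"
    using F by (auto simp: finite_norm_functions_def)
  have "Lp_qnorm (lebesgue_on K) r (\<lambda>z. ennreal (norm (F z))) < \<infinity>" if K: "compact K" for K
  proof (cases "r = \<infinity>")
    case False
    define s where "s = enn2real r"
    have s: "ennreal s = r" "0 < s"
      using False r(1) by (auto simp: s_def less_top enn2real_positive_iff)
    interpret r: weighted_function_qnorm point_norm "mixed_triangle_const \<B>" s "phase_weight \<omega>"
      by (rule weighted_function_qnorm_point_norm) (use s r_le_exponent in auto)
    obtain D where D: "D < \<infinity>" "(\<integral>\<^sup>+z. ennreal (cmod (F z) powr s) * indicator K z \<partial>lebesgue)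
        \<le> D * ennreal_powr (wnorm F) s"
      using r.nn_integral_le_wnorm[OF K] Fm by blast
    have "(\<integral>\<^sup>+z. ennreal_powr (ennreal (norm (F z))) s \<partial>lebesgue_on K)
        = (\<integral>\<^sup>+z. ennreal (cmod (F z) powr s) * indicator K z \<partial>lebesgue)"
      using K by (subst nn_integral_restrict_space) (auto simp: ennreal_powr_ennreal borel_compact)
    also have "\<dots> < \<infinity>"
      using D fin by (auto simp: ennreal_mult_less_top intro: le_less_trans)
    finally show ?thesis
      using False by (simp add: Lp_qnorm_eq s_def)
  next
    case True
    note \<B> = mixed_quasi_norm_space_admissible[OF mixed]
    have p: "p = \<infinity>" if "p \<in> set (map fst \<B>)" for p
      using r_le_exponent[OF that] True by (simp add: top_unique)
    have "(\<lambda>z. ennreal (cmod (F z) * phase_weight \<omega> z)) \<in> borel_measurable lebesgue" by measurable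
    then obtain g where g: "g \<in> borel_measurable borel"
      and ae: "AE z in lebesgue. ennreal (cmod (F z) * phase_weight \<omega> z) = g z"
      by (rule borel_representative)
    have "AE z in lborel. g z \<le> point_norm g"
      unfolding point_norm_def
      by (rule AE_le_mixed_qnorm_infinity[OF \<B> linear_complex_point surj_complex_point p g])
    then have "AE z in lebesgue. g z \<le> wnorm F"
      by (simp add: AE_completion_iff wnorm_def cong_AE[OF ae])
    moreover obtain m where m: "wnorm F = ennreal m" "0 \<le> m" using fin by (cases "wnorm F") auto
    ultimately have "AE z in lebesgue. g z \<le> ennreal m" by simp
    then have le: "AE z in lebesgue. cmod (F z) * phase_weight \<omega> z \<le> m"
      using ae
    proof eventually_elim
      case (elim z)
      then have "ennreal (cmod (F z) * phase_weight \<omega> z) \<le> ennreal m" by (simp add: m)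
      then show ?case using m by simp
    qed
    obtain M where M: "M > 0" "AE z in lebesgue. z \<in> K \<longrightarrow> 1 \<le> M * phase_weight \<omega> z"
      using W_below[OF K] by blast
    have "AE z in lebesgue. z \<in> K \<longrightarrow> ennreal (norm (F z)) \<le> ennreal (M * m)"
      using le M(2)
    proof eventually_elim
      case (elim z)
      show ?case
      proof
        assume "z \<in> K"
        then have "cmod (F z) * 1 \<le> cmod (F z) * (M * phase_weight \<omega> z)"
          using elim by (intro mult_left_mono) auto
        also have "\<dots> = M * (cmod (F z) * phase_weight \<omega> z)" by simp
        also have "\<dots> \<le> M * m" using elim M(1) by (intro mult_left_mono) auto
        finally show "ennreal (norm (F z)) \<le> ennreal (M * m)" by (simp add: ennreal_leI)
      qed
    qed
    then have "AE z in lebesgue_on K. ennreal (norm (F z)) \<le> ennreal (M * m)"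
      using K by (subst AE_restrict_space_iff) (auto simp: borel_compact)
    moreover have "(\<lambda>z. ennreal (norm (F z))) \<in> borel_measurable (lebesgue_on K)"
      by (intro measurable_restrict_space1) measurable
    ultimately have "esssup (lebesgue_on K) (\<lambda>z. ennreal (norm (F z))) \<le> ennreal (M * m)"
      by (intro esssup_I)
    then show ?thesis using True by (auto simp: Lp_qnorm_eq intro: le_less_trans)
  qed
  then show ?thesis by (simp add: Lp_loc_def)
qed

lemma B_functions_eq: "B_functions r \<omega> \<B> = finite_norm_functions"
  using finite_norm_imp_Lp_loc
  by (auto simp: B_functions_def B_qnorm_eq_wnorm finite_norm_functions_def Lp_loc_def)

lemma A_space_eq: "A_space r \<omega> \<B> = entire_functions"
  by (simp add: A_space_def entire_functions_def B_functions_eq)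

lemma A_norm_eq: "A_norm \<omega> \<B> = real_norm"
  by (simp add: fun_eq_iff A_norm_def real_norm_def B_qnorm_eq_wnorm)

lemma B_space_eq: "B_space r \<omega> \<B> = norm_classes"
  by (simp add: B_space_def norm_classes_def B_functions_eq)

lemma B_norm_eq: "B_norm \<omega> \<B> = (\<lambda>f. real_norm (rep_ae_fun f))"
  by (simp add: fun_eq_iff B_norm_def real_norm_def B_qnorm_eq_wnorm)

lemma M_norm_eq: "M_norm \<omega> \<B> c = A_norm \<omega> \<B> (bargmann c)"
  by (simp add: M_norm_def A_norm_def B_qnorm_def stft_def)

lemma M_space_iff: "c \<in> M_space \<omega> \<B> \<longleftrightarrow> c \<in> H_flat1' \<and> bargmann c \<in> A_space r \<omega> \<B>"
proof -
  have "phase_qnorm \<omega> \<B> (stft c) = wnorm (bargmann c)"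
    by (simp add: stft_def flip: B_qnorm_def B_qnorm_eq_wnorm)
  then show ?thesis
    by (auto simp: M_space_def A_space_eq entire_functions_def finite_norm_functions_def
        entire_measurable bargmann_entire)
qed

lemma bargmann_bij: "bij_betw bargmann (M_space \<omega> \<B>) (A_space r \<omega> \<B>)"
proof -
  have "M_space \<omega> \<B> \<subseteq> H_flat1'" using M_space_iff by blast
  moreover have "bargmann ` M_space \<omega> \<B> = A_space r \<omega> \<B>"
  proof
    show "A_space r \<omega> \<B> \<subseteq> bargmann ` M_space \<omega> \<B>"
    proof
      fix F assume F: "F \<in> A_space r \<omega> \<B>"
      then have "F \<in> bargmann ` H_flat1'"
        using bargmann_bij_entire by (auto simp: bij_betw_def A_space_eq entire_functions_def)
      with F show "F \<in> bargmann ` M_space \<omega> \<B>" by (auto simp: M_space_iff)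
    qed
  qed (auto simp: M_space_iff)
  ultimately show ?thesis
    using bargmann_bij_entire by (auto simp: bij_betw_def intro: inj_on_subset)
qed

lemma subspace_M: "module.subspace fun_scale (M_space \<omega> \<B>)"
proof -
  note A = entire_functions_quasi_normed(1)[unfolded subspace_iff[OF vector_space_fun_scale], folded A_space_eq]
  note H = subspace_H_flat1'[unfolded subspace_iff[OF vector_space_fun_scale]]
  have "bargmann (0 :: 'd hermite_series) = 0"
    using bargmann_add[of "0 :: 'd hermite_series" 0] H by auto
  then show ?thesis
    unfolding subspace_iff[OF vector_space_fun_scale] M_space_iff
    using A H by (auto simp: bargmann_add bargmann_scale M_space_iff)
qed

lemma bargmann_diff:
  assumes "c \<in> M_space \<omega> \<B>" "c' \<in> M_space \<omega> \<B>"
  shows "bargmann (c - c') = bargmann c - bargmann c'"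
proof -
  have H: "c \<in> H_flat1'" "c' \<in> H_flat1'" using assms by (auto simp: M_space_iff)
  then have "fun_scale (-1) c' \<in> H_flat1'"
    using subspace_H_flat1' by (auto simp: subspace_iff[OF vector_space_fun_scale])
  then have "bargmann (c + fun_scale (-1) c') = bargmann c + fun_scale (-1) (bargmann c')"
    using H by (simp add: bargmann_add bargmann_scale)
  then show ?thesis by (simp add: fun_scale_def plus_fun_def fun_diff_def)
qed

lemma bargmann_isometric: "isometric_on (M_space \<omega> \<B>) (M_norm \<omega> \<B>) (A_norm \<omega> \<B>) bargmann"
  unfolding isometric_on_def by (simp add: M_norm_eq bargmann_diff)

theorem A_space_complete_quasi_normed:
  "module.subspace fun_scale (A_space r \<omega> \<B>)"
  "quasi_norm_on (mixed_triangle_const \<B>) fun_scale (A_space r \<omega> \<B>) (A_norm \<omega> \<B>)"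
  "complete_wrt (A_space r \<omega> \<B>) (A_norm \<omega> \<B>)"
  unfolding A_space_eq A_norm_eq
  by (rule entire_functions_quasi_normed entire_functions_complete)+

theorem B_space_complete_quasi_normed:
  "module.subspace ae_scale (B_space r \<omega> \<B>)"
  "quasi_norm_on (mixed_triangle_const \<B>) ae_scale (B_space r \<omega> \<B>) (B_norm \<omega> \<B>)"
  "complete_wrt (B_space r \<omega> \<B>) (B_norm \<omega> \<B>)"
  unfolding B_space_eq B_norm_eq
  by (rule classes_quasi_normed classes_complete)+

theorem M_space_complete_quasi_normed:
  "quasi_norm_on (mixed_triangle_const \<B>) fun_scale (M_space \<omega> \<B>) (M_norm \<omega> \<B>)"
  "complete_wrt (M_space \<omega> \<B>) (M_norm \<omega> \<B>)"
proof -
  show "quasi_norm_on (mixed_triangle_const \<B>) fun_scale (M_space \<omega> \<B>) (M_norm \<omega> \<B>)"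
  proof (rule transport_quasi_norm_on[OF _ _ bargmann_bij _ M_norm_eq A_space_complete_quasi_normed(2)])
    show "0 \<in> M_space \<omega> \<B>" using subspace_M by (simp add: subspace_iff[OF vector_space_fun_scale])
  qed (auto simp: M_space_iff bargmann_add bargmann_scale)
  show "complete_wrt (M_space \<omega> \<B>) (M_norm \<omega> \<B>)"
    by (rule transport_complete_wrt[OF bargmann_diff bargmann_bij M_norm_eq A_space_complete_quasi_normed(3)])
qed

end

theorem theorem4p8:
  fixes \<omega> :: "(real ^ 'd) \<times> (real ^ 'd) \<Rightarrow> real"
    and \<B> :: "((real ^ 'd) \<times> (real ^ 'd)) mixed_space"
    and r :: ennreal
  assumes "weight \<omega>"
    and "mixed_quasi_norm_space \<B>"
    and "0 < r" and "r \<le> \<nu>\<^sub>1 \<B>"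
  shows "(quasi_banach_space fun_scale (A_space r \<omega> \<B>) (A_norm \<omega> \<B>) \<and>
          quasi_banach_space ae_scale (B_space r \<omega> \<B>) (B_norm \<omega> \<B>) \<and>
          quasi_banach_space fun_scale (M_space \<omega> \<B>) (M_norm \<omega> \<B>)) \<and>
         (\<nu>\<^sub>1 \<B> \<ge> 1 \<longrightarrow>
          banach_space fun_scale (A_space r \<omega> \<B>) (A_norm \<omega> \<B>) \<and>
          banach_space ae_scale (B_space r \<omega> \<B>) (B_norm \<omega> \<B>) \<and>
          banach_space fun_scale (M_space \<omega> \<B>) (M_norm \<omega> \<B>)) \<and>
         bij_betw bargmann (M_space \<omega> \<B>) (A_space r \<omega> \<B>) \<and>
         isometric_on (M_space \<omega> \<B>) (M_norm \<omega> \<B>) (A_norm \<omega> \<B>) bargmann"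
proof -
  interpret weighted_phase_space \<omega> \<B> r by standard (fact assms)+
  note facts = A_space_complete_quasi_normed B_space_complete_quasi_normed
    M_space_complete_quasi_normed subspace_M
  have "mixed_triangle_const \<B> = 1" if "1 \<le> \<nu>\<^sub>1 \<B>"
  proof (rule mixed_triangle_const_eq_1)
    fix p assume "p \<in> set (map fst \<B>)"
    then have "\<nu>\<^sub>1 \<B> \<le> p" unfolding \<nu>\<^sub>1_def by (intro Min_le) auto
    with that show "1 \<le> p" by (rule order_trans)
  qed
  then show ?thesis
    unfolding quasi_banach_space_def banach_space_def
    using facts mixed_triangle_const_ge_1[of \<B>] bargmann_bij bargmann_isometric
    by (auto simp: vector_space_fun_scale vector_space_ae_scale)
qed

end
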